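(* Let $1\le p\le\infty$, $\alpha>\max(-1/p,-1/2)$, $\gamma>1/3$ with $(\gamma,\alpha)\in\mathcal{D}'$, $v_0\in\mathcal{F}L^{\alpha,p}$, and let $v:[0,T]\to\mathcal{F}L^{\alpha,p}$ be the unique $\gamma$-Hölder path with $v(0)=v_0$ and $v_t=v_s+X_{ts}(v_s,v_s)+X^2_{ts}(v_s,v_s,v_s)+o(|t-s|)$, $T>0$ being its existence time. For $n\ge1$ define $y^n_0=v_0$ and $y^n_i=y^n_{i-1}+X_{i/n,(i-1)/n}(y^n_{i-1},y^n_{i-1})+X^2_{i/n,(i-1)/n}(y^n_{i-1},y^n_{i-1},y^n_{i-1})$ for $i\ge1$, and $\Delta^n_i=y^n_i-v_{i/n}$. Then $$\sup_{0\le i<j\le nT}\frac{|\Delta^n_i-\Delta^n_j|_{\mathcal{F}L^{\alpha,p}}}{|i-j|^\gamma}=O(n^{1-3\gamma}).$$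
   Context: $\mathbb{T}=[-\pi,\pi]$, $f=\sum_k\hat f(k)e^{ik\xi}$; $\mathcal{F}L^{\alpha,p}$: real distributions with $\hat f(0)=0$, $\|\langle k\rangle^\alpha\hat f(k)\|_{\ell^p}<\infty$, $\langle x\rangle=(1+x^2)^{1/2}$. $\dot X_\sigma$: $\widehat{\dot X_\sigma(\varphi_1,\varphi_2)}(k)=\frac{ik}{2}\sum_{k_1\ne0,k}e^{-3ikk_1k_2\sigma}\hat\varphi_1(k_1)\hat\varphi_2(k_2)$, $k_2=k-k_1$; $X_{ts}=\int_s^t\dot X_\sigma d\sigma$, $\widehat{X_{ts}(\varphi_1,\varphi_2)}(k)=\sum_{k_1\ne0,k}\frac{e^{-3ikk_1k_2s}-e^{-3ikk_1k_2t}}{6k_1k_2}\hat\varphi_1(k_1)\hat\varphi_2(k_2)$; $X^2_{ts}(\varphi_1,\varphi_2,\varphi_3)=2\int_s^td\sigma\int_s^\sigma d\sigma_1\dot X_\sigma(\varphi_1,\dot X_{\sigma_1}(\varphi_2,\varphi_3))$. $\mathcal{D}$: for $2\le p\le\infty$, $\{\alpha\ge-\tfrac12-\tfrac1p+\gamma,0\le\gamma<\tfrac14\}\cup\{\alpha>-1-\tfrac1p+3\gamma,\tfrac14\le\gamma\le\tfrac12\}$; for $1\le p\le2$, $\{\alpha\ge-1+\gamma,0\le\gamma<\tfrac1{2p}\}\cup\{\alpha>-1-\tfrac1p+3\gamma,\tfrac1{2p}\le\gamma\le\tfrac12\}$; $\mathcal{D}'=\mathcal{D}\cap\{\alpha>\max(-1/p,-1/2)\}$.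 "$o(|t-s|)$": the remainder $R_{ts}$ satisfies $\sup_{|t-s|\le h}|R_{ts}|/h\to0$. *)

theory Defs
  imports "HOL-Analysis.Analysis"
begin

text \<open>Distributions on the torus are represented by their Fourier coefficients.\<close>
type_synonym fser = "int \<Rightarrow> complex"

definition jbr :: "int \<Rightarrow> real" where
  "jbr k = sqrt (1 + (real_of_int k)\<^sup>2)"

definition FLnorm :: "real \<Rightarrow> ereal \<Rightarrow> fser \<Rightarrow> ennreal" where
  "FLnorm \<alpha> p f =
     (if p = \<infinity> then (SUP k. ennreal (jbr k powr \<alpha> * cmod (f k)))
      else (let q = real_of_ereal p;
                g = (\<lambda>k. (jbr k powr \<alpha> * cmod (f k)) powr q)
            in if g summable_on UNIV then ennreal ((infsum g UNIV) powr (1 / q)) else top))"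

text \<open>The space FL^{alpha,p}: real distributions with zero mean and finite norm.\<close>
definition FL :: "real \<Rightarrow> ereal \<Rightarrow> fser set" where
  "FL \<alpha> p = {f. f 0 = 0 \<and> (\<forall>k. f (- k) = cnj (f k)) \<and> FLnorm \<alpha> p f < top}"

definition Xop :: "real \<Rightarrow> real \<Rightarrow> fser \<Rightarrow> fser \<Rightarrow> fser" where
  "Xop t s \<phi>1 \<phi>2 = (\<lambda>k. \<Sum>\<^sub>\<infinity>k1\<in>{k1. k1 \<noteq> 0 \<and> k1 \<noteq> k}.
      (exp (- 3 * \<i> * of_int (k * k1 * (k - k1)) * of_real s)
        - exp (- 3 * \<i> * of_int (k * k1 * (k - k1)) * of_real t))
      / of_int (6 * k1 * (k - k1)) * \<phi>1 k1 * \<phi>2 (k - k1))"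

definition sint :: "real \<Rightarrow> real \<Rightarrow> (real \<Rightarrow> complex) \<Rightarrow> complex" where
  "sint a b f = (if a \<le> b then integral {a..b} f else - integral {b..a} f)"

text \<open>X^2_{ts}(phi1,phi2,phi3) = 2 int_s^t dsigma int_s^sigma dsigma1
  Xdot_sigma(phi1, Xdot_sigma1(phi2,phi3)), computed Fourier-coefficientwise
  (time integrals taken inside the frequency sums).\<close>
definition X2op :: "real \<Rightarrow> real \<Rightarrow> fser \<Rightarrow> fser \<Rightarrow> fser \<Rightarrow> fser" where
  "X2op t s \<phi>1 \<phi>2 \<phi>3 = (\<lambda>k. infsum (\<lambda>(k1, k3).
      let k2 = k - k1; k4 = k2 - k3 in
      2 * sint s t (\<lambda>\<sigma>. sint s \<sigma> (\<lambda>\<sigma>1.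
             (\<i> * of_int k / 2) * exp (- 3 * \<i> * of_int (k * k1 * k2) * of_real \<sigma>)
           * (\<i> * of_int k2 / 2) * exp (- 3 * \<i> * of_int (k2 * k3 * k4) * of_real \<sigma>1)))
        * \<phi>1 k1 * \<phi>2 k3 * \<phi>3 k4)
     {(k1, k3). k1 \<noteq> 0 \<and> k1 \<noteq> k \<and> k3 \<noteq> 0 \<and> k3 \<noteq> k - k1})"

fun yseq :: "nat \<Rightarrow> fser \<Rightarrow> nat \<Rightarrow> fser" where
  "yseq n v0 0 = v0"
| "yseq n v0 (Suc i) =
     (let y = yseq n v0 i; t = real (Suc i) / real n; s = real i / real n
      in (\<lambda>k. y k + Xop t s y y k + X2op t s y y y k))"

definition invp :: "ereal \<Rightarrow> real" where
  "invp p = (if p = \<infinity> then 0 else 1 / real_of_ereal p)"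

definition inD :: "ereal \<Rightarrow> real \<Rightarrow> real \<Rightarrow> bool" where
  "inD p \<gamma> \<alpha> \<longleftrightarrow>
     (2 \<le> p \<and> ((\<alpha> \<ge> -1/2 - invp p + \<gamma> \<and> 0 \<le> \<gamma> \<and> \<gamma> < 1/4)
               \<or> (\<alpha> > -1 - invp p + 3 * \<gamma> \<and> 1/4 \<le> \<gamma> \<and> \<gamma> \<le> 1/2)))
   \<or> (1 \<le> p \<and> p \<le> 2 \<and> ((\<alpha> \<ge> -1 + \<gamma> \<and> 0 \<le> \<gamma> \<and> \<gamma> < invp p / 2)
               \<or> (\<alpha> > -1 - invp p + 3 * \<gamma> \<and> invp p / 2 \<le> \<gamma> \<and> \<gamma> \<le> 1/2)))"

definition inDprime :: "ereal \<Rightarrow> real \<Rightarrow> real \<Rightarrow> bool" where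
  "inDprime p \<gamma> \<alpha> \<longleftrightarrow> inD p \<gamma> \<alpha> \<and> \<alpha> > max (- invp p) (- 1/2)"

end

theory Submission
  imports Defs "HOL-Library.Function_Algebras"
begin

text \<open>
  A path is a solution when it satisfies \<open>v\<^sub>t = step v\<^sub>s + R\<^sub>t\<^sub>s\<close> with a small remainder. Chen's
  relation makes \<open>R\<close> additive up to terms of order \<open>|t - s|\<^sup>3\<^sup>\<gamma>\<close>, and since \<open>3\<gamma> > 1\<close> the (discrete)
  sewing argument upgrades \<open>R = o(|t - s|)\<close> to \<open>R = O(|t - s|\<^sup>3\<^sup>\<gamma>)\<close>. The remainders of the scheme and
  of the solution differ over one step by \<open>O(n\<^sup>-\<^sup>3\<^sup>\<gamma>)\<close>; sewing their difference shows, on a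
  time window whose length does not depend on \<open>n\<close>, that the error is at most twice its initial value
  plus \<open>O(n\<^sup>1\<^sup>-\<^sup>3\<^sup>\<gamma>)\<close>, and finitely many windows cover \<open>[0, T]\<close>. As \<open>|i - j|\<^sup>\<gamma> \<ge> 1\<close>, this uniform bound
  is all that is needed.

  The analytic input is that \<open>X\<^sub>t\<^sub>s\<close> and \<open>X\<^sup>2\<^sub>t\<^sub>s\<close> are bounded multilinear operators with norms
  \<open>O(|t - s|\<^sup>\<gamma>)\<close> and \<open>O(|t - s|\<^sup>2\<^sup>\<gamma>)\<close>. For \<open>X\<^sup>2\<close> the two phases \<open>\<Phi>\<close>, \<open>\<Psi>\<close> add up to
  \<open>3 k\<^sub>2 (k - k\<^sub>3)(k - k\<^sub>4)\<close>. If \<open>|\<Phi> + \<Psi>| \<ge> |\<Phi>|/2\<close>, the kernel is dominated by the composition of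
  two kernels of \<open>X\<close>; if \<open>0 < |\<Phi> + \<Psi>| < |\<Phi>|/2\<close>, the frequencies are paired up and Hoelder's
  inequality in two suitable frequencies suffices; if \<open>\<Phi> + \<Psi> = 0\<close>, the sum decouples.
\<close>

section \<open>Sewing and stability of one-step schemes\<close>

text \<open>Nothing bounds the iterates in advance, and the one-step map is quadratic and cubic, so
  its Lipschitz constants grow with its argument. Each window is therefore run under the proviso
  that the error stays below 1, which frees the constants from the iterates. As
  \<open>n powr (1 - 3 * \<gamma>)\<close> tends to 0, the proviso survives a fixed number of
  doublings once \<open>n\<close> is large; hence the estimate from some \<open>n\<close> on. On the
  analytic side, put u = 1/p. Kernels and weights leave a decay of order z = \<alpha> + 2 -
  3\<gamma>, and the hypotheses give z > 1 - u: the sequence <k>^(-z) lies in the space conjugate to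
  \<ell>^p. The non-resonant estimates consist in placing this decay on frequencies that, together
  with others, determine the summation index. The obstacle is the near-resonant region, where \<Phi>
  + \<Psi> may be far smaller than \<Phi> and \<Psi> and the double integral does not split into two
  gains: a single oscillatory integral has to supply the whole power 2\<gamma> of time, and the lost
  decay is recovered from the arithmetic of the frequencies.\<close>

lemma discrete_sewing:
  fixes f :: "nat \<Rightarrow> nat \<Rightarrow> real"
  assumes beta: "\<beta> > 1" and M: "M \<ge> 0"
    and unit: "\<And>i. a \<le> i \<Longrightarrow> i < b \<Longrightarrow> f i (Suc i) \<le> r"
    and split: "\<And>i k j. a \<le> i \<Longrightarrow> i < k \<Longrightarrow> k < j \<Longrightarrow> j \<le> b \<Longrightarrow>
        f i j \<le> f i k + f k j + M * real (j - i) powr \<beta>"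
  assumes "a \<le> i" "i < j" "j \<le> b"
  shows "f i j \<le> M / (1 - (2/3) powr (\<beta> - 1)) * real (j - i) powr \<beta> + real (j - i) * r"
  using assms(5-7)
proof (induction "j - i" arbitrary: i j rule: less_induct)
  case less
  \<comment> \<open>Bisecting an integer interval of length at least 2 leaves pieces of at most two
    thirds of its length, the extreme case being 3 = 1 + 2. Since \<beta> > 1, the sum of the
    \<beta>-th powers shrinks by \<open>q < 1\<close>.\<close>
  define q :: real where "q = (2/3) powr (\<beta> - 1)"
  have q: "0 < q" "q < 1"
    using beta powr_less_mono2[of "\<beta> - 1" "2/3" 1] by (auto simp: q_def)
  \<comment> \<open>The fixed point of c = c q + M, so the constant reproduces itself under
    bisection.\<close>
  define c where "c = M / (1 - q)"
  have c: "c \<ge> 0" "c * q + M = c"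
    using q M by (auto simp: c_def field_simps)
  show ?case
  proof (cases "j = Suc i")
    case True
    then show ?thesis
      using unit[of i] less.prems c by (simp add: q_def c_def)
  next
    case False
    define k where "k = i + (j - i) div 2"
    have k: "i < k" "k < j" "3 * (k - i) \<le> 2 * (j - i)" "3 * (j - k) \<le> 2 * (j - i)"
      "(k - i) + (j - k) = j - i"
      using False less.prems by (auto simp: k_def)
    define x y m where "x = real (k - i)" and "y = real (j - k)" and "m = real (j - i)"
    have xy: "0 < x" "0 < y" "x \<le> 2/3 * m" "y \<le> 2/3 * m" "x + y = m" "m > 0"
      using k by (auto simp: x_def y_def m_def)
    have pow: "w powr \<beta> \<le> w * (q * m powr (\<beta> - 1))" if "0 < w" "w \<le> 2/3 * m" for w
    proof -
      have "w powr \<beta> = w * w powr (\<beta> - 1)"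
        using that by (simp add: powr_mult_base)
      also have "w powr (\<beta> - 1) \<le> (2/3 * m) powr (\<beta> - 1)"
        using that beta by (intro powr_mono2) auto
      also have "(2/3 * m) powr (\<beta> - 1) = q * m powr (\<beta> - 1)"
          using powr_mult[of "2/3" m "\<beta> - 1"] xy by (simp add: q_def)
      finally show ?thesis
        using that by simp
    qed
    have "x powr \<beta> + y powr \<beta> \<le> (x + y) * (q * m powr (\<beta> - 1))"
      unfolding distrib_right using xy by (intro add_mono pow) auto
    also have "\<dots> = q * m powr \<beta>"
      using xy by (simp add: powr_mult_base)
    finally have conv: "x powr \<beta> + y powr \<beta> \<le> q * m powr \<beta>" .
    have "f i k \<le> c * x powr \<beta> + x * r" "f k j \<le> c * y powr \<beta> + y * r"
      using less.hyps[of k i] less.hyps[of j k] k less.prems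
      by (auto simp: c_def q_def x_def y_def)
    moreover have "f i j \<le> f i k + f k j + M * m powr \<beta>"
      using split[of i k j] k less.prems by (auto simp: m_def)
    ultimately have "f i j \<le> c * (x powr \<beta> + y powr \<beta>) + M * m powr \<beta> + (x + y) * r"
      by (simp add: algebra_simps)
    also have "\<dots> \<le> c * (q * m powr \<beta>) + M * m powr \<beta> + m * r"
      using conv c xy M by (intro add_mono mult_left_mono) auto
    also have "\<dots> = (c * q + M) * m powr \<beta> + m * r"
      by (simp add: algebra_simps)
    finally show ?thesis
      using c by (simp add: m_def c_def q_def)
  qed
qed

text \<open>The stability argument needs an additive group with a subadditive size, operators of
  time order \<gamma> and 2\<gamma>, and Chen's relation \<open>X2_chain\<close>. Its mixed term is
  written twice because X^2 carries a factor 2 and a group has no scalars. Times are confined to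
  \<open>[0, T]\<close> since the bound for X^2 comes with a constant depending on
  \<open>T\<close>.\<close>

locale rough_equation =
  fixes B :: "'a::ab_group_add set" and N :: "'a \<Rightarrow> real"
    and X :: "real \<Rightarrow> real \<Rightarrow> 'a \<Rightarrow> 'a \<Rightarrow> 'a"
    and X2 :: "real \<Rightarrow> real \<Rightarrow> 'a \<Rightarrow> 'a \<Rightarrow> 'a \<Rightarrow> 'a"
    and T K \<gamma> :: real
  assumes B_zero [simp]: "0 \<in> B"
    and B_add [simp]: "x \<in> B \<Longrightarrow> y \<in> B \<Longrightarrow> x + y \<in> B"
    and B_uminus [simp]: "x \<in> B \<Longrightarrow> - x \<in> B"
    and N_zero: "N 0 = 0"
    and N_nonneg [simp]: "0 \<le> N x"
    and N_uminus: "N (- x) = N x"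
    and N_add: "x \<in> B \<Longrightarrow> y \<in> B \<Longrightarrow> N (x + y) \<le> N x + N y"
    and gamma: "1/3 < \<gamma>" "\<gamma> \<le> 1/2"
    and K: "0 \<le> K" and T: "0 < T"
    and X_in [simp]: "0 \<le> s \<Longrightarrow> s \<le> t \<Longrightarrow> t \<le> T \<Longrightarrow> x \<in> B \<Longrightarrow> y \<in> B \<Longrightarrow> X t s x y \<in> B"
    and X_bound: "0 \<le> s \<Longrightarrow> s \<le> t \<Longrightarrow> t \<le> T \<Longrightarrow> x \<in> B \<Longrightarrow> y \<in> B \<Longrightarrow>
        N (X t s x y) \<le> K * (t - s) powr \<gamma> * (N x * N y)"
    and X_add: "0 \<le> s \<Longrightarrow> s \<le> t \<Longrightarrow> t \<le> T \<Longrightarrow> x \<in> B \<Longrightarrow> x' \<in> B \<Longrightarrow> y \<in> B \<Longrightarrow>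
        X t s (x + x') y = X t s x y + X t s x' y"
    and X_commute: "X t s x y = X t s y x"
    and X_chain: "0 \<le> s \<Longrightarrow> s \<le> m \<Longrightarrow> m \<le> t \<Longrightarrow> t \<le> T \<Longrightarrow> x \<in> B \<Longrightarrow> y \<in> B \<Longrightarrow>
        X t s x y = X t m x y + X m s x y"
    and X2_in [simp]: "0 \<le> s \<Longrightarrow> s \<le> t \<Longrightarrow> t \<le> T \<Longrightarrow> x \<in> B \<Longrightarrow> y \<in> B \<Longrightarrow> z \<in> B \<Longrightarrow>
        X2 t s x y z \<in> B"
    and X2_bound: "0 \<le> s \<Longrightarrow> s \<le> t \<Longrightarrow> t \<le> T \<Longrightarrow> x \<in> B \<Longrightarrow> y \<in> B \<Longrightarrow> z \<in> B \<Longrightarrow>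
        N (X2 t s x y z) \<le> K * (t - s) powr (2 * \<gamma>) * (N x * N y * N z)"
    and X2_add1: "0 \<le> s \<Longrightarrow> s \<le> t \<Longrightarrow> t \<le> T \<Longrightarrow> x \<in> B \<Longrightarrow> x' \<in> B \<Longrightarrow> y \<in> B \<Longrightarrow> z \<in> B \<Longrightarrow>
        X2 t s (x + x') y z = X2 t s x y z + X2 t s x' y z"
    and X2_add2: "0 \<le> s \<Longrightarrow> s \<le> t \<Longrightarrow> t \<le> T \<Longrightarrow> x \<in> B \<Longrightarrow> x' \<in> B \<Longrightarrow> y \<in> B \<Longrightarrow> z \<in> B \<Longrightarrow>
        X2 t s y (x + x') z = X2 t s y x z + X2 t s y x' z"
    and X2_add3: "0 \<le> s \<Longrightarrow> s \<le> t \<Longrightarrow> t \<le> T \<Longrightarrow> x \<in> B \<Longrightarrow> x' \<in> B \<Longrightarrow> y \<in> B \<Longrightarrow> z \<in> B \<Longrightarrow>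
        X2 t s y z (x + x') = X2 t s y z x + X2 t s y z x'"
    and X2_chain: "0 \<le> s \<Longrightarrow> s \<le> m \<Longrightarrow> m \<le> t \<Longrightarrow> t \<le> T \<Longrightarrow> x \<in> B \<Longrightarrow> y \<in> B \<Longrightarrow> z \<in> B \<Longrightarrow>
        X2 t s x y z = X2 t m x y z + X2 m s x y z + (X t m x (X m s y z) + X t m x (X m s y z))"
begin

lemma B_diff [simp]: "x \<in> B \<Longrightarrow> y \<in> B \<Longrightarrow> x - y \<in> B"
  using B_add[of x "- y"] by auto

lemma N_add_le: "N x \<le> a \<Longrightarrow> N y \<le> b \<Longrightarrow> x \<in> B \<Longrightarrow> y \<in> B \<Longrightarrow> N (x + y) \<le> a + b"
  using N_add[of x y] by linarith

lemma N_diff: "x \<in> B \<Longrightarrow> y \<in> B \<Longrightarrow> N (x - y) \<le> N x + N y"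
  using N_add[of x "- y"] by (auto simp: N_uminus)

lemma X_diff: "0 \<le> s \<Longrightarrow> s \<le> t \<Longrightarrow> t \<le> T \<Longrightarrow> x \<in> B \<Longrightarrow> x' \<in> B \<Longrightarrow> y \<in> B \<Longrightarrow>
    X t s (x - x') y = X t s x y - X t s x' y"
  using X_add[of s t "x - x'" x' y] B_diff[of x x'] by (simp add: algebra_simps)

lemma X_diff_right: "0 \<le> s \<Longrightarrow> s \<le> t \<Longrightarrow> t \<le> T \<Longrightarrow> x \<in> B \<Longrightarrow> x' \<in> B \<Longrightarrow> y \<in> B \<Longrightarrow>
    X t s y (x - x') = X t s y x - X t s y x'"
  using X_diff X_commute by metis

lemma X2_diff1: "0 \<le> s \<Longrightarrow> s \<le> t \<Longrightarrow> t \<le> T \<Longrightarrow> x \<in> B \<Longrightarrow> x' \<in> B \<Longrightarrow> y \<in> B \<Longrightarrow> z \<in> B \<Longrightarrow>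
    X2 t s (x - x') y z = X2 t s x y z - X2 t s x' y z"
  using X2_add1[of s t "x - x'" x' y z] B_diff[of x x'] by (simp add: algebra_simps)

lemma X2_diff2: "0 \<le> s \<Longrightarrow> s \<le> t \<Longrightarrow> t \<le> T \<Longrightarrow> x \<in> B \<Longrightarrow> x' \<in> B \<Longrightarrow> y \<in> B \<Longrightarrow> z \<in> B \<Longrightarrow>
    X2 t s y (x - x') z = X2 t s y x z - X2 t s y x' z"
  using X2_add2[of s t "x - x'" x' y z] B_diff[of x x'] by (simp add: algebra_simps)

lemma X2_diff3: "0 \<le> s \<Longrightarrow> s \<le> t \<Longrightarrow> t \<le> T \<Longrightarrow> x \<in> B \<Longrightarrow> x' \<in> B \<Longrightarrow> y \<in> B \<Longrightarrow> z \<in> B \<Longrightarrow>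
    X2 t s y z (x - x') = X2 t s y z x - X2 t s y z x'"
  using X2_add3[of s t "x - x'" x' y z] B_diff[of x x'] by (simp add: algebra_simps)

lemma X_le:
  assumes "0 \<le> s" "s \<le> t" "t \<le> T" "x \<in> B" "y \<in> B" "t - s \<le> \<tau>" "N x \<le> a" "N y \<le> b"
  shows "N (X t s x y) \<le> K * \<tau> powr \<gamma> * (a * b)"
proof -
  have "0 \<le> a" "0 \<le> b"
    using assms order_trans[OF N_nonneg] by blast+
  then show ?thesis
    using assms K gamma
    by (intro order_trans[OF X_bound] mult_mono powr_mono2) auto
qed

lemma X2_le:
  assumes "0 \<le> s" "s \<le> t" "t \<le> T" "x \<in> B" "y \<in> B" "z \<in> B" "t - s \<le> \<tau>"
    "N x \<le> a" "N y \<le> b" "N z \<le> c"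
  shows "N (X2 t s x y z) \<le> K * \<tau> powr (2 * \<gamma>) * (a * b * c)"
proof -
  have "0 \<le> a" "0 \<le> b" "0 \<le> c"
    using assms order_trans[OF N_nonneg] by blast+
  then show ?thesis
    using assms K gamma
    by (intro order_trans[OF X2_bound] mult_mono powr_mono2) auto
qed

definition step :: "real \<Rightarrow> real \<Rightarrow> 'a \<Rightarrow> 'a" where
  "step t s x = x + X t s x x + X2 t s x x x"

lemma step_in [simp]: "0 \<le> s \<Longrightarrow> s \<le> t \<Longrightarrow> t \<le> T \<Longrightarrow> x \<in> B \<Longrightarrow> step t s x \<in> B"
  by (simp add: step_def)

lemma X_diff_le:
  assumes "0 \<le> s" "s \<le> t" "t \<le> T" "x \<in> B" "y \<in> B" "x' \<in> B" "y' \<in> B" "t - s \<le> \<tau>"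
    "N x' \<le> a" "N y \<le> b" "N (x - x') \<le> a'" "N (y - y') \<le> b'"
  shows "N (X t s x y - X t s x' y') \<le> K * \<tau> powr \<gamma> * (a' * b + a * b')"
proof -
  have "X t s x y - X t s x' y' = X t s (x - x') y + X t s x' (y - y')"
    using assms by (simp add: X_diff X_diff_right)
  also have "N \<dots> \<le> N (X t s (x - x') y) + N (X t s x' (y - y'))"
    using assms by (intro N_add) auto
  also have "\<dots> \<le> K * \<tau> powr \<gamma> * (a' * b) + K * \<tau> powr \<gamma> * (a * b')"
    using assms by (intro add_mono X_le) auto
  finally show ?thesis
    by (simp add: algebra_simps)
qed

lemma X2_diff_le:
  assumes "0 \<le> s" "s \<le> t" "t \<le> T" "x \<in> B" "y \<in> B" "z \<in> B" "x' \<in> B" "y' \<in> B" "z' \<in> B" "t - s \<le> \<tau>"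
    "N x' \<le> a" "N y' \<le> b" "N y \<le> b" "N z \<le> c"
    "N (x - x') \<le> a'" "N (y - y') \<le> b'" "N (z - z') \<le> c'"
  shows "N (X2 t s x y z - X2 t s x' y' z') \<le> K * \<tau> powr (2 * \<gamma>) * (a' * b * c + a * b' * c + a * b * c')"
proof -
  have "X2 t s x y z - X2 t s x' y' z' =
      X2 t s (x - x') y z + X2 t s x' (y - y') z + X2 t s x' y' (z - z')"
    using assms by (simp add: X2_diff1 X2_diff2 X2_diff3)
  also have "N \<dots> \<le> N (X2 t s (x - x') y z) + N (X2 t s x' (y - y') z) + N (X2 t s x' y' (z - z'))"
    using assms by (intro order_trans[OF N_add] add_mono order_refl N_add) auto
  also have "\<dots> \<le> K * \<tau> powr (2 * \<gamma>) * (a' * b * c) + K * \<tau> powr (2 * \<gamma>) * (a * b' * c)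
      + K * \<tau> powr (2 * \<gamma>) * (a * b * c')"
    using assms by (intro add_mono X2_le) auto
  finally show ?thesis
    by (simp add: algebra_simps)
qed

text \<open>The failure of the remainder of a path to be additive depends only on its values at the
  two earlier times, which is what makes the induction on the length of the window possible.\<close>

definition defect :: "real \<Rightarrow> real \<Rightarrow> real \<Rightarrow> 'a \<Rightarrow> 'a \<Rightarrow> 'a" where
  "defect t m s x y =
     X t m (y - x) (y - x)
     + (X t m x (y - x - X m s x x) + X t m x (y - x - X m s x x))
     + (X2 t m (y - x) y y + X2 t m x (y - x) y + X2 t m x x (y - x))"

lemma defect_in [simp]:
  "0 \<le> s \<Longrightarrow> s \<le> m \<Longrightarrow> m \<le> t \<Longrightarrow> t \<le> T \<Longrightarrow> x \<in> B \<Longrightarrow> y \<in> B \<Longrightarrow> defect t m s x y \<in> B"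
  by (auto simp: defect_def)

text \<open>With d = y - x the quadratic term changes by X(d, d) + 2 X(x, d), and Chen's relation
  contributes - 2 X(x, X_ms(x, x)); so only the second-order increment d - X_ms(x, x) is paired with
  x. The X^2 differences telescope. The end value \<open>w\<close> is arbitrary because it is the
  same summand on both sides.\<close>

lemma defect_eq:
  assumes "0 \<le> s" "s \<le> m" "m \<le> t" "t \<le> T" "x \<in> B" "y \<in> B"
  shows "w - step t s x = (w - step t m y) + (y - step m s x) + defect t m s x y"
proof -
  have 1: "X m s x x \<in> B" "m \<le> T" "0 \<le> m"
    using assms by auto
  have 2: "X t m y x = X t m x y"
    by (rule X_commute)
  show ?thesis
    unfolding step_def defect_def
    using assms 1 2
    by (simp add: X_diff X_diff_right X2_diff1 X2_diff2 X2_diff3 B_diff X_chain[of s m t]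
        X2_chain[of s m t])
qed

text \<open>Each summand has total time order 3\<gamma>, as \<gamma> + \<gamma> + \<gamma>, \<gamma>
  + 2\<gamma> or 2\<gamma> + \<gamma>. The constant 6 counts three X terms and three X^2 terms after
  \<open>L ^ 2 \<le> L ^ 3\<close>.\<close>

lemma defect_le:
  assumes "0 \<le> s" "s \<le> m" "m \<le> t" "t \<le> T" "x \<in> B" "y \<in> B" "t - s \<le> \<tau>" "L \<ge> 1"
    and "N x \<le> L" "N y \<le> L" "N (y - x) \<le> L * \<tau> powr \<gamma>"
    and "N (y - x - X m s x x) \<le> L * \<tau> powr (2 * \<gamma>)"
  shows "N (defect t m s x y) \<le> 6 * K * L ^ 3 * \<tau> powr (3 * \<gamma>)"
proof -
  have B: "y - x \<in> B" "y - x - X m s x x \<in> B" "0 \<le> m" "m \<le> T" "t - m \<le> \<tau>"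
    using assms by auto
  define p where "p = \<tau> powr \<gamma>"
  have p: "\<tau> powr (2 * \<gamma>) = p ^ 2" "\<tau> powr (3 * \<gamma>) = p ^ 3" "p \<ge> 0"
    by (cases "\<tau> = 0"; simp add: p_def powr_power mult.commute)+
  have "N (defect t m s x y) \<le> K * p * ((L * p) * (L * p))
     + (K * p * (L * (L * p ^ 2)) + K * p * (L * (L * p ^ 2)))
     + (K * p ^ 2 * ((L * p) * L * L) + K * p ^ 2 * (L * (L * p) * L) + K * p ^ 2 * (L * L * (L * p)))"
    unfolding p(1)[symmetric] unfolding p_def
    unfolding defect_def
    by (intro N_add_le X_le X2_le X_in X2_in B_add; fact assms B)
  also have "\<dots> = 3 * (K * p ^ 3) * L ^ 2 + 3 * (K * p ^ 3) * L ^ 3"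
    by (simp add: algebra_simps power2_eq_square power3_eq_cube)
  also have "L ^ 2 \<le> L ^ 3"
    using assms by (intro power_increasing) auto
  hence "3 * (K * p ^ 3) * L ^ 2 + 3 * (K * p ^ 3) * L ^ 3 \<le> 3 * (K * p ^ 3) * L ^ 3 + 3 * (K * p ^ 3) * L ^ 3"
    using K p by (intro add_mono mult_left_mono) auto
  also have "\<dots> = 6 * K * L ^ 3 * \<tau> powr (3 * \<gamma>)"
    by (simp add: p)
  finally show ?thesis .
qed

text \<open>Lipschitz counterpart of \<open>defect_le\<close>: by multilinearity one slot at a time
  receives a difference, which brings a factor \<eta> and keeps the time order of that slot. The
  constant is 15 = 2 + 10 + 3, the coefficients of L, L^2 and L^3.\<close>

lemma defect_diff_le:
  assumes "0 \<le> s" "s \<le> m" "m \<le> t" "t \<le> T" "x \<in> B" "y \<in> B" "x' \<in> B" "y' \<in> B" "t - s \<le> \<tau>" "L \<ge> 1"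
    and "N x \<le> L" "N y \<le> L" "N (y - x) \<le> L * \<tau> powr \<gamma>"
    and "N (y - x - X m s x x) \<le> L * \<tau> powr (2 * \<gamma>)"
    and "N x' \<le> L" "N y' \<le> L" "N (y' - x') \<le> L * \<tau> powr \<gamma>"
    and "N (x - x') \<le> \<eta>" "N (y - y') \<le> \<eta>" "N ((y - x) - (y' - x')) \<le> L * \<eta> * \<tau> powr \<gamma>"
    and "N ((y - x - X m s x x) - (y' - x' - X m s x' x')) \<le> L * \<eta> * \<tau> powr (2 * \<gamma>)"
  shows "N (defect t m s x y - defect t m s x' y') \<le> 15 * K * L ^ 3 * \<eta> * \<tau> powr (3 * \<gamma>)"
proof -
  define d d' Z Z' where "d = y - x" and "d' = y' - x'" and "Z = d - X m s x x" and "Z' = d' - X m s x' x'"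
  have B: "d \<in> B" "Z \<in> B" "d' \<in> B" "Z' \<in> B" "0 \<le> m" "m \<le> T" "t - m \<le> \<tau>"
    using assms(1-9) by (auto simp: d_def d'_def Z_def Z'_def)
  note defs = d_def[symmetric] d'_def[symmetric] Z_def[symmetric] Z'_def[symmetric]
  note asm = assms[unfolded defs]
  have eta: "0 \<le> \<eta>"
    using order_trans[OF N_nonneg assms(18)] .
  define p where "p = \<tau> powr \<gamma>"
  have p: "\<tau> powr (2 * \<gamma>) = p ^ 2" "\<tau> powr (3 * \<gamma>) = p ^ 3" "p \<ge> 0"
    by (cases "\<tau> = 0"; simp add: p_def powr_power mult.commute)+
  have eq: "defect t m s x y - defect t m s x' y' = (X t m d d - X t m d' d')
     + ((X t m x Z - X t m x' Z') + (X t m x Z - X t m x' Z'))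
     + ((X2 t m d y y - X2 t m d' y' y') + (X2 t m x d y - X2 t m x' d' y')
        + (X2 t m x x d - X2 t m x' x' d'))"
    unfolding defect_def defs by (simp add: algebra_simps)
  have "N (defect t m s x y - defect t m s x' y') \<le> K * p * ((L * \<eta> * p) * (L * p) + (L * p) * (L * \<eta> * p))
     + (K * p * (\<eta> * (L * p ^ 2) + L * (L * \<eta> * p ^ 2)) + K * p * (\<eta> * (L * p ^ 2) + L * (L * \<eta> * p ^ 2)))
     + (K * p ^ 2 * ((L * \<eta> * p) * L * L + (L * p) * \<eta> * L + (L * p) * L * \<eta>)
       + K * p ^ 2 * (\<eta> * (L * p) * L + L * (L * \<eta> * p) * L + L * (L * p) * \<eta>)
       + K * p ^ 2 * (\<eta> * L * (L * p) + L * \<eta> * (L * p) + L * L * (L * \<eta> * p)))"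
    unfolding p(1)[symmetric] eq unfolding p_def
    by (intro N_add_le X_diff_le X2_diff_le B_diff X_in X2_in B_add; fact asm B)
  also have "\<dots> = (K * p ^ 3 * \<eta>) * (2 * L + 10 * L ^ 2 + 3 * L ^ 3)"
    by (simp add: algebra_simps power2_eq_square power3_eq_cube)
  also have "\<dots> \<le> (K * p ^ 3 * \<eta>) * (2 * L ^ 3 + 10 * L ^ 3 + 3 * L ^ 3)"
    using K p eta assms(10) power_increasing[of 1 3 L] power_increasing[of 2 3 L]
    by (intro mult_left_mono) auto
  also have "\<dots> = 15 * K * L ^ 3 * \<eta> * \<tau> powr (3 * \<gamma>)"
    by (simp add: p)
  finally show ?thesis .
qed

text \<open>The qualitative hypothesis \<open>small\<close> enters twice. With \<epsilon> = 1 it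
  gives order 2\<gamma>, because 2\<gamma> \<le> 1, and hence the second-order increments that
  \<open>defect_le\<close> asks for. With arbitrary \<epsilon> it bounds the unit steps of a fine
  grid, whose total \<epsilon> (t - s) can be made as small as desired, so that only the sewing term
  remains.\<close>

lemma remainder_bound:
  assumes v: "\<And>t. 0 \<le> t \<Longrightarrow> t \<le> T \<Longrightarrow> v t \<in> B"
    and holder: "\<And>s t. 0 \<le> s \<Longrightarrow> s \<le> t \<Longrightarrow> t \<le> T \<Longrightarrow> N (v t - v s) \<le> H * (t - s) powr \<gamma>"
    and small: "\<And>\<epsilon>. 0 < \<epsilon> \<Longrightarrow> \<exists>h>0. \<forall>s t. 0 \<le> s \<and> s \<le> t \<and> t \<le> T \<and> t - s \<le> h \<longrightarrow>
        N (v t - step t s (v s)) \<le> \<epsilon> * (t - s)"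
  obtains L where "L \<ge> 1" "\<And>t. 0 \<le> t \<Longrightarrow> t \<le> T \<Longrightarrow> N (v t) \<le> L"
    "\<And>s t. 0 \<le> s \<Longrightarrow> s \<le> t \<Longrightarrow> t \<le> T \<Longrightarrow> N (v t - v s) \<le> L * (t - s) powr \<gamma>"
    "\<And>s t. 0 \<le> s \<Longrightarrow> s \<le> t \<Longrightarrow> t \<le> T \<Longrightarrow> N (v t - v s - X t s (v s) (v s)) \<le> L * (t - s) powr (2 * \<gamma>)"
    "\<And>s t. 0 \<le> s \<Longrightarrow> s \<le> t \<Longrightarrow> t \<le> T \<Longrightarrow> N (v t - step t s (v s)) \<le> L * (t - s) powr (3 * \<gamma>)"
proof -
  define V where "V = N (v 0) + \<bar>H\<bar> * T powr \<gamma>"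
  have V0: "V \<ge> 0"
    by (simp add: V_def)
  have V: "N (v t) \<le> V" if "0 \<le> t" "t \<le> T" for t
  proof -
    have "N (v t) \<le> N (v 0) + N (v t - v 0)"
      using N_add[of "v 0" "v t - v 0"] v that T by simp
    also have "N (v t - v 0) \<le> H * (t - 0) powr \<gamma>"
      using that by (intro holder) auto
    also have "\<dots> \<le> \<bar>H\<bar> * T powr \<gamma>"
      using that gamma by (intro mult_mono powr_mono2) auto
    finally show ?thesis
      by (simp add: V_def)
  qed
  obtain h where h: "h > 0" "\<And>s t. 0 \<le> s \<Longrightarrow> s \<le> t \<Longrightarrow> t \<le> T \<Longrightarrow> t - s \<le> h \<Longrightarrow>
      N (v t - step t s (v s)) \<le> t - s"
    using small[of 1] by auto
  define Q where "Q = \<bar>H\<bar> * T powr \<gamma> + K * T powr \<gamma> * (V * V) + K * T powr (2 * \<gamma>) * (V * V * V)"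
  have Q: "Q \<ge> 0"
    using V0 K by (simp add: Q_def)
  \<comment> \<open>The first summand serves gaps up to \<open>h\<close>, where the remainder is at
    most t - s and 1 - 2\<gamma> \<ge> 0; the second serves longer gaps, where the crude size
    \<open>Q\<close> suffices.\<close>
  define C0 where "C0 = T powr (1 - 2 * \<gamma>) + Q / h powr (2 * \<gamma>)"
  have R2: "N (v t - step t s (v s)) \<le> C0 * (t - s) powr (2 * \<gamma>)"
    if st: "0 \<le> s" "s \<le> t" "t \<le> T" for s t
  proof (cases "t - s \<le> h")
    case True
    have "N (v t - step t s (v s)) \<le> t - s"
      using True st by (intro h) auto
    also have "\<dots> = (t - s) powr (1 - 2 * \<gamma>) * (t - s) powr (2 * \<gamma>)"
      using st by (cases "s = t") (auto simp: powr_add[symmetric])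
    also have "\<dots> \<le> C0 * (t - s) powr (2 * \<gamma>)"
      using st gamma Q by (intro mult_right_mono) (auto simp: C0_def intro!: powr_mono2 add_increasing2)
    finally show ?thesis .
  next
    case False
    have B: "v s \<in> B" "v t \<in> B"
      using v st by auto
    have "v t - step t s (v s) = (v t - v s) - X t s (v s) (v s) - X2 t s (v s) (v s) (v s)"
      by (simp add: step_def algebra_simps)
    also have "N \<dots> \<le> N (v t - v s) + N (X t s (v s) (v s)) + N (X2 t s (v s) (v s) (v s))"
      using st B by (intro order_trans[OF N_diff] add_mono N_diff order_refl) auto
    also have "\<dots> \<le> H * (t - s) powr \<gamma> + K * T powr \<gamma> * (V * V) + K * T powr (2 * \<gamma>) * (V * V * V)"
      using st B V by (intro add_mono holder X_le X2_le) auto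
    also have "H * (t - s) powr \<gamma> \<le> \<bar>H\<bar> * T powr \<gamma>"
      using st gamma by (intro mult_mono powr_mono2) auto
    finally have "N (v t - step t s (v s)) \<le> Q"
      by (simp add: Q_def)
    also have "\<dots> = Q / h powr (2 * \<gamma>) * h powr (2 * \<gamma>)"
      using h by simp
    also have "\<dots> \<le> C0 * (t - s) powr (2 * \<gamma>)"
      using False Q h gamma by (intro mult_mono powr_mono2) (auto simp: C0_def)
    finally show ?thesis .
  qed
  define C1 where "C1 = C0 + K * V ^ 3"
  have R1: "N (v t - v s - X t s (v s) (v s)) \<le> C1 * (t - s) powr (2 * \<gamma>)"
    if st: "0 \<le> s" "s \<le> t" "t \<le> T" for s t
  proof -
    have B: "v s \<in> B" "v t \<in> B"
      using v st by auto
    have "v t - v s - X t s (v s) (v s) = (v t - step t s (v s)) + X2 t s (v s) (v s) (v s)"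
      by (simp add: step_def algebra_simps)
    also have "N \<dots> \<le> N (v t - step t s (v s)) + N (X2 t s (v s) (v s) (v s))"
      using st B by (intro N_add) auto
    also have "\<dots> \<le> C0 * (t - s) powr (2 * \<gamma>) + K * (t - s) powr (2 * \<gamma>) * (V * V * V)"
      using st B V by (intro add_mono R2 X2_le) auto
    finally show ?thesis
      by (simp add: C1_def algebra_simps power3_eq_cube)
  qed
  define L where "L = 1 + V + \<bar>H\<bar> + C1"
  have C1: "C1 \<ge> 0"
    using Q K V0 by (simp add: C1_def C0_def)
  have L: "L \<ge> 1" "V \<le> L" "\<bar>H\<bar> \<le> L" "C1 \<le> L"
    using V0 C1 by (auto simp: L_def)
  have h1: "N (v t - v s) \<le> L * (t - s) powr \<gamma>" if "0 \<le> s" "s \<le> t" "t \<le> T" for s t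
    using holder[OF that] L by (elim order_trans) (auto intro!: mult_right_mono)
  have h2: "N (v t - v s - X t s (v s) (v s)) \<le> L * (t - s) powr (2 * \<gamma>)"
    if "0 \<le> s" "s \<le> t" "t \<le> T" for s t
    using R1[OF that] L by (elim order_trans) (auto intro!: mult_right_mono)
  define c where "c = 1 / (1 - (2/3) powr (3 * \<gamma> - 1))"
  have c: "c > 0"
    using gamma powr_less_mono2[of "3 * \<gamma> - 1" "2/3" 1] by (auto simp: c_def)
  define M where "M = 6 * K * L ^ 3"
  have M: "M \<ge> 0"
    using K L by (simp add: M_def)
  have h3: "N (v t - step t s (v s)) \<le> c * M * (t - s) powr (3 * \<gamma>)"
    if st: "0 \<le> s" "s \<le> t" "t \<le> T" for s t
  proof (cases "s = t")
    case True
    then show ?thesis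
      using h(2)[of s t] st h(1) by simp
  next
    case False
    show ?thesis
    proof (rule field_le_epsilon)
      fix e :: real assume "e > 0"
      \<comment> \<open>The unit remainders over the grid then add up to exactly
        \<open>e\<close>.\<close>
      define \<epsilon> where "\<epsilon> = e / (t - s)"
      have eps: "\<epsilon> > 0"
        using \<open>e > 0\<close> False st by (simp add: \<epsilon>_def)
      obtain h' where h': "h' > 0" "\<And>s t. 0 \<le> s \<Longrightarrow> s \<le> t \<Longrightarrow> t \<le> T \<Longrightarrow> t - s \<le> h' \<Longrightarrow>
          N (v t - step t s (v s)) \<le> \<epsilon> * (t - s)"
        using small[of \<epsilon>] eps by auto
      obtain n :: nat where n: "real n > (t - s) / h'"
        using reals_Archimedean2 by blast
      have "(t - s) / h' > 0"
        using False st h' by simp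
      hence n0: "real n > 0" "n > 0"
        using n by linarith+
      define \<delta> where "\<delta> = (t - s) / n"
      have del: "\<delta> > 0" "\<delta> \<le> h'" "n * \<delta> = t - s"
        using n n0 False st h' by (auto simp: \<delta>_def field_simps)
      define g where "g = (\<lambda>i::nat. s + i * \<delta>)"
      have g: "0 \<le> g i" "g i \<le> g j" "g j \<le> T" "g j - g i = real (j - i) * \<delta>"
        if "i \<le> j" "j \<le> n" for i j
      proof -
        have "real j * \<delta> \<le> real n * \<delta>"
          using that del by (intro mult_right_mono) auto
        thus "g j \<le> T"
          using del st by (simp add: g_def)
      qed (use that del st in \<open>auto simp: g_def of_nat_diff algebra_simps\<close>)
      define f where "f = (\<lambda>i j. N (v (g j) - step (g j) (g i) (v (g i))))"
      have "f 0 n \<le> (M * \<delta> powr (3 * \<gamma>)) / (1 - (2/3) powr (3 * \<gamma> - 1)) * real (n - 0) powr (3 * \<gamma>)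
          + real (n - 0) * (\<epsilon> * \<delta>)"
      proof (rule discrete_sewing)
        show "3 * \<gamma> > 1"
          using gamma by simp
        show "M * \<delta> powr (3 * \<gamma>) \<ge> 0"
          using M by simp
        show "f i (Suc i) \<le> \<epsilon> * \<delta>" if "0 \<le> i" "i < n" for i
          using h'(2)[of "g i" "g (Suc i)"] g[of i "Suc i"] del that by (simp add: f_def)
        show "f i j \<le> f i k + f k j + M * \<delta> powr (3 * \<gamma>) * real (j - i) powr (3 * \<gamma>)"
          if "0 \<le> i" "i < k" "k < j" "j \<le> n" for i k j
        proof -
          note gs = g[of i k] g[of k j] g[of i j]
          have B: "v (g i) \<in> B" "v (g k) \<in> B" "v (g j) \<in> B"
            using gs that by (auto intro!: v intro: order_trans)
          have le: "(g k - g i) powr a \<le> (real (j - i) * \<delta>) powr a" if "a \<ge> 0" for a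
            using gs \<open>i < k\<close> \<open>k < j\<close> \<open>j \<le> n\<close> del that
            by (intro powr_mono2) (auto intro!: mult_right_mono)
          have "f i j \<le> N (v (g j) - step (g j) (g k) (v (g k))) + N (v (g k) - step (g k) (g i) (v (g i)))
              + N (defect (g j) (g k) (g i) (v (g i)) (v (g k)))"
            unfolding f_def using gs that B
            by (subst defect_eq[where m = "g k" and y = "v (g k)"])
              (auto intro!: order_trans[OF N_add] add_mono N_add)
          also have "N (defect (g j) (g k) (g i) (v (g i)) (v (g k))) \<le> M * (real (j - i) * \<delta>) powr (3 * \<gamma>)"
            unfolding M_def
          proof (rule defect_le)
            show "N (v (g k) - v (g i)) \<le> L * (real (j - i) * \<delta>) powr \<gamma>"
              using gs that L gamma by (intro order_trans[OF h1] mult_left_mono le) auto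
            show "N (v (g k) - v (g i) - X (g k) (g i) (v (g i)) (v (g i))) \<le> L * (real (j - i) * \<delta>) powr (2 * \<gamma>)"
              using gs that L gamma by (intro order_trans[OF h2] mult_left_mono le) auto
            show "N (v (g i)) \<le> L" "N (v (g k)) \<le> L"
              using gs that L by (auto intro!: order_trans[OF V])
          qed (use gs that B L in auto)
          also have "M * (real (j - i) * \<delta>) powr (3 * \<gamma>) = M * \<delta> powr (3 * \<gamma>) * real (j - i) powr (3 * \<gamma>)"
            using del by (simp add: powr_mult)
          finally show ?thesis
            by (simp add: f_def)
        qed
      qed (use n0 in auto)
      also have "\<dots> = c * M * (n * \<delta>) powr (3 * \<gamma>) + \<epsilon> * (n * \<delta>)"
        using n0 del(1) by (simp add: c_def powr_mult mult_ac)
      also have "\<dots> = c * M * (t - s) powr (3 * \<gamma>) + e"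
        using del False by (simp add: \<epsilon>_def)
      finally show "N (v t - step t s (v s)) \<le> c * M * (t - s) powr (3 * \<gamma>) + e"
        using del by (simp add: f_def g_def)
    qed
  qed
  define L' where "L' = L + c * M"
  have L': "L \<le> L'" "c * M \<le> L'"
    using L c M by (auto simp: L'_def)
  have mono: "a * (t - s) powr b \<le> L' * (t - s) powr b" if "a \<le> L'" for a b s t
    using that by (intro mult_right_mono) auto
  show ?thesis
  proof (rule that[of L'])
    show "L' \<ge> 1"
      using L L' by simp
    show "N (v t) \<le> L'" if "0 \<le> t" "t \<le> T" for t
      using V[OF that] L L' by simp
    show "N (v t - v s) \<le> L' * (t - s) powr \<gamma>"
      and "N (v t - v s - X t s (v s) (v s)) \<le> L' * (t - s) powr (2 * \<gamma>)"
      and "N (v t - step t s (v s)) \<le> L' * (t - s) powr (3 * \<gamma>)"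
      if "0 \<le> s" "s \<le> t" "t \<le> T" for s t
      using order_trans[OF h1[OF that] mono[OF L'(1)]] order_trans[OF h2[OF that] mono[OF L'(1)]]
        order_trans[OF h3[OF that] mono[OF L'(2)]] by auto
  qed
qed

end

section \<open>Stability of the scheme on short windows and convergence on [0, T]\<close>

context rough_equation
begin

text \<open>Hypothesis \<open>D\<close> controls differences of full remainders. Adding back X^2 and
  then X yields the differences of increments, of orders 2\<gamma> and \<gamma>, that
  \<open>defect_diff_le\<close> expects; \<open>t - s \<le> 1\<close> lets the higher order be
  absorbed in the lower one.\<close>

lemma increment_diff:
  assumes "0 \<le> s" "s \<le> t" "t \<le> T" "x \<in> B" "y \<in> B" "x' \<in> B" "y' \<in> B" "t - s \<le> 1" "L \<ge> 0"
    and "N x \<le> L" "N x' \<le> L" "N (x - x') \<le> \<eta>"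
    and D: "N ((y - step t s x) - (y' - step t s x')) \<le> \<eta> * (t - s) powr (2 * \<gamma>)"
  shows "N ((y - x - X t s x x) - (y' - x' - X t s x' x')) \<le> (1 + 3 * K * L ^ 2) * \<eta> * (t - s) powr (2 * \<gamma>)"
    and "N ((y - x) - (y' - x')) \<le> (1 + 2 * K * L + 3 * K * L ^ 2) * \<eta> * (t - s) powr \<gamma>"
proof -
  have eta: "0 \<le> \<eta>"
    using order_trans[OF N_nonneg assms(12)] .
  have eq: "(y - x - X t s x x) - (y' - x' - X t s x' x')
      = ((y - step t s x) - (y' - step t s x')) + (X2 t s x x x - X2 t s x' x' x')"
    by (simp add: step_def algebra_simps)
  have "N ((y - x - X t s x x) - (y' - x' - X t s x' x'))
      \<le> \<eta> * (t - s) powr (2 * \<gamma>) + K * (t - s) powr (2 * \<gamma>) * (\<eta> * L * L + L * \<eta> * L + L * L * \<eta>)"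
    unfolding eq using assms by (intro N_add_le D X2_diff_le) auto
  also have "\<dots> = (1 + 3 * K * L ^ 2) * \<eta> * (t - s) powr (2 * \<gamma>)"
    by (simp add: algebra_simps power2_eq_square)
  finally show 1: "N ((y - x - X t s x x) - (y' - x' - X t s x' x'))
      \<le> (1 + 3 * K * L ^ 2) * \<eta> * (t - s) powr (2 * \<gamma>)" .
  have eq: "(y - x) - (y' - x') = ((y - x - X t s x x) - (y' - x' - X t s x' x'))
      + (X t s x x - X t s x' x')"
    by (simp add: algebra_simps)
  have "N ((y - x) - (y' - x'))
      \<le> (1 + 3 * K * L ^ 2) * \<eta> * (t - s) powr (2 * \<gamma>) + K * (t - s) powr \<gamma> * (\<eta> * L + L * \<eta>)"
    unfolding eq using assms by (intro N_add_le 1 X_diff_le) auto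
  also have "(t - s) powr (2 * \<gamma>) \<le> (t - s) powr \<gamma>"
    using assms gamma by (intro powr_mono') auto
  hence "(1 + 3 * K * L ^ 2) * \<eta> * (t - s) powr (2 * \<gamma>) \<le> (1 + 3 * K * L ^ 2) * \<eta> * (t - s) powr \<gamma>"
    using K eta assms(9) by (intro mult_left_mono) auto
  finally show "N ((y - x) - (y' - x')) \<le> (1 + 2 * K * L + 3 * K * L ^ 2) * \<eta> * (t - s) powr \<gamma>"
    by (simp add: algebra_simps)
qed

text \<open>Sewing the remainder differences requires bounds on the increments of \<open>y\<close>,
  which in turn follow from the remainder differences. Induction on the right end of the window
  breaks the circle: a splitting uses increments of \<open>y\<close> only between earlier times,
  where the bounds are known. One number \<eta> bounds both the error and the 2\<gamma>-Hoelder size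
  of the remainder difference, so a single smallness condition on \<tau> closes both
  estimates.\<close>

lemma window_stability:
  assumes v: "\<And>t. 0 \<le> t \<Longrightarrow> t \<le> T \<Longrightarrow> v t \<in> B"
    and L: "L \<ge> 1" "\<And>t. 0 \<le> t \<Longrightarrow> t \<le> T \<Longrightarrow> N (v t) \<le> L"
    "\<And>s t. 0 \<le> s \<Longrightarrow> s \<le> t \<Longrightarrow> t \<le> T \<Longrightarrow> N (v t - v s) \<le> L * (t - s) powr \<gamma>"
    "\<And>s t. 0 \<le> s \<Longrightarrow> s \<le> t \<Longrightarrow> t \<le> T \<Longrightarrow> N (v t - v s - X t s (v s) (v s)) \<le> L * (t - s) powr (2 * \<gamma>)"
    "\<And>s t. 0 \<le> s \<Longrightarrow> s \<le> t \<Longrightarrow> t \<le> T \<Longrightarrow> N (v t - step t s (v s)) \<le> L * (t - s) powr (3 * \<gamma>)"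
  obtains \<tau> where "\<tau> > 0" "\<And>n y i j a. n > 0 \<Longrightarrow>
      (\<And>i. y (Suc i) = step (real (Suc i) / real n) (real i / real n) (y i)) \<Longrightarrow> y i \<in> B \<Longrightarrow>
      N (y i - v (real i / real n)) \<le> a \<Longrightarrow> 2 * a + 2 * L * real n powr (1 - 3 * \<gamma>) \<le> 1 \<Longrightarrow> i \<le> j \<Longrightarrow>
      real j / real n \<le> T \<Longrightarrow> real (j - i) / real n \<le> \<tau> \<Longrightarrow>
      y j \<in> B \<and> N (y j - v (real j / real n)) \<le> 2 * a + 2 * L * real n powr (1 - 3 * \<gamma>)"
proof -
  define c where "c = 1 / (1 - (2/3) powr (3 * \<gamma> - 1))"
  have c: "c > 0"
    using gamma powr_less_mono2[of "3 * \<gamma> - 1" "2/3" 1] by (auto simp: c_def)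
  define \<Lambda>1 where "\<Lambda>1 = 1 + 2 * K * (L + 1) + 3 * K * (L + 1) ^ 2"
  define \<Lambda> where "\<Lambda> = L + 1 + \<Lambda>1"
  have Lam1: "\<Lambda>1 \<ge> 1" "1 + 3 * K * (L + 1) ^ 2 \<le> \<Lambda>1"
    using K L(1) by (auto simp: \<Lambda>1_def)
  have Lam: "\<Lambda> \<ge> 1" "\<Lambda>1 \<le> \<Lambda>" "L + 1 \<le> \<Lambda>" "L + \<Lambda>1 \<le> \<Lambda>"
    using Lam1 L(1) by (auto simp: \<Lambda>_def)
  define M where "M = 15 * K * \<Lambda> ^ 3"
  have M: "M \<ge> 0"
    using K Lam by (simp add: M_def)
  define q where "q = c * M + \<Lambda>"
  have q: "q > 0" "c * M \<le> q" "\<Lambda> \<le> q"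
    using c M Lam by (auto simp: q_def add_nonneg_pos)
  \<comment> \<open>Makes both \<open>c * M * \<tau> powr \<gamma>\<close> and
    \<open>\<Lambda> * \<tau> powr \<gamma>\<close> at most 1/2, with \<tau> \<le> 1.\<close>
  define \<tau> where "\<tau> = (1 / (2 * (1 + q))) powr (1 / \<gamma>)"
  have \<tau>_powr: "\<tau> powr \<gamma> = 1 / (2 * (1 + q))"
    using q gamma by (simp add: \<tau>_def powr_powr)
  have tq: "q * \<tau> powr \<gamma> \<le> 1 / 2"
    unfolding \<tau>_powr using q by (simp add: field_simps)
  have tau: "0 < \<tau>" "\<tau> \<le> 1"
    using q gamma by (auto simp: \<tau>_def intro!: powr_le1)
  have "c * M * \<tau> powr \<gamma> \<le> q * \<tau> powr \<gamma>" "\<Lambda> * \<tau> powr \<gamma> \<le> q * \<tau> powr \<gamma>"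
    using q by (auto intro!: mult_right_mono)
  hence tau2: "c * M * \<tau> powr \<gamma> \<le> 1 / 2" "\<Lambda> * \<tau> powr \<gamma> \<le> 1 / 2"
    using tq by linarith+
  show ?thesis
  proof (rule that[OF tau(1)])
    fix n :: nat and y :: "nat \<Rightarrow> 'a" and i0 j0 :: nat and a :: real
    assume n: "n > 0" and y: "\<And>i. y (Suc i) = step (real (Suc i) / real n) (real i / real n) (y i)"
      and y0: "y i0 \<in> B" "N (y i0 - v (real i0 / real n)) \<le> a"
      and a: "2 * a + 2 * L * real n powr (1 - 3 * \<gamma>) \<le> 1"
      and j0: "i0 \<le> j0" "real j0 / real n \<le> T" "real (j0 - i0) / real n \<le> \<tau>"
    define g where "g = (\<lambda>i. real i / real n)"
    define w where "w = (\<lambda>i. v (g i))"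
    \<comment> \<open>Twice the initial error plus twice the accumulated one-step remainders: each
      source takes at most one half of \<eta>, and the other half is left for the terms made small
      by \<tau>.\<close>
    define \<eta> where "\<eta> = 2 * a + 2 * L * real n powr (1 - 3 * \<gamma>)"
    have "a \<ge> 0"
      using order_trans[OF N_nonneg y0(2)] .
    hence eta: "0 \<le> \<eta>" "\<eta> \<le> 1" "a \<le> \<eta> / 2" "L * real n powr (1 - 3 * \<gamma>) \<le> \<eta> / 2"
      using a L(1) by (auto simp: \<eta>_def)
    have g: "0 \<le> g i" "g i \<le> g j" "g j \<le> T" "g j - g i = real (j - i) / real n" "0 \<le> g j"
        "g i \<le> T" "g j - g i \<le> \<tau>" "g j - g i \<le> 1"
      if "i0 \<le> i" "i \<le> j" "j \<le> j0" for i j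
    proof -
      have "g j \<le> g j0" "g i0 \<le> g i"
        using that by (auto simp: g_def divide_right_mono)
      moreover have "g j0 - g i0 \<le> \<tau>"
        using j0 by (simp add: g_def of_nat_diff diff_divide_distrib)
      moreover have "g j0 \<le> T" "g i \<le> g j"
        using j0 that by (auto simp: g_def divide_right_mono)
      ultimately show "g j \<le> T" "g i \<le> T" "g j - g i \<le> \<tau>" "g j - g i \<le> 1"
        using tau by linarith+
    qed (use that in \<open>auto simp: g_def of_nat_diff diff_divide_distrib divide_right_mono\<close>)
    have w: "w i \<in> B" "N (w i) \<le> L" if "i0 \<le> i" "i \<le> j0" for i
      using g[of i i] that by (auto simp: w_def intro: v L(2))
    \<comment> \<open>The scheme has no remainder over a single step, so \<open>D i (Suc i)\<close>
      is minus the one-step remainder of the solution, of size L n^(-3\<gamma>).\<close>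
    define D where "D = (\<lambda>i j. (y j - step (g j) (g i) (y i)) - (w j - step (g j) (g i) (w i)))"
    have incr: "N ((y j - y i - X (g j) (g i) (y i) (y i)) - (w j - w i - X (g j) (g i) (w i) (w i)))
          \<le> \<Lambda>1 * \<eta> * (g j - g i) powr (2 * \<gamma>)"
        "N ((y j - y i) - (w j - w i)) \<le> \<Lambda>1 * \<eta> * (g j - g i) powr \<gamma>"
        "N (y i) \<le> L + 1"
      if "i0 \<le> i" "i \<le> j" "j \<le> j0" "y i \<in> B" "y j \<in> B" "N (y i - w i) \<le> \<eta>"
        "N (D i j) \<le> \<eta> * (g j - g i) powr (2 * \<gamma>)" for i j
    proof -
      have "N (y i) = N ((y i - w i) + w i)"
        by simp
      also have "\<dots> \<le> \<eta> + L"
        using that w[of i] by (intro N_add_le) auto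
      finally show yL: "N (y i) \<le> L + 1"
        using eta by simp
      note I = increment_diff[of "g i" "g j" "y i" "y j" "w i" "w j" "L + 1" \<eta>]
      have I1: "N ((y j - y i - X (g j) (g i) (y i) (y i)) - (w j - w i - X (g j) (g i) (w i) (w i)))
          \<le> (1 + 3 * K * (L + 1) ^ 2) * \<eta> * (g j - g i) powr (2 * \<gamma>)"
        using that g[of i j] w[of i] w[of j] L(1) yL D_def by (intro I(1)) auto
      also have "\<dots> \<le> \<Lambda>1 * \<eta> * (g j - g i) powr (2 * \<gamma>)"
        using Lam1 eta by (intro mult_right_mono) auto
      finally show "N ((y j - y i - X (g j) (g i) (y i) (y i)) - (w j - w i - X (g j) (g i) (w i) (w i)))
          \<le> \<Lambda>1 * \<eta> * (g j - g i) powr (2 * \<gamma>)" .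
      show "N ((y j - y i) - (w j - w i)) \<le> \<Lambda>1 * \<eta> * (g j - g i) powr \<gamma>"
        unfolding \<Lambda>1_def using that g[of i j] w[of i] w[of j] L(1) yL D_def by (intro I(2)) auto
    qed
    have main: "(\<forall>k. i0 \<le> k \<and> k \<le> m \<longrightarrow> y k \<in> B \<and> N (y k - w k) \<le> \<eta>) \<and>
        (\<forall>i k. i0 \<le> i \<and> i < k \<and> k \<le> m \<longrightarrow> N (D i k) \<le> \<eta> * (g k - g i) powr (2 * \<gamma>))"
      if "i0 \<le> m" "m \<le> j0" for m
      using that
    proof (induction m rule: dec_induct)
      case base
      have "N (y k - w k) \<le> \<eta>" if "k = i0" for k
        using y0 eta \<open>a \<ge> 0\<close> that by (auto simp: w_def g_def)
      then show ?case
        using y0 by auto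
    next
      case (step m)
      have m: "i0 \<le> m" "m < j0" "Suc m \<le> j0"
        using step by auto
      have yB: "y k \<in> B" "N (y k - w k) \<le> \<eta>" if "i0 \<le> k" "k \<le> m" for k
        using step m that by auto
      have DB: "N (D i k) \<le> \<eta> * (g k - g i) powr (2 * \<gamma>)" if "i0 \<le> i" "i < k" "k \<le> m" for i k
        using step m that by auto
      have ym: "y (Suc m) = step (g (Suc m)) (g m) (y m)"
        by (simp add: y g_def)
      \<comment> \<open>Membership at \<open>Suc m\<close> is available at once; the norm bound
        there has to wait for \<open>D_le\<close>, which uses norms of \<open>y\<close> only up to
        \<open>m\<close>.\<close>
      have yB': "y k \<in> B" if "i0 \<le> k" "k \<le> Suc m" for k
        using yB[of k] yB[of m] ym g[of m "Suc m"] m that by (cases "k = Suc m") auto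
      have D_le: "N (D i j) \<le> \<eta> * (g j - g i) powr (2 * \<gamma>)" if ij: "i0 \<le> i" "i < j" "j \<le> Suc m" for i j
      proof -
        have "N (D i j) \<le> (M * \<eta> * (1 / real n) powr (3 * \<gamma>)) / (1 - (2/3) powr (3 * \<gamma> - 1))
              * real (j - i) powr (3 * \<gamma>) + real (j - i) * (L * (1 / real n) powr (3 * \<gamma>))"
        proof (rule discrete_sewing[where a = i0 and b = "Suc m"])
          show "3 * \<gamma> > 1" "M * \<eta> * (1 / real n) powr (3 * \<gamma>) \<ge> 0"
            using gamma M eta by auto
          show "N (D i (Suc i)) \<le> L * (1 / real n) powr (3 * \<gamma>)" if "i0 \<le> i" "i < Suc m" for i
          proof -
            have gi: "g (Suc i) - g i = 1 / real n" "0 \<le> g i" "g i \<le> g (Suc i)" "g (Suc i) \<le> T"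
              using g[of i "Suc i"] that m by auto
            have "D i (Suc i) = - (w (Suc i) - step (g (Suc i)) (g i) (w i))"
              unfolding D_def using y[of i] by (simp add: g_def)
            then have "N (D i (Suc i)) = N (w (Suc i) - step (g (Suc i)) (g i) (w i))"
              by (simp only: N_uminus)
            also have "\<dots> \<le> L * (g (Suc i) - g i) powr (3 * \<gamma>)"
              unfolding w_def using gi by (intro L)
            finally show ?thesis
              using gi by simp
          qed
          show "N (D i j) \<le> N (D i k) + N (D k j) + M * \<eta> * (1 / real n) powr (3 * \<gamma>) * real (j - i) powr (3 * \<gamma>)"
            if "i0 \<le> i" "i < k" "k < j" "j \<le> Suc m" for i k j
          proof -
            have B: "y i \<in> B" "y k \<in> B" "y j \<in> B" "w i \<in> B" "w k \<in> B" "w j \<in> B"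
              using that m by (auto intro!: yB' w)
            note gs = g[of i k] g[of k j] g[of i j]
            have gg: "0 \<le> g i" "g i \<le> g k" "g k \<le> g j" "g j \<le> T" "0 \<le> g k" "g k \<le> T"
              using gs that m by auto
            let ?\<tau> = "g j - g i"
            have mono: "C * (g k - g i) powr e \<le> C' * ?\<tau> powr e" if "0 \<le> C" "C \<le> C'" "0 \<le> e" for C C' e
              using that gg by (intro mult_mono powr_mono2) auto
            have inc: "N ((y k - y i - X (g k) (g i) (y i) (y i)) - (w k - w i - X (g k) (g i) (w i) (w i)))
                  \<le> \<Lambda>1 * \<eta> * (g k - g i) powr (2 * \<gamma>)"
                "N ((y k - y i) - (w k - w i)) \<le> \<Lambda>1 * \<eta> * (g k - g i) powr \<gamma>"
                "N (y i) \<le> L + 1"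
              using incr[of i k] yB[of i] yB[of k] DB[of i k] that m by auto
            have wh: "N (w k - w i) \<le> L * (g k - g i) powr \<gamma>"
              "N (w k - w i - X (g k) (g i) (w i) (w i)) \<le> L * (g k - g i) powr (2 * \<gamma>)"
              using gg by (auto simp: w_def intro: L)
            have yk: "N (y k) \<le> L + 1"
            proof -
              have "N ((y k - w k) + w k) \<le> \<eta> + L"
                using that m B by (intro N_add_le yB w) auto
              then show ?thesis
                using eta by simp
            qed
            have eq: "D i j = D i k + D k j
                + (defect (g j) (g k) (g i) (y i) (y k) - defect (g j) (g k) (g i) (w i) (w k))"
              using defect_eq[of "g i" "g k" "g j" "y i" "y k" "y j"]
                defect_eq[of "g i" "g k" "g j" "w i" "w k" "w j"] gg B
              by (simp add: D_def)
            \<comment> \<open>Here \<eta> \<le> 1 enters: the increments of \<open>y\<close> are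
              those of the solution plus a perturbation bounded independently of \<eta>, so
              \<open>M\<close> does not depend on the error.\<close>
            have le1: "\<Lambda>1 * \<eta> \<le> \<Lambda>1"
              using eta Lam1 by (simp add: mult_left_le)
            have le2: "\<Lambda>1 * \<eta> * u + L * u \<le> (L + \<Lambda>1) * u" if "0 \<le> u" for u
              using mult_right_mono[OF le1 that] by (simp add: algebra_simps)
            have d_le: "N (defect (g j) (g k) (g i) (y i) (y k) - defect (g j) (g k) (g i) (w i) (w k))
                \<le> M * \<eta> * ?\<tau> powr (3 * \<gamma>)"
              unfolding M_def
            proof (rule defect_diff_le)
              have "N (y k - y i) = N (((y k - y i) - (w k - w i)) + (w k - w i))"
                by simp
              also have "\<dots> \<le> \<Lambda>1 * \<eta> * (g k - g i) powr \<gamma> + L * (g k - g i) powr \<gamma>"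
                using B by (intro N_add_le inc wh) auto
              also have "\<dots> \<le> (L + \<Lambda>1) * (g k - g i) powr \<gamma>"
                by (intro le2) auto
              also have "\<dots> \<le> \<Lambda> * ?\<tau> powr \<gamma>"
                using Lam L(1) Lam1 gamma by (intro mono) auto
              finally show "N (y k - y i) \<le> \<Lambda> * ?\<tau> powr \<gamma>" .
              have "N (y k - y i - X (g k) (g i) (y i) (y i))
                = N (((y k - y i - X (g k) (g i) (y i) (y i)) - (w k - w i - X (g k) (g i) (w i) (w i)))
                  + (w k - w i - X (g k) (g i) (w i) (w i)))"
                by simp
              also have "\<dots> \<le> \<Lambda>1 * \<eta> * (g k - g i) powr (2 * \<gamma>) + L * (g k - g i) powr (2 * \<gamma>)"
                using B gg by (intro N_add_le inc wh) auto
              also have "\<dots> \<le> (L + \<Lambda>1) * (g k - g i) powr (2 * \<gamma>)"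
                by (intro le2) auto
              also have "\<dots> \<le> \<Lambda> * ?\<tau> powr (2 * \<gamma>)"
                using Lam L(1) Lam1 gamma by (intro mono) auto
              finally show "N (y k - y i - X (g k) (g i) (y i) (y i)) \<le> \<Lambda> * ?\<tau> powr (2 * \<gamma>)" .
              show "N (w k - w i) \<le> \<Lambda> * ?\<tau> powr \<gamma>"
                using Lam L(1) gamma by (intro order_trans[OF wh(1)] mono) auto
              have "\<Lambda>1 * \<eta> \<le> \<Lambda> * \<eta>"
                using Lam eta by (intro mult_right_mono) auto
              then show "N (y k - y i - (w k - w i)) \<le> \<Lambda> * \<eta> * ?\<tau> powr \<gamma>"
                and "N (y k - y i - X (g k) (g i) (y i) (y i) - (w k - w i - X (g k) (g i) (w i) (w i)))
                  \<le> \<Lambda> * \<eta> * ?\<tau> powr (2 * \<gamma>)"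
                using Lam1 eta gamma
                by (auto intro!: order_trans[OF inc(1)] order_trans[OF inc(2)] mono mult_nonneg_nonneg)
              show "N (y i) \<le> \<Lambda>" "N (y k) \<le> \<Lambda>" "N (w i) \<le> \<Lambda>" "N (w k) \<le> \<Lambda>"
                using inc(3) yk w(2)[of i] w(2)[of k] Lam that m by auto
              show "N (y i - w i) \<le> \<eta>" "N (y k - w k) \<le> \<eta>"
                using that m by (auto intro: yB)
            qed (use gg B Lam in auto)
            have "N (D i j) \<le> N (D i k) + N (D k j) + M * \<eta> * ?\<tau> powr (3 * \<gamma>)"
              unfolding eq using B gg that by (intro N_add_le order_refl d_le) (auto simp: D_def)
            also have "?\<tau> powr (3 * \<gamma>) = (1 / real n) powr (3 * \<gamma>) * real (j - i) powr (3 * \<gamma>)"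
              using g(4)[of i j] that m n by (simp add: powr_divide)
            finally show ?thesis
              by (simp add: mult_ac)
          qed
        qed (use ij in auto)
        also have "\<dots> = c * M * \<eta> * (g j - g i) powr (3 * \<gamma>) + L * real n powr (1 - 3 * \<gamma>) * (g j - g i)"
        proof -
          have 1: "g j - g i = real (j - i) / real n"
            using g[of i j] ij m by auto
          have 2: "(1 / real n) powr (3 * \<gamma>) = real n powr (1 - 3 * \<gamma>) / real n"
            using n by (simp add: powr_diff powr_divide)
          have 3: "(1 / real n) powr (3 * \<gamma>) * real (j - i) powr (3 * \<gamma>) = (real (j - i) / real n) powr (3 * \<gamma>)"
            by (simp add: powr_divide)
          have "(M * \<eta> * (1 / real n) powr (3 * \<gamma>)) / (1 - (2/3) powr (3 * \<gamma> - 1)) * real (j - i) powr (3 * \<gamma>)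
            = c * M * \<eta> * ((1 / real n) powr (3 * \<gamma>) * real (j - i) powr (3 * \<gamma>))"
            by (simp add: c_def)
          moreover have "real (j - i) * (L * (1 / real n) powr (3 * \<gamma>)) = L * real n powr (1 - 3 * \<gamma>) * (real (j - i) / real n)"
            unfolding 2 by simp
          ultimately show ?thesis
            unfolding 1 3 by simp
        qed
        \<comment> \<open>In the first term 3\<gamma> = \<gamma> + 2\<gamma>, and \<tau> absorbs the
          power \<gamma>. In the second the length is below its own 2\<gamma>-th power, being at
          most 1 with 2\<gamma> \<le> 1.\<close>
        also have "\<dots> \<le> \<eta> / 2 * (g j - g i) powr (2 * \<gamma>) + \<eta> / 2 * (g j - g i) powr (2 * \<gamma>)"
        proof (rule add_mono)
          have ge: "0 \<le> g j - g i" "g j - g i \<le> \<tau>" "g j - g i \<le> 1" "g j - g i > 0"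
            using g[of i j] ij m n by auto
          have "c * M * \<eta> * (g j - g i) powr (3 * \<gamma>) = (c * M * (g j - g i) powr \<gamma>) * \<eta> * (g j - g i) powr (2 * \<gamma>)"
            by (simp add: powr_add[symmetric])
          also have "\<dots> \<le> (c * M * \<tau> powr \<gamma>) * \<eta> * (g j - g i) powr (2 * \<gamma>)"
            using ge c M eta gamma by (intro mult_right_mono mult_left_mono powr_mono2) auto
          also have "\<dots> \<le> (1 / 2) * \<eta> * (g j - g i) powr (2 * \<gamma>)"
            using eta by (intro mult_right_mono tau2) auto
          finally show "c * M * \<eta> * (g j - g i) powr (3 * \<gamma>) \<le> \<eta> / 2 * (g j - g i) powr (2 * \<gamma>)"
            by simp
          have "g j - g i \<le> (g j - g i) powr (2 * \<gamma>)"
            using powr_mono'[of "2 * \<gamma>" 1 "g j - g i"] ge gamma by simp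
          then show "L * real n powr (1 - 3 * \<gamma>) * (g j - g i) \<le> \<eta> / 2 * (g j - g i) powr (2 * \<gamma>)"
            using eta ge by (intro mult_mono) auto
        qed
        finally show ?thesis
          by simp
      qed
      have "N (y (Suc m) - w (Suc m)) \<le> \<eta>"
      proof -
        have y00: "N (y i0 - w i0) \<le> a"
          using y0 by (simp add: w_def g_def)
        have "y (Suc m) - w (Suc m) = (y i0 - w i0) + ((y (Suc m) - y i0) - (w (Suc m) - w i0))"
          by simp
        also have "N \<dots> \<le> a + \<Lambda>1 * \<eta> * (g (Suc m) - g i0) powr \<gamma>"
          using m by (intro N_add_le y00 incr D_le yB yB') (auto intro!: B_diff yB' w)
        also have "\<dots> \<le> \<eta> / 2 + \<Lambda> * \<eta> * \<tau> powr \<gamma>"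
          using eta Lam Lam1 g[of i0 "Suc m"] m gamma
          by (intro add_mono mult_mono powr_mono2 mult_right_mono) auto
        also have "\<Lambda> * \<eta> * \<tau> powr \<gamma> = \<Lambda> * \<tau> powr \<gamma> * \<eta>"
          by simp
        also have "\<dots> \<le> 1 / 2 * \<eta>"
          using eta by (intro mult_right_mono tau2) auto
        finally show ?thesis
          by simp
      qed
      then show ?case
        using D_le yB yB' by (metis le_Suc_eq)
    qed
    show "y j0 \<in> B \<and> N (y j0 - v (real j0 / real n)) \<le> 2 * a + 2 * L * real n powr (1 - 3 * \<gamma>)"
      using main[of j0] j0 by (auto simp: w_def g_def \<eta>_def)
  qed
qed

text \<open>Windows are chained: an error e at the start of a window is at most 2 e + 2 r throughout
  it, with r = L n^(1 - 3\<gamma>), hence at most (2^q - 1) 2 r after q windows. The number of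
  windows does not depend on \<open>n\<close>.\<close>

lemma euler_convergence:
  assumes v: "\<And>t. 0 \<le> t \<Longrightarrow> t \<le> T \<Longrightarrow> v t \<in> B"
    and holder: "\<And>s t. 0 \<le> s \<Longrightarrow> s \<le> t \<Longrightarrow> t \<le> T \<Longrightarrow> N (v t - v s) \<le> H * (t - s) powr \<gamma>"
    and small: "\<And>\<epsilon>. 0 < \<epsilon> \<Longrightarrow> \<exists>h>0. \<forall>s t. 0 \<le> s \<and> s \<le> t \<and> t \<le> T \<and> t - s \<le> h \<longrightarrow>
        N (v t - step t s (v s)) \<le> \<epsilon> * (t - s)"
  obtains C n0 where "C \<ge> 0" "\<And>n y j. n \<ge> n0 \<Longrightarrow> y 0 = v 0 \<Longrightarrow>
      (\<And>i. y (Suc i) = step (real (Suc i) / real n) (real i / real n) (y i)) \<Longrightarrow>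
      real j / real n \<le> T \<Longrightarrow>
      y j \<in> B \<and> N (y j - v (real j / real n)) \<le> C * real n powr (1 - 3 * \<gamma>)"
proof -
  obtain L where L: "L \<ge> 1" "\<And>t. 0 \<le> t \<Longrightarrow> t \<le> T \<Longrightarrow> N (v t) \<le> L"
    "\<And>s t. 0 \<le> s \<Longrightarrow> s \<le> t \<Longrightarrow> t \<le> T \<Longrightarrow> N (v t - v s) \<le> L * (t - s) powr \<gamma>"
    "\<And>s t. 0 \<le> s \<Longrightarrow> s \<le> t \<Longrightarrow> t \<le> T \<Longrightarrow> N (v t - v s - X t s (v s) (v s)) \<le> L * (t - s) powr (2 * \<gamma>)"
    "\<And>s t. 0 \<le> s \<Longrightarrow> s \<le> t \<Longrightarrow> t \<le> T \<Longrightarrow> N (v t - step t s (v s)) \<le> L * (t - s) powr (3 * \<gamma>)"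
    using remainder_bound[OF v holder small] by blast
  obtain \<tau> where tau: "\<tau> > 0" and win: "\<And>n y i j a. n > 0 \<Longrightarrow>
      (\<And>i. y (Suc i) = step (real (Suc i) / real n) (real i / real n) (y i)) \<Longrightarrow> y i \<in> B \<Longrightarrow>
      N (y i - v (real i / real n)) \<le> a \<Longrightarrow> 2 * a + 2 * L * real n powr (1 - 3 * \<gamma>) \<le> 1 \<Longrightarrow> i \<le> j \<Longrightarrow>
      real j / real n \<le> T \<Longrightarrow> real (j - i) / real n \<le> \<tau> \<Longrightarrow>
      y j \<in> B \<and> N (y j - v (real j / real n)) \<le> 2 * a + 2 * L * real n powr (1 - 3 * \<gamma>)"
    using window_stability[OF v L] by blast
  \<comment> \<open>A window consists of floor(\<tau> n) steps, which is at least \<tau> n / 2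
    because \<tau> n \<ge> 1; hence the factor 2.\<close>
  define Q where "Q = nat \<lceil>2 * T / \<tau>\<rceil>"
  have Q: "real Q \<ge> 2 * T / \<tau>"
    by (simp add: Q_def of_nat_ceiling)
  \<comment> \<open>Dominates the error after all \<open>Q\<close> windows. Requiring
    \<open>C * real n powr (1 - 3 * \<gamma>) < 1\<close> below secures the smallness hypothesis of
    \<open>win\<close> in every window at once.\<close>
  define C where "C = 2 ^ Suc Q * L"
  have "((\<lambda>n. C * real n powr (1 - 3 * \<gamma>)) \<longlongrightarrow> C * 0) sequentially"
    using gamma by (intro tendsto_mult tendsto_const tendsto_neg_powr filterlim_real_sequentially) auto
  hence "eventually (\<lambda>n. C * real n powr (1 - 3 * \<gamma>) < 1) sequentially"
    by (intro order_tendstoD(2)) auto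
  moreover have "eventually (\<lambda>n. real n \<ge> 1 / \<tau>) sequentially"
    using filterlim_real_sequentially unfolding filterlim_at_top by blast
  ultimately have "eventually (\<lambda>n. C * real n powr (1 - 3 * \<gamma>) < 1 \<and> real n \<ge> 1 / \<tau>) sequentially"
    by (rule eventually_conj)
  then obtain n0 where n0: "\<And>n. n \<ge> n0 \<Longrightarrow> C * real n powr (1 - 3 * \<gamma>) < 1 \<and> real n \<ge> 1 / \<tau>"
    unfolding eventually_sequentially by blast
  show ?thesis
  proof (rule that[of C n0])
    show "C \<ge> 0"
      using L by (simp add: C_def)
    fix n :: nat and y :: "nat \<Rightarrow> 'a" and j :: nat
    assume n: "n \<ge> n0" and y0: "y 0 = v 0"
      and y: "\<And>i. y (Suc i) = step (real (Suc i) / real n) (real i / real n) (y i)"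
      and j: "real j / real n \<le> T"
    define r where "r = L * real n powr (1 - 3 * \<gamma>)"
    have r0: "r \<ge> 0"
      using L by (simp add: r_def)
    have nt: "real n \<ge> 1 / \<tau>" "C * real n powr (1 - 3 * \<gamma>) < 1"
      using n0[OF n] by auto
    have npos: "n > 0"
      using nt tau by (intro Nat.gr0I) (auto simp: field_simps)
    have Cr: "C * real n powr (1 - 3 * \<gamma>) = 2 ^ Suc Q * r"
      by (simp add: C_def r_def)
    define l where "l = nat \<lfloor>\<tau> * n\<rfloor>"
    have "\<tau> * n \<ge> 1"
      using nt tau by (simp add: field_simps)
    hence "\<lfloor>\<tau> * n\<rfloor> \<ge> 1"
      by simp
    hence "real l = real_of_int \<lfloor>\<tau> * n\<rfloor>" "real l \<ge> 1"
      by (auto simp: l_def)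
    hence l: "real l \<le> \<tau> * n" "real l \<ge> \<tau> * n / 2"
      using floor_correct[of "\<tau> * n"] by linarith+
    have "j \<le> q * l \<Longrightarrow> real j / real n \<le> T \<Longrightarrow> q \<le> Q \<Longrightarrow>
        y j \<in> B \<and> N (y j - v (real j / real n)) \<le> (2 ^ q - 1) * (2 * r)" for q j
    proof (induction q arbitrary: j)
      case 0
      then show ?case
        using v[of 0] T y0 by (simp add: N_zero)
    next
      case (Suc q)
      show ?case
      proof (cases "j \<le> q * l")
        case True
        have "(2 ^ q - 1) * (2 * r) \<le> (2 ^ Suc q - 1) * (2 * r)"
          using r0 by (intro mult_right_mono) auto
        then show ?thesis
          using Suc.IH[OF True] Suc.prems by force
      next
        case False
        define i where "i = q * l"
        have i: "i \<le> j" "j - i \<le> l"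
          using False Suc.prems by (auto simp: i_def)
        have iT: "real i / real n \<le> T"
          using i npos by (intro order_trans[OF _ Suc.prems(2)] divide_right_mono) auto
        have IH: "y i \<in> B" "N (y i - v (real i / real n)) \<le> (2 ^ q - 1) * (2 * r)"
          using Suc.IH[of i] Suc.prems iT by (auto simp: i_def)
        have eq: "2 * ((2 ^ q - 1) * (2 * r)) + 2 * L * real n powr (1 - 3 * \<gamma>) = (2 ^ Suc q - 1) * (2 * r)"
          by (simp add: r_def algebra_simps)
        have "(2 ^ Suc q - 1) * (2 * r) \<le> 2 ^ Q * (2 * r)"
          using r0 Suc.prems power_increasing[of "Suc q" Q "2::real"] by (intro mult_right_mono) auto
        also have "\<dots> \<le> 1"
          using nt Cr by simp
        finally have le1: "2 * ((2 ^ q - 1) * (2 * r)) + 2 * L * real n powr (1 - 3 * \<gamma>) \<le> 1"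
          unfolding eq .
        have "real (j - i) \<le> real l"
          using i by (intro of_nat_mono)
        hence "real (j - i) / real n \<le> \<tau>"
          using l npos by (simp add: field_simps)
        from win[OF npos y IH le1 i(1) Suc.prems(2) this] show ?thesis
          unfolding eq .
      qed
    qed
    moreover have "j \<le> Q * l"
    proof -
      have "real j \<le> T * n"
        using j npos by (simp add: field_simps)
      also have "\<dots> = (2 * T / \<tau>) * (\<tau> * n / 2)"
        using tau by simp
      also have "\<dots> \<le> real Q * real l"
        using Q l tau T by (intro mult_mono) auto
      finally show ?thesis
        by (metis of_nat_le_iff of_nat_mult)
    qed
    ultimately have "y j \<in> B \<and> N (y j - v (real j / real n)) \<le> (2 ^ Q - 1) * (2 * r)"
      using j by blast
    moreover have "(2 ^ Q - 1) * (2 * r) \<le> C * real n powr (1 - 3 * \<gamma>)"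
      unfolding Cr using r0 by (simp add: algebra_simps)
    ultimately show "y j \<in> B \<and> N (y j - v (real j / real n)) \<le> C * real n powr (1 - 3 * \<gamma>)"
      by linarith
  qed
qed

end

section \<open>Weighted sequence spaces in dual form\<close>

text \<open>Differs from \<open>powr\<close> only in \<open>pw 0 0 = 1\<close>. Factors with
  exponent u or 1 - u thus disappear at the endpoints u = 0 and u = 1, as Hoelder's inequality
  requires, and \<open>pw_add\<close> holds for all nonnegative exponents.\<close>

definition pw :: "real \<Rightarrow> real \<Rightarrow> real" where
  "pw x u = (if u = 0 then 1 else x powr u)"

lemma pw_nonneg [simp]: "0 \<le> pw x u"
  by (simp add: pw_def)

lemma pw_0 [simp]: "pw x 0 = 1"
  by (simp add: pw_def)

lemma pw_1 [simp]: "0 \<le> x \<Longrightarrow> pw x 1 = x"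
  by (simp add: pw_def)

lemma pw_one [simp]: "pw 1 u = 1"
  by (simp add: pw_def)

lemma pw_mult: "0 \<le> x \<Longrightarrow> 0 \<le> y \<Longrightarrow> pw (x * y) u = pw x u * pw y u"
  by (simp add: pw_def powr_mult)

lemma pw_add: "0 \<le> u \<Longrightarrow> 0 \<le> v \<Longrightarrow> pw x (u + v) = pw x u * pw x v"
  by (auto simp: pw_def powr_add)

lemma pw_le_one: "0 \<le> x \<Longrightarrow> x \<le> 1 \<Longrightarrow> 0 \<le> u \<Longrightarrow> pw x u \<le> 1"
  by (auto simp: pw_def intro: powr_le1)

lemma young2:
  assumes "0 \<le> a" "0 \<le> b" "a + b = 1" "0 \<le> x" "0 \<le> y"
  shows "pw x a * pw y b \<le> a * x + b * y"
proof (cases "a = 0 \<or> b = 0")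
  case True
  then show ?thesis
    using assms by auto
next
  case False
  then show ?thesis
    using assms Youngs_inequality_0[of a b x y] by (cases "x = 0 \<or> y = 0") (auto simp: pw_def)
qed

lemma young3:
  assumes "0 \<le> a" "0 \<le> b" "0 \<le> c" "a + b + c = 1" "0 \<le> x" "0 \<le> y" "0 \<le> z"
  shows "pw x a * pw y b * pw z c \<le> a * x + b * y + c * z"
proof (cases "b + c = 0")
  case True
  then have "b = 0" "c = 0"
    using assms by linarith+
  then show ?thesis
    using assms by simp
next
  case False
  define s where "s = b + c"
  have s: "s > 0"
    using False assms by (simp add: s_def)
  have 1: "pw (pw y (b / s) * pw z (c / s)) s = pw y b * pw z c"
    using s assms by (auto simp: pw_def powr_mult powr_powr)
  have "pw x a * pw (pw y (b / s) * pw z (c / s)) s \<le> a * x + s * (pw y (b / s) * pw z (c / s))"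
    using s assms by (intro young2) (auto simp: s_def)
  also have "\<dots> \<le> a * x + s * (b / s * y + c / s * z)"
    using s assms by (intro add_left_mono mult_left_mono young2) (auto simp: s_def add_divide_distrib[symmetric])
  finally show ?thesis
    using s unfolding 1 by (simp add: distrib_left mult.assoc)
qed

text \<open>With values in [0, \<infinity>], interchange, reindexing and comparison carry no
  summability conditions; convergence of the complex sums is recovered afterwards from a finite
  majorant.\<close>

abbreviation tsum :: "('a \<Rightarrow> ennreal) \<Rightarrow> ennreal" where
  "tsum f \<equiv> nn_integral (count_space UNIV) f"

lemma tsum_swap:
  fixes f :: "'a::countable \<Rightarrow> 'b \<Rightarrow> ennreal"
  shows "tsum (\<lambda>x. tsum (\<lambda>y. f x y)) = tsum (\<lambda>y. tsum (\<lambda>x. f x y))"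
  by (rule nn_integral_count_space_nn_integral[symmetric]) auto

lemma tsum_mono: "(\<And>x. f x \<le> g x) \<Longrightarrow> tsum f \<le> tsum g"
  by (rule nn_integral_mono)

lemma tsum_add: "tsum (\<lambda>x. f x + g x) = tsum f + tsum g"
  by (rule nn_integral_add) auto

lemma tsum_cmult: "tsum (\<lambda>x. c * f x) = c * tsum f"
  by (rule nn_integral_cmult) auto

lemma tsum_multc: "tsum (\<lambda>x. f x * c) = tsum f * c"
  by (rule nn_integral_multc) auto

lemma tsum_bij: "bij h \<Longrightarrow> tsum (\<lambda>x. f (h x)) = tsum f"
  by (rule nn_integral_bij_count_space)

lemma tsum_diff_left: "tsum (\<lambda>x::int. f (k - x)) = tsum f"
  by (rule tsum_bij[of "\<lambda>x. k - x"]) (auto intro!: bij_betwI[where g = "\<lambda>x. k - x"])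

lemma sum_le_tsum: "finite F \<Longrightarrow> sum f F \<le> tsum f"
  by (subst nn_integral_count_space_finite[symmetric])
    (auto simp: nn_integral_count_space_indicator split: split_indicator intro!: nn_integral_mono)

lemma le_tsum: "f x \<le> tsum f"
  using sum_le_tsum[of "{x}" f] by simp

text \<open>Monotone convergence along the intervals from -n to n.\<close>

lemma tsum_le:
  fixes f :: "int \<Rightarrow> ennreal"
  assumes "\<And>F. finite F \<Longrightarrow> sum f F \<le> C"
  shows "tsum f \<le> C"
proof -
  have "f x = (SUP n. f x * indicator {- int n..int n} x)" for x
  proof (rule antisym)
    have "f x = f x * indicator {- int (nat \<bar>x\<bar>)..int (nat \<bar>x\<bar>)} x"
      by (auto simp: indicator_def)
    also have "\<dots> \<le> (SUP n. f x * indicator {- int n..int n} x)"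
      by (rule SUP_upper) auto
    finally show "f x \<le> (SUP n. f x * indicator {- int n..int n} x)" .
    show "(SUP n. f x * indicator {- int n..int n} x) \<le> f x"
      by (intro SUP_least) (auto simp: indicator_def)
  qed
  hence "tsum f = tsum (\<lambda>x. SUP n. f x * indicator {- int n..int n} x)"
    by simp
  also have "\<dots> = (SUP n. tsum (\<lambda>x. f x * indicator {- int n..int n} x))"
    by (rule nn_integral_monotone_convergence_SUP)
      (auto simp: incseq_def le_fun_def split: split_indicator intro!: mult_left_mono)
  also have "\<dots> \<le> C"
  proof (rule SUP_least)
    fix n
    have "tsum (\<lambda>x. f x * indicator {- int n..int n} x) = sum f {- int n..int n}"
      by (simp add: nn_integral_count_space_indicator[symmetric] nn_integral_count_space_finite)
    then show "tsum (\<lambda>x. f x * indicator {- int n..int n} x) \<le> C"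
      using assms by simp
  qed
  finally show ?thesis .
qed

lemma summable_of_tsum:
  fixes f :: "'a \<Rightarrow> complex"
  assumes "\<And>x. x \<in> S \<Longrightarrow> norm (f x) \<le> g x" "\<And>x. 0 \<le> g x" "tsum (\<lambda>x. ennreal (g x)) < top"
  shows "(\<lambda>x. norm (f x)) summable_on S"
proof (rule nonneg_bdd_above_summable_on)
  show "bdd_above (sum (\<lambda>x. norm (f x)) ` {F. F \<subseteq> S \<and> finite F})"
  proof (rule bdd_aboveI2)
    fix F assume F: "F \<in> {F. F \<subseteq> S \<and> finite F}"
    have "ennreal (sum (\<lambda>x. norm (f x)) F) \<le> ennreal (sum g F)"
      using F assms by (intro ennreal_leI sum_mono) auto
    also have "\<dots> = sum (\<lambda>x. ennreal (g x)) F"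
      using assms by simp
    also have "\<dots> \<le> tsum (\<lambda>x. ennreal (g x))"
      using F by (intro sum_le_tsum) auto
    also have "\<dots> = ennreal (enn2real (tsum (\<lambda>x. ennreal (g x))))"
      using assms(3) by simp
    finally show "sum (\<lambda>x. norm (f x)) F \<le> enn2real (tsum (\<lambda>x. ennreal (g x)))"
      by (simp add: ennreal_le_iff)
  qed
qed auto

text \<open>If the majorant diverges the right side is infinite, so majorants may be inserted before
  they are known to be finite.\<close>

lemma norm_infsum_le_tsum:
  fixes f :: "'a \<Rightarrow> complex"
  assumes "\<And>x. x \<in> S \<Longrightarrow> norm (f x) \<le> g x" "\<And>x. 0 \<le> g x"
  shows "ennreal (norm (infsum f S)) \<le> tsum (\<lambda>x. ennreal (g x))"
proof (cases "tsum (\<lambda>x. ennreal (g x)) < top")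
  case True
  have sm: "(\<lambda>x. norm (f x)) summable_on S"
    using assms True by (rule summable_of_tsum)
  have "norm (infsum f S) \<le> infsum (\<lambda>x. norm (f x)) S"
    by (rule norm_infsum_bound[OF sm])
  also have "\<dots> \<le> enn2real (tsum (\<lambda>x. ennreal (g x)))"
  proof (rule infsum_le_finite_sums[OF sm])
    fix F assume F: "finite F" "F \<subseteq> S"
    have "ennreal (sum (\<lambda>x. norm (f x)) F) \<le> ennreal (sum g F)"
      using F assms by (intro ennreal_leI sum_mono) auto
    also have "\<dots> = sum (\<lambda>x. ennreal (g x)) F"
      using assms by simp
    also have "\<dots> \<le> tsum (\<lambda>x. ennreal (g x))"
      using F by (intro sum_le_tsum) auto
    also have "\<dots> = ennreal (enn2real (tsum (\<lambda>x. ennreal (g x))))"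
      using True by simp
    finally show "sum (\<lambda>x. norm (f x)) F \<le> enn2real (tsum (\<lambda>x. ennreal (g x)))"
      by (simp add: ennreal_le_iff)
  qed
  finally have "ennreal (norm (infsum f S)) \<le> ennreal (enn2real (tsum (\<lambda>x. ennreal (g x))))"
    by (rule ennreal_leI)
  then show ?thesis
    using True by simp
next
  case False
  then have "tsum (\<lambda>x. ennreal (g x)) = top"
    using top.not_eq_extremum by blast
  then show ?thesis
    by simp
qed

text \<open>The nonnegative part of the unit ball of \<ell>^1. The powers \<open>pw (D k) u\<close>
  dominate the unit ball of \<ell>^(1/u), so one family of objects serves all p, and Young's
  inequality reduces multilinear bounds to sums of products of unit masses.\<close>

definition unit_mass :: "(int \<Rightarrow> real) \<Rightarrow> bool" where
  "unit_mass D \<longleftrightarrow> (\<forall>k. 0 \<le> D k) \<and> tsum (\<lambda>k. ennreal (D k)) \<le> 1"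

lemma unit_mass_nonneg: "unit_mass D \<Longrightarrow> 0 \<le> D k"
  by (simp add: unit_mass_def)

lemma unit_mass_tsum: "unit_mass D \<Longrightarrow> tsum (\<lambda>k. ennreal (D k)) \<le> 1"
  by (simp add: unit_mass_def)

lemma unit_mass_le_one: "unit_mass D \<Longrightarrow> D k \<le> 1"
  using le_tsum[of "\<lambda>k. ennreal (D k)" k] order_trans unfolding unit_mass_def
  by (metis ennreal_le_1)

lemma unit_massI:
  assumes "\<And>k. 0 \<le> D k" "\<And>F. finite F \<Longrightarrow> sum D F \<le> 1"
  shows "unit_mass D"
  unfolding unit_mass_def
proof (intro conjI allI tsum_le)
  fix F :: "int set" assume "finite F"
  then have "ennreal (sum D F) \<le> 1"
    using assms(2) by (simp add: ennreal_le_1)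
  then show "(\<Sum>k\<in>F. ennreal (D k)) \<le> 1"
    using assms(1) by simp
qed (rule assms)

lemma unit_mass_sum: 
  assumes "unit_mass D" "finite F"
  shows "sum D F \<le> 1"
proof -
  have "ennreal (sum D F) = (\<Sum>k\<in>F. ennreal (D k))"
    using assms by (simp add: unit_mass_def)
  also have "\<dots> \<le> 1"
    using assms sum_le_tsum order_trans unfolding unit_mass_def by blast
  finally show ?thesis
    by (simp add: ennreal_le_1)
qed

text \<open>The \<open>\<ell>\<^sup>p\<close> norm, \<open>u = 1/p\<close>, in its dual form: the competitors \<open>B\<^sup>1\<^sup>-\<^sup>u\<close> run through the unit
  ball of the conjugate space. In this form the triangle inequality is immediate, the endpoints
  \<open>p = 1\<close> and \<open>p = \<infinity>\<close> need no special treatment (this is why \<open>pw 0 0 = 1\<close>), and multilinear bounds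
  follow from Young's inequality applied under the summation sign.\<close>

definition dnorm :: "real \<Rightarrow> (int \<Rightarrow> ennreal) \<Rightarrow> ennreal" where
  "dnorm u a = (SUP B\<in>{B. unit_mass B}. tsum (\<lambda>k. a k * ennreal (pw (B k) (1 - u))))"

lemma dnorm_mono: "(\<And>k. a k \<le> b k) \<Longrightarrow> dnorm u a \<le> dnorm u b"
  unfolding dnorm_def by (intro SUP_mono') (auto intro!: tsum_mono mult_right_mono)

lemma dnorm_add: "dnorm u (\<lambda>k. a k + b k) \<le> dnorm u a + dnorm u b"
  unfolding dnorm_def distrib_right tsum_add
  by (intro SUP_least add_mono) (auto intro!: SUP_upper)

lemma dnorm_cmult: "dnorm u (\<lambda>k. c * a k) = c * dnorm u a"
proof -
  have "unit_mass (\<lambda>_. 0)"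
    by (auto intro: unit_massI)
  then have "{B. unit_mass B} \<noteq> {}"
    by auto
  then show ?thesis
    unfolding dnorm_def by (simp add: mult.assoc tsum_cmult SUP_mult_left_ennreal)
qed

lemma tsum_le_dnorm: "unit_mass B \<Longrightarrow> tsum (\<lambda>k. a k * ennreal (pw (B k) (1 - u))) \<le> dnorm u a"
  unfolding dnorm_def by (rule SUP_upper) auto

lemma dnorm_le: 
  "(\<And>B. unit_mass B \<Longrightarrow> tsum (\<lambda>k. a k * ennreal (pw (B k) (1 - u))) \<le> C) \<Longrightarrow> dnorm u a \<le> C"
  unfolding dnorm_def by (rule SUP_least) auto

text \<open>Hoelder's inequality: \<open>young2\<close> under the sum splits the pairing into u
  times the mass of \<open>D\<close> plus 1 - u times the mass of \<open>B\<close>.\<close>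

lemma dnorm_ball_le:
  assumes u: "0 \<le> u" "u \<le> 1" and C: "C \<ge> 0"
    and D: "unit_mass D" "\<And>k. a k \<le> ennreal (C * pw (D k) u)"
  shows "dnorm u a \<le> ennreal C"
proof (rule dnorm_le)
  fix B assume B: "unit_mass B"
  have "a k * ennreal (pw (B k) (1 - u)) \<le> ennreal C * (ennreal u * ennreal (D k) + ennreal (1 - u) * ennreal (B k))" for k
  proof -
    have "a k * ennreal (pw (B k) (1 - u)) \<le> ennreal (C * pw (D k) u) * ennreal (pw (B k) (1 - u))"
      by (intro mult_right_mono D) auto
    also have "\<dots> = ennreal (C * (pw (D k) u * pw (B k) (1 - u)))"
      using C by (simp add: ennreal_mult[symmetric] mult.assoc)
    also have "\<dots> \<le> ennreal (C * (u * D k + (1 - u) * B k))"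
      using u C B D by (intro ennreal_leI mult_left_mono young2) (auto simp: unit_mass_nonneg)
    finally show ?thesis
      using u C B D(1) by (simp add: ennreal_mult unit_mass_nonneg)
  qed
  then have "tsum (\<lambda>k. a k * ennreal (pw (B k) (1 - u)))
    \<le> tsum (\<lambda>k. ennreal C * (ennreal u * ennreal (D k) + ennreal (1 - u) * ennreal (B k)))"
    by (rule tsum_mono)
  also have "\<dots> = ennreal C * (ennreal u * tsum (\<lambda>k. ennreal (D k)) + ennreal (1 - u) * tsum (\<lambda>k. ennreal (B k)))"
    by (simp add: tsum_cmult tsum_add)
  also have "\<dots> \<le> ennreal C * (ennreal u * 1 + ennreal (1 - u) * 1)"
    using B D by (intro mult_left_mono add_mono) (auto simp: unit_mass_def)
  also have "\<dots> = ennreal C"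
    using u by (simp add: ennreal_plus[symmetric] del: ennreal_plus)
  finally show "tsum (\<lambda>k. a k * ennreal (pw (B k) (1 - u))) \<le> ennreal C" .
qed

lemma le_dnorm: "a k \<le> dnorm u a"
proof -
  define B where "B = (\<lambda>j. if j = k then 1 else (0::real))"
  have "unit_mass B"
    by (rule unit_massI) (auto simp: B_def sum.If_cases)
  then have "tsum (\<lambda>k. a k * ennreal (pw (B k) (1 - u))) \<le> dnorm u a"
    by (rule tsum_le_dnorm)
  moreover have "a k * ennreal (pw (B k) (1 - u)) \<le> tsum (\<lambda>k. a k * ennreal (pw (B k) (1 - u)))"
    by (rule le_tsum)
  ultimately show ?thesis
    by (simp add: B_def)
qed

text \<open>Converse of \<open>dnorm_ball_le\<close>, so the dual form is the norm of \<ell>^(1/u);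
  the optimal \<open>D\<close> is the (1/u)-th power of a / C. The multilinear estimates start from
  this representation of their inputs.\<close>

lemma dnorm_ball:
  assumes u: "0 \<le> u" "u \<le> 1" and C: "C > 0" and a: "dnorm u a \<le> ennreal C"
  obtains D where "unit_mass D" "\<And>k. a k \<le> ennreal (C * pw (D k) u)"
\<comment> \<open>For u = 0 only a \<le> C has to be expressed, and D = 0 does so because
  \<open>pw 0 0 = 1\<close>.\<close>
proof (cases "u = 0")
  case True
  have "unit_mass (\<lambda>_. 0)"
    by (auto intro: unit_massI)
  moreover have "a k \<le> ennreal (C * pw 0 u)" for k
    using le_dnorm[of a k u] a True by simp
  ultimately show ?thesis
    by (rule that)
next
  case False
  with u have u0: "u > 0"
    by simp
  have fin: "a k < top" for k
    using le_dnorm[of a k u] a by (meson ennreal_less_top order_le_less_trans)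
  define t where "t = (\<lambda>k. enn2real (a k) / C)"
  have t: "t k \<ge> 0" "a k = ennreal (C * t k)" for k
    using C fin[of k] by (auto simp: t_def)
  define D where "D = (\<lambda>k. t k powr (1 / u))"
  have D0: "D k \<ge> 0" for k
    by (simp add: D_def)
  have Du: "pw (D k) u = t k" for k
    using u0 t(1)[of k] by (simp add: pw_def D_def powr_powr)
  have "unit_mass D"
  proof (rule unit_massI[OF D0])
    fix F :: "int set" assume F: "finite F"
    define S where "S = sum D F"
    have "S \<le> 1"
    proof (cases "S > 0")
      case S: True
      \<comment> \<open>The extremal competitor in Hoelder's inequality, cut to the finite set
        \<open>F\<close>. Tested with it, the norm is at least C S^u, which forces S \<le>
        1.\<close>
      define B where "B = (\<lambda>k. if k \<in> F then D k / S else 0)"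
      have B: "unit_mass B"
      proof (rule unit_massI)
        show "0 \<le> B k" for k
          using S D0 by (simp add: B_def)
        fix G :: "int set" assume G: "finite G"
        have "sum B G = sum B (F \<inter> G)"
          using G by (intro sum.mono_neutral_right) (auto simp: B_def)
        also have "\<dots> \<le> sum B F"
          using F S D0 by (intro sum_mono2) (auto simp: B_def)
        also have "\<dots> = 1"
          using S by (simp add: B_def sum_divide_distrib[symmetric] S_def)
        finally show "sum B G \<le> 1" .
      qed
      have eq: "t k * pw (D k / S) (1 - u) = D k / pw S (1 - u)" for k
      proof -
        have "t k * pw (D k / S) (1 - u) = (pw (D k) u * pw (D k) (1 - u)) / pw S (1 - u)"
          using S D0[of k] by (simp add: pw_def powr_divide Du[symmetric])
        also have "pw (D k) u * pw (D k) (1 - u) = D k"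
          using u D0[of k] by (simp add: pw_add[symmetric])
        finally show ?thesis .
      qed
      have "C * (S / pw S (1 - u)) = C * ((\<Sum>k\<in>F. D k) / pw S (1 - u))"
        by (simp add: S_def)
      then have "ennreal (C * (S / pw S (1 - u))) = ennreal (\<Sum>k\<in>F. C * t k * pw (B k) (1 - u))"
        by (simp add: B_def mult.assoc eq sum_divide_distrib sum_distrib_left)
      also have "\<dots> = (\<Sum>k\<in>F. a k * ennreal (pw (B k) (1 - u)))"
        using t C by (simp add: ennreal_mult[symmetric])
      also have "\<dots> \<le> tsum (\<lambda>k. a k * ennreal (pw (B k) (1 - u)))"
        by (rule sum_le_tsum[OF F])
      also have "\<dots> \<le> ennreal C"
        using tsum_le_dnorm[OF B] a order_trans by blast
      finally have "C * (S / pw S (1 - u)) \<le> C"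
        using C by (simp add: ennreal_le_iff)
      moreover have "S / pw S (1 - u) = S powr u"
        using S powr_add[of S u "1 - u"] by (auto simp: pw_def field_simps)
      ultimately have "S powr u \<le> 1"
        using C by simp
      then show ?thesis
        using S u0 by (meson gr_one_powr not_le)
    qed auto
    then show "sum D F \<le> 1"
      by (simp add: S_def)
  qed
  moreover have "a k \<le> ennreal (C * pw (D k) u)" for k
    by (simp add: Du t(2))
  ultimately show ?thesis
    by (rule that)
qed

text \<open>Both sides may be infinite; equality is obtained by comparing balls of positive finite
  radius, where \<open>dnorm_ball\<close> and \<open>dnorm_ball_le\<close> apply.\<close>

lemma FLnorm_eq_dnorm:
  assumes p: "1 \<le> p"
  shows "FLnorm \<alpha> p f = dnorm (invp p) (\<lambda>k. ennreal (jbr k powr \<alpha> * cmod (f k)))"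
proof -
  define a where "a = (\<lambda>k. jbr k powr \<alpha> * cmod (f k))"
  have a0: "a k \<ge> 0" for k
    by (simp add: a_def)
  define u where "u = invp p"
  have u: "0 \<le> u" "u \<le> 1"
  proof -
    have "p = \<infinity> \<or> (\<exists>r\<ge>1. p = ereal r)"
      using p by (cases p) (auto simp: one_ereal_def)
    then show "0 \<le> u" "u \<le> 1"
      by (auto simp: u_def invp_def)
  qed
  have iff: "FLnorm \<alpha> p f \<le> ennreal C \<longleftrightarrow> dnorm u (\<lambda>k. ennreal (a k)) \<le> ennreal C" if C: "C > 0" for C
  proof (cases "p = \<infinity>")
    case True
    then have u0: "u = 0"
      by (simp add: u_def invp_def)
    have "FLnorm \<alpha> p f \<le> ennreal C \<longleftrightarrow> (\<forall>k. ennreal (a k) \<le> ennreal C)"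
      using True by (auto simp: FLnorm_def a_def SUP_le_iff)
    also have "\<dots> \<longleftrightarrow> dnorm u (\<lambda>k. ennreal (a k)) \<le> ennreal C"
    proof
      assume "\<forall>k. ennreal (a k) \<le> ennreal C"
      then show "dnorm u (\<lambda>k. ennreal (a k)) \<le> ennreal C"
        using C u0 by (intro dnorm_ball_le[of _ _ "\<lambda>_. 0"]) (auto intro: unit_massI)
    qed (auto intro: order_trans[OF le_dnorm])
    finally show ?thesis .
  next
    case False
    then obtain r where r: "p = ereal r" "r \<ge> 1"
      using p by (cases p) (auto simp: one_ereal_def)
    have ur: "u = 1 / r" "u > 0"
      using r by (auto simp: u_def invp_def)
    define g where "g = (\<lambda>k. a k powr r)"
    have FL: "FLnorm \<alpha> p f = (if g summable_on UNIV then ennreal ((infsum g UNIV) powr (1 / r)) else top)"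
      using r by (simp add: FLnorm_def g_def a_def Let_def)
    have g0: "g k \<ge> 0" for k
      by (simp add: g_def)
    have "FLnorm \<alpha> p f \<le> ennreal C \<longleftrightarrow> (\<forall>F. finite F \<longrightarrow> sum g F \<le> C powr r)"
    proof
      assume *: "FLnorm \<alpha> p f \<le> ennreal C"
      then have sm: "g summable_on UNIV"
        by (auto simp: FL split: if_splits simp: top_unique)
      then have "(infsum g UNIV) powr (1 / r) \<le> C"
        using * C by (simp add: FL ennreal_le_iff)
      then have "((infsum g UNIV) powr (1 / r)) powr r \<le> C powr r"
        using r by (intro powr_mono2) auto
      then have "infsum g UNIV \<le> C powr r"
        using r g0 by (simp add: powr_powr infsum_nonneg)
      moreover have "sum g F \<le> infsum g UNIV" if "finite F" for F
        using that sm g0 by (intro finite_sum_le_infsum) auto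
      ultimately show "\<forall>F. finite F \<longrightarrow> sum g F \<le> C powr r"
        using order_trans by blast
    next
      assume *: "\<forall>F. finite F \<longrightarrow> sum g F \<le> C powr r"
      have sm: "g summable_on UNIV"
        using * g0 by (intro nonneg_bdd_above_summable_on bdd_aboveI2[where M = "C powr r"]) auto
      have "infsum g UNIV \<le> C powr r"
        using * sm by (intro infsum_le_finite_sums) auto
      then have "(infsum g UNIV) powr (1 / r) \<le> (C powr r) powr (1 / r)"
        using r g0 by (intro powr_mono2) (auto simp: infsum_nonneg)
      also have "\<dots> = C"
        using r C by (simp add: powr_powr)
      finally show "FLnorm \<alpha> p f \<le> ennreal C"
        using sm by (simp add: FL ennreal_leI)
    qed
    also have "\<dots> \<longleftrightarrow> dnorm u (\<lambda>k. ennreal (a k)) \<le> ennreal C"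
    proof
      assume *: "\<forall>F. finite F \<longrightarrow> sum g F \<le> C powr r"
      \<comment> \<open>Normalised p-th powers: their u-th powers give back a / C.\<close>
      define D where "D = (\<lambda>k. g k / C powr r)"
      have "unit_mass D"
      proof (rule unit_massI)
        show "0 \<le> D k" for k
          by (simp add: D_def g_def)
        show "sum D F \<le> 1" if "finite F" for F
          using * that C by (simp add: D_def sum_divide_distrib[symmetric])
      qed
      moreover have "C * pw (D k) u = a k" for k
        using ur r C a0[of k] by (simp add: pw_def D_def g_def powr_divide powr_powr)
      ultimately show "dnorm u (\<lambda>k. ennreal (a k)) \<le> ennreal C"
        using u C by (intro dnorm_ball_le[of u C D]) auto
    next
      assume "dnorm u (\<lambda>k. ennreal (a k)) \<le> ennreal C"
      then obtain D where D: "unit_mass D" "\<And>k. ennreal (a k) \<le> ennreal (C * pw (D k) u)"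
        using dnorm_ball[OF u C] by blast
      have "g k \<le> C powr r * D k" for k
      proof -
        have "a k \<le> C * pw (D k) u"
          using D(2)[of k] C by (simp add: ennreal_le_iff)
        then have "g k \<le> (C * pw (D k) u) powr r"
          unfolding g_def using a0 r by (intro powr_mono2) auto
        also have "\<dots> = C powr r * D k"
          using ur r unit_mass_nonneg[OF D(1), of k] C by (simp add: pw_def powr_mult powr_powr)
        finally show ?thesis .
      qed
      then have "sum g F \<le> C powr r * sum D F" for F
        by (simp add: sum_distrib_left sum_mono)
      moreover have "C powr r * sum D F \<le> C powr r * 1" if "finite F" for F
        using unit_mass_sum[OF D(1) that] by (intro mult_left_mono) auto
      ultimately show "\<forall>F. finite F \<longrightarrow> sum g F \<le> C powr r"
        by (metis mult.right_neutral order_trans)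
    qed
    finally show ?thesis .
  qed
  \<comment> \<open>Otherwise density yields a positive finite number strictly between
    \<open>y\<close> and \<open>x\<close>, which bounds one and not the other.\<close>
  have "x \<le> y" if xy: "\<And>C. C > 0 \<Longrightarrow> y \<le> ennreal C \<Longrightarrow> x \<le> ennreal C" for x y :: ennreal
  proof (rule ccontr)
    assume "\<not> x \<le> y"
    then obtain z where z: "y < z" "z < x"
      using dense by (metis not_le)
    then have "z < top"
      using order_less_le_trans top_greatest by blast
    then obtain C where C: "z = ennreal C" "C \<ge> 0"
      by (cases z rule: ennreal_cases) auto
    have "C > 0"
      using z C by (cases "C = 0") auto
    then show False
      using xy[of C] z C leD less_imp_le by metis
  qed
  from this[of "dnorm u (\<lambda>k. ennreal (a k))" "FLnorm \<alpha> p f"]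
    this[of "FLnorm \<alpha> p f" "dnorm u (\<lambda>k. ennreal (a k))"] iff
  show ?thesis
    by (intro antisym) (auto simp: a_def u_def)
qed

section \<open>Multilinear estimates\<close>

lemma jbr_ge_1: "1 \<le> jbr k"
  by (simp add: jbr_def)

lemma jbr_pos [simp]: "0 < jbr k"
  using jbr_ge_1[of k] by linarith

lemma jbr_nonneg [simp]: "0 \<le> jbr k"
  using jbr_ge_1[of k] by linarith

lemma jbr_neq_0 [simp]: "jbr k \<noteq> 0"
  using jbr_pos[of k] by linarith

lemma abs_le_jbr: "\<bar>real_of_int k\<bar> \<le> jbr k"
  unfolding jbr_def by (rule real_le_rsqrt) simp

lemma jbr_le_abs: "k \<noteq> 0 \<Longrightarrow> jbr k \<le> 2 * \<bar>real_of_int k\<bar>"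
proof -
  assume "k \<noteq> 0"
  then have "1 \<le> \<bar>k\<bar>"
    by simp
  then have "1 \<le> \<bar>real_of_int k\<bar>"
    by (metis of_int_1_le_iff of_int_abs)
  then have "1\<^sup>2 \<le> \<bar>real_of_int k\<bar>\<^sup>2"
    by (intro power_mono) auto
  then show ?thesis
    unfolding jbr_def by (intro real_le_lsqrt) (auto simp: power2_eq_square)
qed

lemma jbr_minus [simp]: "jbr (- k) = jbr k"
  by (simp add: jbr_def)

lemma jbr_triangle: "jbr (k + l) \<le> jbr k + jbr l"
proof -
  have "jbr (k + l) = sqrt (1 + (real_of_int k + real_of_int l)\<^sup>2)"
    by (simp add: jbr_def)
  also have "\<dots> \<le> sqrt ((1 + 1)\<^sup>2 + (real_of_int k + real_of_int l)\<^sup>2)"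
    by simp
  also have "\<dots> \<le> sqrt (1\<^sup>2 + (real_of_int k)\<^sup>2) + sqrt (1\<^sup>2 + (real_of_int l)\<^sup>2)"
    by (rule real_sqrt_sum_squares_triangle_ineq)
  finally show ?thesis
    by (simp add: jbr_def)
qed

text \<open>Folding the integers onto |k| counts k = 0 twice, which is harmless for finiteness; the
  value 1 there replaces \<open>0 powr - s\<close>.\<close>

lemma tsum_jbr:
  assumes "s > 1"
  shows "tsum (\<lambda>k. ennreal (jbr k powr - s)) < top"
proof -
  define f :: "int \<Rightarrow> ennreal" where "f = (\<lambda>k. ennreal (jbr k powr - s))"
  have nat: "tsum (\<lambda>n::nat. ennreal (if n = 0 then 1 else real n powr - s)) < top"
  proof -
    have "summable (\<lambda>n. real n powr - s)"
      using assms by (simp add: summable_real_powr_iff)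
    then have "summable (\<lambda>n::nat. if n = 0 then 1 else real n powr - s)"
      by (rule summable_cong[THEN iffD1, rotated])
        (auto intro!: eventually_mono[OF eventually_gt_at_top[of 0]])
    then have "(\<Sum>n::nat. ennreal (if n = 0 then 1 else real n powr - s)) \<noteq> top"
      by (rule ennreal_suminf_neq_top) auto
    then show ?thesis
      unfolding nn_integral_count_space_nat by (simp only: less_top)
  qed
  have le: "f k \<le> ennreal (if n = 0 then 1 else real n powr - s)" if "\<bar>k\<bar> = int n" for k n
  proof (cases "n = 0")
    case True
    then show ?thesis
      using that assms by (simp add: f_def jbr_def)
  next
    case False
    have "real n = \<bar>real_of_int k\<bar>"
      using that by (metis of_int_abs of_int_of_nat_eq)
    then have "jbr k powr - s \<le> real n powr - s"
      using False abs_le_jbr[of k] assms by (intro powr_mono2') auto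
    then show ?thesis
      using False by (simp add: f_def ennreal_leI)
  qed
  have "tsum f \<le> tsum (\<lambda>k. tsum (\<lambda>n::nat. f k * indicator {int n} k + f k * indicator {- int n} k))"
  proof (rule tsum_mono)
    fix k :: int
    have "f k \<le> f k * indicator {int (nat \<bar>k\<bar>)} k + f k * indicator {- int (nat \<bar>k\<bar>)} k"
      by (cases "k \<ge> 0") (auto simp: indicator_def)
    also have "\<dots> \<le> tsum (\<lambda>n::nat. f k * indicator {int n} k + f k * indicator {- int n} k)"
      by (rule le_tsum[where x = "nat \<bar>k\<bar>"])
    finally show "f k \<le> tsum (\<lambda>n::nat. f k * indicator {int n} k + f k * indicator {- int n} k)" .
  qed
  also have "\<dots> = tsum (\<lambda>n::nat. tsum (\<lambda>k. f k * indicator {int n} k + f k * indicator {- int n} k))"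
    by (rule tsum_swap)
  also have "\<dots> = tsum (\<lambda>n::nat. f (int n) + f (- int n))"
    by (simp add: tsum_add)
  also have "\<dots> \<le> tsum (\<lambda>n::nat. ennreal (if n = 0 then 1 else real n powr - s)
      + ennreal (if n = 0 then 1 else real n powr - s))"
    by (intro tsum_mono add_mono le) auto
  also have "\<dots> < top"
    unfolding tsum_add using nat by (simp add: ennreal_add_less_top)
  finally show ?thesis
    by (simp add: f_def)
qed

section \<open>Weights as powers of unit masses, and products of unit masses\<close>

lemma unit_mass_scale:
  assumes "\<And>k. 0 \<le> f k" "tsum (\<lambda>k. ennreal (f k)) < top"
  obtains S where "S > 0" "unit_mass (\<lambda>k. f k / S)"
proof -
  define S where "S = 1 + enn2real (tsum (\<lambda>k. ennreal (f k)))"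
  have S: "S > 0"
    by (simp add: S_def add_pos_nonneg)
  have "unit_mass (\<lambda>k. f k / S)"
  proof (rule unit_massI)
    fix F :: "int set" assume F: "finite F"
    have "ennreal (sum f F) = (\<Sum>k\<in>F. ennreal (f k))"
      using assms by simp
    also have "\<dots> \<le> tsum (\<lambda>k. ennreal (f k))"
      by (rule sum_le_tsum[OF F])
    also have "\<dots> = ennreal (enn2real (tsum (\<lambda>k. ennreal (f k))))"
      using assms(2) by simp
    finally have "sum f F \<le> S"
      by (simp add: S_def ennreal_le_iff)
    then show "(\<Sum>k\<in>F. f k / S) \<le> 1"
      using S by (simp add: sum_divide_distrib[symmetric])
  qed (use assms S in auto)
  with S show ?thesis
    by (rule that)
qed

text \<open>For e > 0 the sequence <k>^(-z) lies in \<ell>^(1/e) because z / e > 1; as a power of a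
  unit mass it can enter Young's inequality.\<close>

lemma jbr_weight:
  assumes "0 \<le> e" "e < z"
  obtains V S where "S > 0" "unit_mass V" "\<And>k. jbr k powr - z \<le> S * pw (V k) e"
proof -
  \<comment> \<open>For e = 0 any s > 1 serves, since s e = 0 < z and \<open>pw\<close> then ignores
    its base.\<close>
  define s where "s = (if e = 0 then 2 else z / e)"
  have s: "s > 1" "s * e \<le> z"
    using assms by (auto simp: s_def)
  obtain S where S: "S > 0" "unit_mass (\<lambda>k. jbr k powr - s / S)"
    using unit_mass_scale[of "\<lambda>k. jbr k powr - s", OF _ tsum_jbr[OF s(1)]] by auto
  show ?thesis
  proof (rule that)
    show "S powr e > 0" "unit_mass (\<lambda>k. jbr k powr - s / S)"
      using S by auto
    fix k
    have "jbr k powr - z \<le> jbr k powr (- (s * e))"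
      using s jbr_ge_1[of k] by (intro powr_mono) auto
    also have "\<dots> = S powr e * pw (jbr k powr - s / S) e"
      using S jbr_pos[of k] by (simp add: pw_def powr_divide powr_powr)
    finally show "jbr k powr - z \<le> S powr e * pw (jbr k powr - s / S) e" .
  qed
qed

lemma tsum_inj_le:
  assumes "inj h"
  shows "tsum (\<lambda>i. f (h i)) \<le> tsum f"
proof -
  have "tsum (\<lambda>i. f (h i)) = (\<integral>\<^sup>+x. f x \<partial>count_space (range h))"
    using assms by (intro nn_integral_bij_count_space) (simp add: inj_on_imp_bij_betw)
  also have "\<dots> \<le> tsum f"
    by (auto simp: nn_integral_count_space_indicator intro!: tsum_mono split: split_indicator)
  finally show ?thesis .
qed

lemma tsum_prod: "tsum (\<lambda>x. tsum (\<lambda>y. f x y)) = tsum (\<lambda>i. f (fst i) (snd i))"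
  using nn_integral_fst_count_space[of "\<lambda>i. f (fst i) (snd i)"] by simp

text \<open>Two frequencies that determine the summation index can be summed independently. The
  groupings of factors in the estimates below are chosen to meet this injectivity condition.\<close>

lemma unit_mass_pair:
  assumes "unit_mass f" "unit_mass g" "inj (\<lambda>i. (\<phi> i, \<psi> i))"
  shows "tsum (\<lambda>i. ennreal (f (\<phi> i) * g (\<psi> i))) \<le> 1"
proof -
  have "tsum (\<lambda>i. ennreal (f (\<phi> i) * g (\<psi> i))) \<le> tsum (\<lambda>i. ennreal (f (fst i) * g (snd i)))"
    using tsum_inj_le[OF assms(3), of "\<lambda>i. ennreal (f (fst i) * g (snd i))"] by simp
  also have "\<dots> = tsum (\<lambda>x. tsum (\<lambda>y. ennreal (f x * g y)))"
    unfolding tsum_prod ..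
  also have "\<dots> = tsum (\<lambda>x. ennreal (f x)) * tsum (\<lambda>y. ennreal (g y))"
    using assms by (simp add: ennreal_mult unit_mass_nonneg tsum_cmult tsum_multc)
  also have "\<dots> \<le> 1 * 1"
    using assms by (intro mult_mono unit_mass_tsum) auto
  finally show ?thesis
    by simp
qed

lemma unit_mass_triple:
  assumes "unit_mass f" "unit_mass g" "unit_mass h" "inj (\<lambda>i. (\<phi> i, \<psi> i, \<theta> i))"
  shows "tsum (\<lambda>i. ennreal (f (\<phi> i) * g (\<psi> i) * h (\<theta> i))) \<le> 1"
proof -
  have "tsum (\<lambda>i. ennreal (f (\<phi> i) * g (\<psi> i) * h (\<theta> i))) \<le> tsum (\<lambda>i. ennreal (f (fst i) * g (fst (snd i)) * h (snd (snd i))))"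
    using tsum_inj_le[OF assms(4), of "\<lambda>i. ennreal (f (fst i) * g (fst (snd i)) * h (snd (snd i)))"] by simp
  also have "\<dots> = tsum (\<lambda>x. tsum (\<lambda>y. tsum (\<lambda>z. ennreal (f x * g y * h z))))"
    unfolding tsum_prod by simp
  also have "\<dots> = tsum (\<lambda>x. ennreal (f x)) * tsum (\<lambda>y. ennreal (g y)) * tsum (\<lambda>z. ennreal (h z))"
    using assms by (simp add: ennreal_mult unit_mass_nonneg tsum_cmult tsum_multc)
  also have "\<dots> \<le> 1 * 1 * 1"
    using assms by (intro mult_mono unit_mass_tsum) auto
  finally show ?thesis
    by simp
qed

lemma tsum_average3:
  assumes "0 \<le> a" "0 \<le> b" "0 \<le> c" "a + b + c = 1"
    and "\<And>i. 0 \<le> f1 i" "\<And>i. 0 \<le> f2 i" "\<And>i. 0 \<le> f3 i"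
    and "\<And>i. f i \<le> a * f1 i + b * f2 i + c * f3 i"
    and "tsum (\<lambda>i. ennreal (f1 i)) \<le> 1" "tsum (\<lambda>i. ennreal (f2 i)) \<le> 1" "tsum (\<lambda>i. ennreal (f3 i)) \<le> 1"
  shows "tsum (\<lambda>i. ennreal (f i)) \<le> 1"
proof -
  have "tsum (\<lambda>i. ennreal (f i)) \<le> tsum (\<lambda>i. ennreal (a * f1 i + b * f2 i + c * f3 i))"
    using assms by (intro tsum_mono ennreal_leI) auto
  also have "\<dots> = ennreal a * tsum (\<lambda>i. ennreal (f1 i)) + ennreal b * tsum (\<lambda>i. ennreal (f2 i))
      + ennreal c * tsum (\<lambda>i. ennreal (f3 i))"
    using assms by (simp add: ennreal_mult tsum_add tsum_cmult)
  also have "\<dots> \<le> ennreal a * 1 + ennreal b * 1 + ennreal c * 1"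
    using assms by (intro add_mono mult_left_mono) auto
  also have "\<dots> = 1"
    using assms by (simp add: ennreal_plus[symmetric] del: ennreal_plus)
  finally show ?thesis .
qed

lemma tsum_average2:
  assumes "0 \<le> a" "0 \<le> b" "a + b = 1" "\<And>i. 0 \<le> f1 i" "\<And>i. 0 \<le> f2 i"
    and "\<And>i. f i \<le> a * f1 i + b * f2 i"
    and "tsum (\<lambda>i. ennreal (f1 i)) \<le> 1" "tsum (\<lambda>i. ennreal (f2 i)) \<le> 1"
  shows "tsum (\<lambda>i. ennreal (f i)) \<le> 1"
  by (rule tsum_average3[of a b 0 f1 f2 f1]) (use assms in auto)

text \<open>In a bilinear interaction of \<open>k\<^sub>1\<close> and \<open>k - k\<^sub>1\<close> with output frequency \<open>k\<close>, the kernel is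
  controlled by a weight on the smallest of the three frequencies. Only the case where this is \<open>k\<close>
  distinguishes \<open>u \<ge> 1/2\<close> and \<open>u \<le> 1/2\<close>.\<close>

lemma form_weight_left:
  assumes u: "0 \<le> u" "u \<le> 1" and um: "unit_mass V" "unit_mass A" "unit_mass C" "unit_mass B"
  shows "tsum (\<lambda>i. ennreal (pw (V (snd i)) (1 - u) * (pw (A (snd i)) u * pw (C (fst i - snd i)) u * pw (B (fst i)) (1 - u)))) \<le> 1"
proof -
  note nn = unit_mass_nonneg[OF um(1)] unit_mass_nonneg[OF um(2)] unit_mass_nonneg[OF um(3)] unit_mass_nonneg[OF um(4)]
  show ?thesis
  proof (rule tsum_average2[of "1 - u" u "\<lambda>i. V (snd i) * B (fst i)" "\<lambda>i. A (snd i) * C (fst i - snd i)"])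
    show "pw (V (snd i)) (1 - u) * (pw (A (snd i)) u * pw (C (fst i - snd i)) u * pw (B (fst i)) (1 - u))
        \<le> (1 - u) * (V (snd i) * B (fst i)) + u * (A (snd i) * C (fst i - snd i))" for i
    proof -
      have "pw (V (snd i)) (1 - u) * (pw (A (snd i)) u * pw (C (fst i - snd i)) u * pw (B (fst i)) (1 - u))
        = pw (V (snd i) * B (fst i)) (1 - u) * pw (A (snd i) * C (fst i - snd i)) u"
        using nn by (simp add: pw_mult)
      also have "\<dots> \<le> (1 - u) * (V (snd i) * B (fst i)) + u * (A (snd i) * C (fst i - snd i))"
        using nn u by (intro young2) auto
      finally show ?thesis .
    qed
  qed (use u nn in \<open>auto intro!: unit_mass_pair um simp: inj_def\<close>)
qed

text \<open>\<open>V\<close> and \<open>B\<close> both sit at the output frequency k and cannot form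
  a pair, since k alone does not determine the index. So \<open>B\<close> is matched with a part of
  \<open>A\<close> and \<open>V\<close> with a part of \<open>C\<close>, of exponent 1 - u each,
  which leaves 2u - 1 \<ge> 0 for \<open>A\<close> with \<open>C\<close>.\<close>

lemma form_weight_output:
  assumes u: "1 / 2 \<le> u" "u \<le> 1" and um: "unit_mass V" "unit_mass A" "unit_mass C" "unit_mass B"
  shows "tsum (\<lambda>i. ennreal (pw (V (fst i)) (1 - u) * (pw (A (snd i)) u * pw (C (fst i - snd i)) u * pw (B (fst i)) (1 - u)))) \<le> 1"
proof -
  note nn = unit_mass_nonneg[OF um(1)] unit_mass_nonneg[OF um(2)] unit_mass_nonneg[OF um(3)] unit_mass_nonneg[OF um(4)]
  show ?thesis
  proof (rule tsum_average3[of "2 * u - 1" "1 - u" "1 - u" "\<lambda>i. A (snd i) * C (fst i - snd i)"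
        "\<lambda>i. B (fst i) * A (snd i)" "\<lambda>i. V (fst i) * C (fst i - snd i)"])
    fix i :: "int \<times> int"
    have "pw (A (snd i)) u = pw (A (snd i)) (2 * u - 1) * pw (A (snd i)) (1 - u)"
      "pw (C (fst i - snd i)) u = pw (C (fst i - snd i)) (2 * u - 1) * pw (C (fst i - snd i)) (1 - u)"
      using u by (simp_all add: pw_add[symmetric])
    then have "pw (V (fst i)) (1 - u) * (pw (A (snd i)) u * pw (C (fst i - snd i)) u * pw (B (fst i)) (1 - u))
      = pw (A (snd i) * C (fst i - snd i)) (2 * u - 1) * pw (B (fst i) * A (snd i)) (1 - u)
        * pw (V (fst i) * C (fst i - snd i)) (1 - u)"
      using nn by (simp add: pw_mult)
    also have "\<dots> \<le> (2 * u - 1) * (A (snd i) * C (fst i - snd i)) + (1 - u) * (B (fst i) * A (snd i))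
        + (1 - u) * (V (fst i) * C (fst i - snd i))"
      using nn u by (intro young3) auto
    finally show "pw (V (fst i)) (1 - u) * (pw (A (snd i)) u * pw (C (fst i - snd i)) u * pw (B (fst i)) (1 - u))
      \<le> (2 * u - 1) * (A (snd i) * C (fst i - snd i)) + (1 - u) * (B (fst i) * A (snd i))
        + (1 - u) * (V (fst i) * C (fst i - snd i))" .
  qed (use u nn in \<open>auto intro!: unit_mass_pair um simp: inj_def\<close>)
qed

text \<open>For u \<le> 1/2 the input \<open>A\<close> cannot cover the exponent 1 - u of
  \<open>B\<close>: a part u of it is matched with \<open>A\<close>, the rest 1 - 2u with the
  additional weight \<open>W\<close> at k1. \<open>V\<close> is again matched with
  \<open>C\<close>.\<close>

lemma form_weight_mixed:
  assumes u: "0 \<le> u" "u \<le> 1 / 2" and um: "unit_mass V" "unit_mass W" "unit_mass A" "unit_mass C" "unit_mass B"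
  shows "tsum (\<lambda>i. ennreal (pw (V (fst i)) u * pw (W (snd i)) (1 - 2 * u)
      * (pw (A (snd i)) u * pw (C (fst i - snd i)) u * pw (B (fst i)) (1 - u)))) \<le> 1"
proof -
  note nn = unit_mass_nonneg[OF um(1)] unit_mass_nonneg[OF um(2)] unit_mass_nonneg[OF um(3)]
    unit_mass_nonneg[OF um(4)] unit_mass_nonneg[OF um(5)]
  show ?thesis
  proof (rule tsum_average3[of "1 - 2 * u" u u "\<lambda>i. B (fst i) * W (snd i)"
        "\<lambda>i. B (fst i) * A (snd i)" "\<lambda>i. V (fst i) * C (fst i - snd i)"])
    fix i :: "int \<times> int"
    have "pw (B (fst i)) (1 - u) = pw (B (fst i)) (1 - 2 * u) * pw (B (fst i)) u"
      using u by (simp add: pw_add[symmetric])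
    then have "pw (V (fst i)) u * pw (W (snd i)) (1 - 2 * u)
        * (pw (A (snd i)) u * pw (C (fst i - snd i)) u * pw (B (fst i)) (1 - u))
      = pw (B (fst i) * W (snd i)) (1 - 2 * u) * pw (B (fst i) * A (snd i)) u
        * pw (V (fst i) * C (fst i - snd i)) u"
      using nn by (simp add: pw_mult)
    also have "\<dots> \<le> (1 - 2 * u) * (B (fst i) * W (snd i)) + u * (B (fst i) * A (snd i))
        + u * (V (fst i) * C (fst i - snd i))"
      using nn u by (intro young3) auto
    finally show "pw (V (fst i)) u * pw (W (snd i)) (1 - 2 * u)
        * (pw (A (snd i)) u * pw (C (fst i - snd i)) u * pw (B (fst i)) (1 - u))
      \<le> (1 - 2 * u) * (B (fst i) * W (snd i)) + u * (B (fst i) * A (snd i))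
        + u * (V (fst i) * C (fst i - snd i))" .
  qed (use u nn in \<open>auto intro!: unit_mass_pair um simp: inj_def\<close>)
qed

lemma form_weight_right:
  assumes u: "0 \<le> u" "u \<le> 1" and um: "unit_mass V" "unit_mass A" "unit_mass C" "unit_mass B"
  shows "tsum (\<lambda>i. ennreal (pw (V (fst i - snd i)) (1 - u) * (pw (A (snd i)) u * pw (C (fst i - snd i)) u * pw (B (fst i)) (1 - u)))) \<le> 1"
proof -
  have "bij (\<lambda>i::int \<times> int. (fst i, fst i - snd i))"
    by (rule bij_betwI[where g = "\<lambda>i. (fst i, fst i - snd i)"]) auto
  from tsum_bij[OF this, of "\<lambda>i. ennreal (pw (V (snd i)) (1 - u) * (pw (C (snd i)) u * pw (A (fst i - snd i)) u * pw (B (fst i)) (1 - u)))"]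
  show ?thesis
    using form_weight_left[OF u um(1,3,2,4)] by (simp add: mult_ac)
qed

lemma powr_comparable:
  fixes x y :: real
  assumes "0 < y" "1 \<le> c" "y \<le> c * x" "x \<le> c * y"
  shows "x powr e \<le> c powr \<bar>e\<bar> * y powr e"
proof -
  have x: "x > 0"
    using assms by (smt (verit) zero_less_mult_iff)
  show ?thesis
  proof (cases "e \<ge> 0")
    case True
    then have "x powr e \<le> (c * y) powr e"
      using assms x by (intro powr_mono2) auto
    then show ?thesis
      using True assms by (simp add: powr_mult)
  next
    case False
    have "x powr e \<le> (y / c) powr e"
      using False assms x by (intro powr_mono2') (auto simp: field_simps)
    also have "\<dots> = c powr (- e) * y powr e"
      using assms by (simp add: powr_divide powr_minus_divide)
    finally show ?thesis
      using False by simp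
  qed
qed

text \<open>By the triangle inequality the two largest of the three numbers are comparable within a
  factor 2. If \<open>y\<close> or \<open>w\<close> is smallest, it can therefore carry the full
  decay 2\<beta> - a. If \<open>x\<close> is smallest, the factor \<open>x powr a\<close> may grow
  or decay according to the sign of \<open>a\<close>, so this case is left open.\<close>

lemma bilinear_weight:
  fixes x y w a \<beta> :: real
  assumes "1 \<le> x" "1 \<le> y" "1 \<le> w" and tri: "x \<le> y + w" "y \<le> x + w" "w \<le> x + y"
    and "0 \<le> \<beta>" "a \<le> \<beta>"
  shows "x powr a * (y powr - \<beta> * w powr - \<beta>) \<le>
    2 powr \<beta> * (y powr - (2 * \<beta> - a) + w powr - (2 * \<beta> - a) + (if x \<le> y then x powr a * y powr - (2 * \<beta>) else 0))"
proof -
  have cmp: "p powr - \<beta> \<le> 2 powr \<beta> * q powr - \<beta>" if "1 \<le> q" "q \<le> 2 * p" "p \<le> 2 * q" for p q :: real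
    using powr_comparable[of q 2 p "- \<beta>"] that assms by simp
  have main: "x powr a * (y powr - \<beta> * w powr - \<beta>) \<le> 2 powr \<beta> * y powr - (2 * \<beta> - a)"
    if "1 \<le> x" "1 \<le> y" "1 \<le> w" "y \<le> x" "y \<le> w" "w \<le> x + y" "x \<le> y + w" for y w
  proof -
    have "x powr a * (y powr - \<beta> * w powr - \<beta>) \<le> x powr a * (y powr - \<beta> * (2 powr \<beta> * x powr - \<beta>))"
      using that by (intro mult_left_mono cmp) auto
    also have "\<dots> = 2 powr \<beta> * y powr - \<beta> * x powr (a - \<beta>)"
      by (simp add: powr_add[symmetric])
    also have "\<dots> \<le> 2 powr \<beta> * y powr - \<beta> * y powr (a - \<beta>)"
      using that assms by (intro mult_left_mono powr_mono2') auto
    also have "\<dots> = 2 powr \<beta> * y powr - (2 * \<beta> - a)"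
      by (simp add: powr_add[symmetric] algebra_simps)
    finally show ?thesis .
  qed
  have nn: "0 \<le> y powr - (2 * \<beta> - a)" "0 \<le> w powr - (2 * \<beta> - a)"
    "0 \<le> (if x \<le> y then x powr a * y powr - (2 * \<beta>) else 0)"
    by auto
  have conv: "t \<le> 2 powr \<beta> * r \<Longrightarrow> r \<le> r' \<Longrightarrow> t \<le> 2 powr \<beta> * r'" for t r r' :: real
    by (meson mult_left_mono order_trans powr_ge_zero)
  consider "y \<le> x" "y \<le> w" | "w \<le> x" "w \<le> y" | "x \<le> y" "x \<le> w"
    by linarith
  then show ?thesis
  proof cases
    case 1
    show ?thesis
      by (rule conv[OF main[of y w]]) (use 1 assms nn in auto)
  next
    case 2
    have "x powr a * (y powr - \<beta> * w powr - \<beta>) \<le> 2 powr \<beta> * w powr - (2 * \<beta> - a)"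
      using main[of w y] 2 assms by (simp add: mult.commute)
    then show ?thesis
      by (rule conv) (use nn in auto)
  next
    case 3
    have "x powr a * (y powr - \<beta> * w powr - \<beta>) \<le> x powr a * (y powr - \<beta> * (2 powr \<beta> * y powr - \<beta>))"
      using 3 assms by (intro mult_left_mono cmp) auto
    also have "\<dots> = 2 powr \<beta> * (x powr a * y powr - (2 * \<beta>))"
      by (simp add: powr_add[symmetric])
    finally show ?thesis
      by (rule conv) (use 3 nn in auto)
  qed
qed

text \<open>Here \<open>u = 1/p\<close>. For \<open>\<gamma> > 1/3\<close> the region \<open>D'\<close> reduces to these inequalities, and \<open>\<alpha> > - 1/p\<close> follows.\<close>

locale exponents =
  fixes u \<alpha> \<gamma> :: real
  assumes u: "0 \<le> u" "u \<le> 1"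
    and alpha: "- 1 / 2 < \<alpha>" "3 * \<gamma> - 1 < \<alpha> + u"
    and gamma: "1 / 3 < \<gamma>" "\<gamma> \<le> 1 / 2"
begin

text \<open>The decay obtained by collecting the weights and the kernel of X on one frequency: 2
  (\<alpha> + 1 - \<gamma>) - (\<alpha> + \<gamma>). The assumption on \<alpha> + u says precisely z
  > 1 - u.\<close>

definition z :: real where "z = \<alpha> + 2 - 3 * \<gamma>"

lemma z_gt: "1 - u < z"
  using alpha by (simp add: z_def)

lemma one_minus_u: "0 \<le> 1 - u"
  using u by simp

lemma bilinear_form:
  obtains C where "C > 0" "\<And>A A' B. unit_mass A \<Longrightarrow> unit_mass A' \<Longrightarrow> unit_mass B \<Longrightarrow>
    tsum (\<lambda>i. ennreal (jbr (fst i) powr (\<alpha> + \<gamma>) * (jbr (snd i) powr - (\<alpha> + 1 - \<gamma>) * jbr (fst i - snd i) powr - (\<alpha> + 1 - \<gamma>))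
      * (pw (A (snd i)) u * pw (A' (fst i - snd i)) u * pw (B (fst i)) (1 - u)))) \<le> ennreal C"
proof -
  define a \<beta> where "a = \<alpha> + \<gamma>" and "\<beta> = \<alpha> + 1 - \<gamma>"
  have ab: "0 \<le> \<beta>" "a \<le> \<beta>" "2 * \<beta> - a = z"
    using alpha gamma by (auto simp: a_def \<beta>_def z_def)
  obtain V S where V: "S > 0" "unit_mass V" "\<And>k. jbr k powr - z \<le> S * pw (V k) (1 - u)"
    by (rule jbr_weight[OF one_minus_u z_gt]) iprover
  \<comment> \<open>The case of smallest output frequency. Its subcases place the weight
    differently, so it is packaged as an unspecified \<open>R\<close> with the one summability
    property that is used.\<close>
  have low: "\<exists>R S'. S' \<ge> 0 \<and> (\<forall>k k1. 0 \<le> R k k1) \<and>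
      (\<forall>k k1. (if jbr k \<le> jbr k1 then jbr k powr a * jbr k1 powr - (2 * \<beta>) else 0) \<le> S' * R k k1) \<and>
      (\<forall>A A' B. unit_mass A \<longrightarrow> unit_mass A' \<longrightarrow> unit_mass B \<longrightarrow>
        tsum (\<lambda>i. ennreal (R (fst i) (snd i) * (pw (A (snd i)) u * pw (A' (fst i - snd i)) u * pw (B (fst i)) (1 - u)))) \<le> 1)"
  proof -
    \<comment> \<open>For u \<ge> 1/2 monotonicity moves all powers to k1 if a \<ge> 0 and to k if a
      < 0; for u < 1/2 the decay is shared between k and k1.\<close>
    consider "u \<ge> 1 / 2" "a \<ge> 0" | "u \<ge> 1 / 2" "a < 0" | "u < 1 / 2"
      by linarith
    then show ?thesis
    proof cases
      case 1
      have "(if jbr k \<le> jbr k1 then jbr k powr a * jbr k1 powr - (2 * \<beta>) else 0) \<le> S * pw (V k1) (1 - u)" for k k1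
      proof (cases "jbr k \<le> jbr k1")
        case True
        then have "jbr k powr a * jbr k1 powr - (2 * \<beta>) \<le> jbr k1 powr a * jbr k1 powr - (2 * \<beta>)"
          using 1 by (intro mult_right_mono powr_mono2) auto
        also have "\<dots> = jbr k1 powr - z"
          by (simp add: powr_add[symmetric] ab(3)[symmetric])
        finally show ?thesis
          using True V(3)[of k1] by simp
      qed (use V in auto)
      then show ?thesis
        using V form_weight_left[OF u V(2)] by (intro exI[of _ "\<lambda>k k1. pw (V k1) (1 - u)"] exI[of _ S]) auto
    next
      case 2
      have "(if jbr k \<le> jbr k1 then jbr k powr a * jbr k1 powr - (2 * \<beta>) else 0) \<le> S * pw (V k) (1 - u)" for k k1
      proof (cases "jbr k \<le> jbr k1")
        case True
        then have "jbr k powr a * jbr k1 powr - (2 * \<beta>) \<le> jbr k powr a * jbr k powr - (2 * \<beta>)"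
          using ab by (intro mult_left_mono powr_mono2') auto
        also have "\<dots> = jbr k powr - z"
          by (simp add: powr_add[symmetric] ab(3)[symmetric])
        finally show ?thesis
          using True V(3)[of k] by simp
      qed (use V in auto)
      then show ?thesis
        using V form_weight_output[OF 2(1) u(2) V(2)]
        by (intro exI[of _ "\<lambda>k k1. pw (V k) (1 - u)"] exI[of _ S]) auto
    next
      case 3
      \<comment> \<open>Half of the excess z - (1 - u), so that z splits into z2 > u at k and z1 > 1
        - 2u at k1, as \<open>form_weight_mixed\<close> demands.\<close>
      define \<epsilon> where "\<epsilon> = (z - (1 - u)) / 2"
      define z2 z1 where "z2 = u + \<epsilon>" and "z1 = z - z2"
      have eps: "\<epsilon> > 0"
        using z_gt by (simp add: \<epsilon>_def)
      have z12: "u < z2" "1 - 2 * u < z1" "z1 + z2 = z"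
        using eps by (auto simp: z1_def z2_def \<epsilon>_def field_simps)
      \<comment> \<open>Indeed a + u > 4\<gamma> - 1 > 0. The sign permits replacing <k> by the
        larger <k1>.\<close>
      have az: "a + z2 \<ge> 0"
        using alpha gamma eps by (auto simp: a_def z2_def)
      obtain V2 S2 where V2: "S2 > 0" "unit_mass V2" "\<And>k. jbr k powr - z2 \<le> S2 * pw (V2 k) u"
        by (rule jbr_weight[OF u(1) z12(1)]) iprover
      have u2: "0 \<le> 1 - 2 * u"
        using 3 by simp
      obtain V1 S1 where V1: "S1 > 0" "unit_mass V1" "\<And>k. jbr k powr - z1 \<le> S1 * pw (V1 k) (1 - 2 * u)"
        by (rule jbr_weight[OF u2 z12(2)]) iprover
      have "(if jbr k \<le> jbr k1 then jbr k powr a * jbr k1 powr - (2 * \<beta>) else 0)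
          \<le> (S2 * S1) * (pw (V2 k) u * pw (V1 k1) (1 - 2 * u))" for k k1
      proof (cases "jbr k \<le> jbr k1")
        case True
        have "jbr k powr a * jbr k1 powr - (2 * \<beta>) = jbr k powr - z2 * jbr k powr (a + z2) * jbr k1 powr - (2 * \<beta>)"
          by (simp add: powr_add[symmetric])
        also have "\<dots> \<le> jbr k powr - z2 * jbr k1 powr (a + z2) * jbr k1 powr - (2 * \<beta>)"
          using True az by (intro mult_right_mono mult_left_mono powr_mono2) auto
        also have "\<dots> = jbr k powr - z2 * jbr k1 powr (a + z2 - 2 * \<beta>)"
          by (simp add: powr_add[symmetric] mult.assoc)
        also have "a + z2 - 2 * \<beta> = - z1"
          using ab z12 by simp
        also have "jbr k powr - z2 * jbr k1 powr - z1 \<le> (S2 * pw (V2 k) u) * (S1 * pw (V1 k1) (1 - 2 * u))"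
          using V1 V2 by (intro mult_mono) auto
        finally show ?thesis
          using True by (simp add: mult_ac)
      qed (use V1 V2 in auto)
      then show ?thesis
        using V1(1) V2(1) form_weight_mixed[OF u(1) _ V2(2) V1(2)] 3
        by (intro exI[of _ "\<lambda>k k1. pw (V2 k) u * pw (V1 k1) (1 - 2 * u)"] exI[of _ "S2 * S1"]) auto
    qed
  qed
  then obtain R S' where R0: "S' \<ge> 0 \<and> (\<forall>k k1. 0 \<le> R k k1) \<and>
      (\<forall>k k1. (if jbr k \<le> jbr k1 then jbr k powr a * jbr k1 powr - (2 * \<beta>) else 0) \<le> S' * R k k1) \<and>
      (\<forall>A A' B. unit_mass A \<longrightarrow> unit_mass A' \<longrightarrow> unit_mass B \<longrightarrow>
        tsum (\<lambda>i. ennreal (R (fst i) (snd i) * (pw (A (snd i)) u * pw (A' (fst i - snd i)) u * pw (B (fst i)) (1 - u)))) \<le> 1)"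
    by (elim exE)
  note R = R0[THEN conjunct1] R0[THEN conjunct2, THEN conjunct1, rule_format]
    R0[THEN conjunct2, THEN conjunct2, THEN conjunct1, rule_format]
    R0[THEN conjunct2, THEN conjunct2, THEN conjunct2, rule_format]
  define C where "C = 2 powr \<beta> * (S + S + S') "
  show ?thesis
  proof (rule that)
    show "C > 0"
      using V R by (simp add: C_def add_pos_nonneg)
    fix A A' B assume um: "unit_mass A" "unit_mass A'" "unit_mass B"
    define P where "P = (\<lambda>i. pw (A (snd i)) u * pw (A' (fst i - snd i)) u * pw (B (fst i)) (1 - u))"
    have P: "0 \<le> P i" for i
      by (simp add: P_def)
    have f1: "tsum (\<lambda>i. ennreal (pw (V (snd i)) (1 - u) * P i)) \<le> 1"
      unfolding P_def by (rule form_weight_left[OF u V(2) um])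
    have f2: "tsum (\<lambda>i. ennreal (pw (V (fst i - snd i)) (1 - u) * P i)) \<le> 1"
      unfolding P_def by (rule form_weight_right[OF u V(2) um])
    have f3: "tsum (\<lambda>i. ennreal (R (fst i) (snd i) * P i)) \<le> 1"
      unfolding P_def by (rule R(4)[OF um])
    have "tsum (\<lambda>i. ennreal (jbr (fst i) powr a * (jbr (snd i) powr - \<beta> * jbr (fst i - snd i) powr - \<beta>) * P i))
      \<le> tsum (\<lambda>i. ennreal (2 powr \<beta>) * (ennreal S * ennreal (pw (V (snd i)) (1 - u) * P i)
          + ennreal S * ennreal (pw (V (fst i - snd i)) (1 - u) * P i)
          + ennreal S' * ennreal (R (fst i) (snd i) * P i)))"
    proof (rule tsum_mono)
      fix i :: "int \<times> int"
      define k k1 where "k = fst i" and "k1 = snd i"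
      have "jbr k powr a * (jbr k1 powr - \<beta> * jbr (k - k1) powr - \<beta>)
        \<le> 2 powr \<beta> * (jbr k1 powr - z + jbr (k - k1) powr - z
          + (if jbr k \<le> jbr k1 then jbr k powr a * jbr k1 powr - (2 * \<beta>) else 0))"
        unfolding ab(3)[symmetric]
        using jbr_triangle[of k1 "k - k1"] jbr_triangle[of k "k1 - k"] jbr_triangle[of k "- k1"]
          jbr_minus[of "k - k1"] ab
        by (intro bilinear_weight jbr_ge_1) auto
      also have "\<dots> \<le> 2 powr \<beta> * (S * pw (V k1) (1 - u) + S * pw (V (k - k1)) (1 - u) + S' * R k k1)"
        by (intro mult_left_mono add_mono V R) auto
      finally have "jbr k powr a * (jbr k1 powr - \<beta> * jbr (k - k1) powr - \<beta>) * P i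
        \<le> 2 powr \<beta> * (S * pw (V k1) (1 - u) + S * pw (V (k - k1)) (1 - u) + S' * R k k1) * P i"
        using P by (rule mult_right_mono)
      also have "\<dots> = 2 powr \<beta> * (S * (pw (V k1) (1 - u) * P i) + S * (pw (V (k - k1)) (1 - u) * P i) + S' * (R k k1 * P i))"
        by (simp add: algebra_simps)
      finally show "ennreal (jbr (fst i) powr a * (jbr (snd i) powr - \<beta> * jbr (fst i - snd i) powr - \<beta>) * P i)
        \<le> ennreal (2 powr \<beta>) * (ennreal S * ennreal (pw (V (snd i)) (1 - u) * P i)
          + ennreal S * ennreal (pw (V (fst i - snd i)) (1 - u) * P i)
          + ennreal S' * ennreal (R (fst i) (snd i) * P i))"
        unfolding k_def[symmetric] k1_def[symmetric]
        using V(1) R(1,2) P by (simp add: ennreal_mult[symmetric] ennreal_leI flip: ennreal_plus)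
    qed
    also have "\<dots> \<le> ennreal (2 powr \<beta>) * (ennreal S * 1 + ennreal S * 1 + ennreal S' * 1)"
      unfolding tsum_cmult tsum_add by (intro mult_left_mono add_mono f1 f2 f3) auto
    also have "\<dots> = ennreal C"
    proof -
      have e1: "ennreal (S + S) = ennreal S + ennreal S"
        using V(1) by (intro ennreal_plus) auto
      have e2: "ennreal (S + S + S') = ennreal (S + S) + ennreal S'"
        using V(1) R(1) by (intro ennreal_plus) auto
      show ?thesis
        unfolding C_def mult_1_right e1[symmetric] e2[symmetric]
        using V(1) R(1) by (intro ennreal_mult[symmetric]) auto
    qed
    finally show "tsum (\<lambda>i. ennreal (jbr (fst i) powr (\<alpha> + \<gamma>) * (jbr (snd i) powr - (\<alpha> + 1 - \<gamma>) * jbr (fst i - snd i) powr - (\<alpha> + 1 - \<gamma>))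
      * (pw (A (snd i)) u * pw (A' (fst i - snd i)) u * pw (B (fst i)) (1 - u)))) \<le> ennreal C"
      unfolding P_def a_def \<beta>_def .
  qed
qed

end

section \<open>Weighted norms of majorants; bilinear, trilinear and resonant bounds\<close>

definition wnorm :: "real \<Rightarrow> real \<Rightarrow> (int \<Rightarrow> ennreal) \<Rightarrow> ennreal" where
  "wnorm u \<alpha> a = dnorm u (\<lambda>k. ennreal (jbr k powr \<alpha>) * a k)"

lemma wnorm_mono: "(\<And>k. a k \<le> b k) \<Longrightarrow> wnorm u \<alpha> a \<le> wnorm u \<alpha> b"
  unfolding wnorm_def by (intro dnorm_mono mult_left_mono) auto

lemma wnorm_add: "wnorm u \<alpha> (\<lambda>k. a k + b k) \<le> wnorm u \<alpha> a + wnorm u \<alpha> b"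
  unfolding wnorm_def distrib_left by (rule dnorm_add)

lemma wnorm_cmult: "wnorm u \<alpha> (\<lambda>k. c * a k) = c * wnorm u \<alpha> a"
  unfolding wnorm_def by (subst dnorm_cmult[symmetric]) (simp add: mult_ac)

lemma FLnorm_eq_wnorm: "1 \<le> p \<Longrightarrow> FLnorm \<alpha> p f = wnorm (invp p) \<alpha> (\<lambda>k. ennreal (cmod (f k)))"
  unfolding wnorm_def by (simp add: FLnorm_eq_dnorm ennreal_mult)

lemma wnorm_ball:
  assumes u: "0 \<le> u" "u \<le> 1" and C: "C > 0" and a: "wnorm u \<alpha> a \<le> ennreal C"
  obtains A where "unit_mass A" "\<And>k. a k \<le> ennreal (C * (jbr k powr - \<alpha> * pw (A k) u))"
proof -
  obtain A where A: "unit_mass A" "\<And>k. ennreal (jbr k powr \<alpha>) * a k \<le> ennreal (C * pw (A k) u)"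
    using dnorm_ball[OF u C a[unfolded wnorm_def]] by blast
  have "a k \<le> ennreal (C * (jbr k powr - \<alpha> * pw (A k) u))" for k
  proof -
    have "a k = ennreal (jbr k powr - \<alpha>) * (ennreal (jbr k powr \<alpha>) * a k)"
      by (simp add: mult.assoc[symmetric] ennreal_mult[symmetric] powr_add[symmetric])
    also have "\<dots> \<le> ennreal (jbr k powr - \<alpha>) * ennreal (C * pw (A k) u)"
      by (intro mult_left_mono A) auto
    also have "\<dots> = ennreal (C * (jbr k powr - \<alpha> * pw (A k) u))"
      using C by (simp add: ennreal_mult[symmetric] mult_ac)
    finally show ?thesis .
  qed
  with A(1) show ?thesis
    by (rule that)
qed

lemma wnorm_le:
  assumes "\<And>B. unit_mass B \<Longrightarrow> tsum (\<lambda>k. ennreal (jbr k powr \<alpha> * pw (B k) (1 - u)) * a k) \<le> C"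
  shows "wnorm u \<alpha> a \<le> C"
  unfolding wnorm_def
proof (rule dnorm_le)
  fix B assume "unit_mass B"
  from assms[OF this] show "tsum (\<lambda>k. ennreal (jbr k powr \<alpha>) * a k * ennreal (pw (B k) (1 - u))) \<le> C"
    by (simp add: ennreal_mult mult_ac)
qed

text \<open>This is |k| |k k1 (k - k1)|^(\<gamma> - 1), the bound for the kernel of X at time order
  \<gamma>, with brackets in place of absolute values.\<close>

definition bikernel :: "real \<Rightarrow> int \<Rightarrow> int \<Rightarrow> real" where
  "bikernel \<gamma> k k1 = jbr k powr \<gamma> * (jbr k1 powr (\<gamma> - 1) * jbr (k - k1) powr (\<gamma> - 1))"

lemma bikernel_nonneg [simp]: "0 \<le> bikernel \<gamma> k k1"
  by (simp add: bikernel_def)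

context exponents
begin

text \<open>Stated with strictly positive radii instead of norms because the representation behind
  \<open>wnorm_ball\<close> divides by them; the passage to the norms is the limit in
  \<open>le_two_factors\<close>.\<close>

lemma bilinear_bound:
  obtains C where "C > 0" "\<And>a b Ca Cb. Ca > 0 \<Longrightarrow> Cb > 0 \<Longrightarrow>
    wnorm u \<alpha> a \<le> ennreal Ca \<Longrightarrow> wnorm u \<alpha> b \<le> ennreal Cb \<Longrightarrow>
    wnorm u \<alpha> (\<lambda>k. tsum (\<lambda>k1. ennreal (bikernel \<gamma> k k1) * (a k1 * b (k - k1)))) \<le> ennreal (C * (Ca * Cb))"
proof -
  obtain C where C: "C > 0" "\<And>A A' B. unit_mass A \<Longrightarrow> unit_mass A' \<Longrightarrow> unit_mass B \<Longrightarrow>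
    tsum (\<lambda>i. ennreal (jbr (fst i) powr (\<alpha> + \<gamma>) * (jbr (snd i) powr - (\<alpha> + 1 - \<gamma>) * jbr (fst i - snd i) powr - (\<alpha> + 1 - \<gamma>))
      * (pw (A (snd i)) u * pw (A' (fst i - snd i)) u * pw (B (fst i)) (1 - u)))) \<le> ennreal C"
    using bilinear_form by blast
  show ?thesis
  proof (rule that[OF C(1)])
    fix a b :: "int \<Rightarrow> ennreal" and Ca Cb :: real
    assume pos: "Ca > 0" "Cb > 0" and a: "wnorm u \<alpha> a \<le> ennreal Ca" and b: "wnorm u \<alpha> b \<le> ennreal Cb"
    obtain A where A: "unit_mass A" "\<And>k. a k \<le> ennreal (Ca * (jbr k powr - \<alpha> * pw (A k) u))"
      using wnorm_ball[OF u pos(1) a] by blast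
    obtain A' where A': "unit_mass A'" "\<And>k. b k \<le> ennreal (Cb * (jbr k powr - \<alpha> * pw (A' k) u))"
      using wnorm_ball[OF u pos(2) b] by blast
    show "wnorm u \<alpha> (\<lambda>k. tsum (\<lambda>k1. ennreal (bikernel \<gamma> k k1) * (a k1 * b (k - k1)))) \<le> ennreal (C * (Ca * Cb))"
    proof (rule wnorm_le)
      fix B assume B: "unit_mass B"
      have "tsum (\<lambda>k. ennreal (jbr k powr \<alpha> * pw (B k) (1 - u)) * tsum (\<lambda>k1. ennreal (bikernel \<gamma> k k1) * (a k1 * b (k - k1))))
        = tsum (\<lambda>i. ennreal (jbr (fst i) powr \<alpha> * pw (B (fst i)) (1 - u)) *
            (ennreal (bikernel \<gamma> (fst i) (snd i)) * (a (snd i) * b (fst i - snd i))))"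
        by (simp add: tsum_cmult[symmetric] tsum_prod)
      also have "\<dots> \<le> tsum (\<lambda>i. ennreal (Ca * Cb) * ennreal (jbr (fst i) powr (\<alpha> + \<gamma>) * (jbr (snd i) powr - (\<alpha> + 1 - \<gamma>) * jbr (fst i - snd i) powr - (\<alpha> + 1 - \<gamma>))
          * (pw (A (snd i)) u * pw (A' (fst i - snd i)) u * pw (B (fst i)) (1 - u))))"
      proof (rule tsum_mono)
        fix i :: "int \<times> int"
        define k k1 where "k = fst i" and "k1 = snd i"
        have "ennreal (jbr k powr \<alpha> * pw (B k) (1 - u)) * (ennreal (bikernel \<gamma> k k1) * (a k1 * b (k - k1)))
          \<le> ennreal (jbr k powr \<alpha> * pw (B k) (1 - u)) * (ennreal (bikernel \<gamma> k k1) *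
             (ennreal (Ca * (jbr k1 powr - \<alpha> * pw (A k1) u)) * ennreal (Cb * (jbr (k - k1) powr - \<alpha> * pw (A' (k - k1)) u))))"
          by (intro mult_left_mono mult_mono A A') auto
        also have "\<dots> = ennreal ((jbr k powr \<alpha> * pw (B k) (1 - u)) * (bikernel \<gamma> k k1 *
             ((Ca * (jbr k1 powr - \<alpha> * pw (A k1) u)) * (Cb * (jbr (k - k1) powr - \<alpha> * pw (A' (k - k1)) u)))))"
          using pos by (simp add: ennreal_mult[symmetric])
        also have "(jbr k powr \<alpha> * pw (B k) (1 - u)) * (bikernel \<gamma> k k1 *
             ((Ca * (jbr k1 powr - \<alpha> * pw (A k1) u)) * (Cb * (jbr (k - k1) powr - \<alpha> * pw (A' (k - k1)) u))))
          = (Ca * Cb) * ((jbr k powr \<alpha> * jbr k powr \<gamma>) * ((jbr k1 powr (\<gamma> - 1) * jbr k1 powr - \<alpha>)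
             * (jbr (k - k1) powr (\<gamma> - 1) * jbr (k - k1) powr - \<alpha>))
             * (pw (A k1) u * pw (A' (k - k1)) u * pw (B k) (1 - u)))"
          by (simp add: bikernel_def mult_ac)
        also have "\<dots> = (Ca * Cb) * (jbr k powr (\<alpha> + \<gamma>) * (jbr k1 powr - (\<alpha> + 1 - \<gamma>) * jbr (k - k1) powr - (\<alpha> + 1 - \<gamma>))
             * (pw (A k1) u * pw (A' (k - k1)) u * pw (B k) (1 - u)))"
          unfolding powr_add[symmetric] by (simp add: algebra_simps)
        finally show "ennreal (jbr (fst i) powr \<alpha> * pw (B (fst i)) (1 - u)) *
            (ennreal (bikernel \<gamma> (fst i) (snd i)) * (a (snd i) * b (fst i - snd i)))
          \<le> ennreal (Ca * Cb) * ennreal (jbr (fst i) powr (\<alpha> + \<gamma>) * (jbr (snd i) powr - (\<alpha> + 1 - \<gamma>) * jbr (fst i - snd i) powr - (\<alpha> + 1 - \<gamma>))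
          * (pw (A (snd i)) u * pw (A' (fst i - snd i)) u * pw (B (fst i)) (1 - u)))"
          unfolding k_def[symmetric] k1_def[symmetric] using pos by (simp add: ennreal_mult'')
      qed
      also have "\<dots> \<le> ennreal (Ca * Cb) * ennreal C"
        unfolding tsum_cmult by (intro mult_left_mono C A A' B) auto
      also have "\<dots> = ennreal (C * (Ca * Cb))"
        using pos C by (simp add: ennreal_mult[symmetric] mult_ac)
      finally show "tsum (\<lambda>k. ennreal (jbr k powr \<alpha> * pw (B k) (1 - u)) * tsum (\<lambda>k1. ennreal (bikernel \<gamma> k k1) * (a k1 * b (k - k1))))
        \<le> ennreal (C * (Ca * Cb))" .
    qed
  qed
qed

text \<open>The powers of order \<alpha> cancel the weights in the norms of the output and of the
  three inputs; a decay of order z at each of two frequencies is left.\<close>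

definition pair_weight :: "(int \<Rightarrow> int \<times> int \<Rightarrow> int) \<Rightarrow> (int \<Rightarrow> int \<times> int \<Rightarrow> int) \<Rightarrow> int \<Rightarrow> int \<times> int \<Rightarrow> real" where
  "pair_weight \<phi> \<psi> k j = jbr k powr - \<alpha> * (jbr (fst j) powr \<alpha> * jbr (snd j) powr \<alpha> * jbr (k - fst j - snd j) powr \<alpha>)
     * (jbr (\<phi> k j) powr - z * jbr (\<psi> k j) powr - z)"

lemma pair_weight_nonneg [simp]: "0 \<le> pair_weight \<phi> \<psi> k j"
  by (simp add: pair_weight_def)

text \<open>Young's inequality with exponents 1 - u and u. The two weights and the dual sequence at
  k form one triple that determines the index, which is \<open>inj\<close>; the three inputs form
  the other.\<close>

lemma trilinear_bound:
  assumes inj: "inj (\<lambda>i. (\<phi> (fst i) (snd i), \<psi> (fst i) (snd i), fst i))"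
  obtains C where "C > 0" "\<And>a b c Ca Cb Cc. Ca > 0 \<Longrightarrow> Cb > 0 \<Longrightarrow> Cc > 0 \<Longrightarrow>
    wnorm u \<alpha> a \<le> ennreal Ca \<Longrightarrow> wnorm u \<alpha> b \<le> ennreal Cb \<Longrightarrow> wnorm u \<alpha> c \<le> ennreal Cc \<Longrightarrow>
    wnorm u \<alpha> (\<lambda>k. tsum (\<lambda>j. ennreal (pair_weight \<phi> \<psi> k j) * (a (fst j) * b (snd j) * c (k - fst j - snd j))))
      \<le> ennreal (C * (Ca * Cb * Cc))"
proof -
  obtain V S where V: "S > 0" "unit_mass V" "\<And>k. jbr k powr - z \<le> S * pw (V k) (1 - u)"
    by (rule jbr_weight[OF one_minus_u z_gt]) iprover
  have "S * S > 0"
    using V by simp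
  then show ?thesis
  proof (rule that)
    fix a b c :: "int \<Rightarrow> ennreal" and Ca Cb Cc :: real
    assume pos: "Ca > 0" "Cb > 0" "Cc > 0" and a: "wnorm u \<alpha> a \<le> ennreal Ca"
      and b: "wnorm u \<alpha> b \<le> ennreal Cb" and c: "wnorm u \<alpha> c \<le> ennreal Cc"
    obtain A1 where A1: "unit_mass A1" "\<And>k. a k \<le> ennreal (Ca * (jbr k powr - \<alpha> * pw (A1 k) u))"
      using wnorm_ball[OF u pos(1) a] by blast
    obtain A2 where A2: "unit_mass A2" "\<And>k. b k \<le> ennreal (Cb * (jbr k powr - \<alpha> * pw (A2 k) u))"
      using wnorm_ball[OF u pos(2) b] by blast
    obtain A3 where A3: "unit_mass A3" "\<And>k. c k \<le> ennreal (Cc * (jbr k powr - \<alpha> * pw (A3 k) u))"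
      using wnorm_ball[OF u pos(3) c] by blast
    show "wnorm u \<alpha> (\<lambda>k. tsum (\<lambda>j. ennreal (pair_weight \<phi> \<psi> k j) * (a (fst j) * b (snd j) * c (k - fst j - snd j))))
        \<le> ennreal (S * S * (Ca * Cb * Cc))"
    proof (rule wnorm_le)
      fix B assume B: "unit_mass B"
      note nn = unit_mass_nonneg[OF A1(1)] unit_mass_nonneg[OF A2(1)] unit_mass_nonneg[OF A3(1)]
        unit_mass_nonneg[OF B] unit_mass_nonneg[OF V(2)]
      define P where "P = (\<lambda>i. pw (V (\<phi> (fst i) (snd i)) * V (\<psi> (fst i) (snd i)) * B (fst i)) (1 - u)
        * pw (A1 (fst (snd i)) * A2 (snd (snd i)) * A3 (fst i - fst (snd i) - snd (snd i))) u)"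
      have P1: "tsum (\<lambda>i. ennreal (P i)) \<le> 1"
      proof (rule tsum_average2[of "1 - u" u "\<lambda>i. V (\<phi> (fst i) (snd i)) * V (\<psi> (fst i) (snd i)) * B (fst i)"
            "\<lambda>i. A1 (fst (snd i)) * A2 (snd (snd i)) * A3 (fst i - fst (snd i) - snd (snd i))"])
        show "tsum (\<lambda>i. ennreal (V (\<phi> (fst i) (snd i)) * V (\<psi> (fst i) (snd i)) * B (fst i))) \<le> 1"
          by (rule unit_mass_triple[OF V(2) V(2) B inj])
        show "tsum (\<lambda>i. ennreal (A1 (fst (snd i)) * A2 (snd (snd i)) * A3 (fst i - fst (snd i) - snd (snd i)))) \<le> 1"
          by (rule unit_mass_triple[OF A1(1) A2(1) A3(1)]) (auto simp: inj_def)
        show "P i \<le> (1 - u) * (V (\<phi> (fst i) (snd i)) * V (\<psi> (fst i) (snd i)) * B (fst i))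
            + u * (A1 (fst (snd i)) * A2 (snd (snd i)) * A3 (fst i - fst (snd i) - snd (snd i)))" for i
          unfolding P_def using nn u by (intro young2) auto
      qed (use nn u in auto)
      have "tsum (\<lambda>k. ennreal (jbr k powr \<alpha> * pw (B k) (1 - u)) *
          tsum (\<lambda>j. ennreal (pair_weight \<phi> \<psi> k j) * (a (fst j) * b (snd j) * c (k - fst j - snd j))))
        = tsum (\<lambda>i. ennreal (jbr (fst i) powr \<alpha> * pw (B (fst i)) (1 - u)) *
          (ennreal (pair_weight \<phi> \<psi> (fst i) (snd i)) * (a (fst (snd i)) * b (snd (snd i)) * c (fst i - fst (snd i) - snd (snd i)))))"
        by (simp add: tsum_cmult[symmetric] tsum_prod)
      also have "\<dots> \<le> tsum (\<lambda>i. ennreal (S * S * (Ca * Cb * Cc)) * ennreal (P i))"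
      proof (rule tsum_mono)
        fix i :: "int \<times> int \<times> int"
        define k j k1 k3 k4 where "k = fst i" and "j = snd i" and "k1 = fst j" and "k3 = snd j" and "k4 = k - k1 - k3"
        note defs = k_def[symmetric] j_def[symmetric] k1_def[symmetric] k3_def[symmetric] k4_def[symmetric]
        define p where "p = pw (A1 k1) u * pw (A2 k3) u * pw (A3 k4) u * pw (B k) (1 - u)"
        have p: "p \<ge> 0"
          by (simp add: p_def)
        have "ennreal (jbr k powr \<alpha> * pw (B k) (1 - u)) * (ennreal (pair_weight \<phi> \<psi> k j) * (a k1 * b k3 * c k4))
          \<le> ennreal (jbr k powr \<alpha> * pw (B k) (1 - u)) * (ennreal (pair_weight \<phi> \<psi> k j) *
             (ennreal (Ca * (jbr k1 powr - \<alpha> * pw (A1 k1) u)) * ennreal (Cb * (jbr k3 powr - \<alpha> * pw (A2 k3) u))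
               * ennreal (Cc * (jbr k4 powr - \<alpha> * pw (A3 k4) u))))"
          by (intro mult_left_mono mult_mono A1 A2 A3) auto
        also have "\<dots> = ennreal ((jbr k powr \<alpha> * pw (B k) (1 - u)) * (pair_weight \<phi> \<psi> k j *
             ((Ca * (jbr k1 powr - \<alpha> * pw (A1 k1) u)) * (Cb * (jbr k3 powr - \<alpha> * pw (A2 k3) u))
               * (Cc * (jbr k4 powr - \<alpha> * pw (A3 k4) u)))))"
          using pos by (simp add: ennreal_mult[symmetric])
        also have "(jbr k powr \<alpha> * pw (B k) (1 - u)) * (pair_weight \<phi> \<psi> k j *
             ((Ca * (jbr k1 powr - \<alpha> * pw (A1 k1) u)) * (Cb * (jbr k3 powr - \<alpha> * pw (A2 k3) u))
               * (Cc * (jbr k4 powr - \<alpha> * pw (A3 k4) u))))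
          = (Ca * Cb * Cc) * (((jbr k powr \<alpha> * jbr k powr - \<alpha>) * (jbr k1 powr \<alpha> * jbr k1 powr - \<alpha>)
             * (jbr k3 powr \<alpha> * jbr k3 powr - \<alpha>) * (jbr k4 powr \<alpha> * jbr k4 powr - \<alpha>))
             * (jbr (\<phi> k j) powr - z * jbr (\<psi> k j) powr - z)) * p"
          unfolding pair_weight_def defs p_def by (simp add: mult_ac)
        also have "\<dots> = (Ca * Cb * Cc) * (jbr (\<phi> k j) powr - z * jbr (\<psi> k j) powr - z) * p"
          unfolding powr_add[symmetric] by simp
        also have "\<dots> \<le> (Ca * Cb * Cc) * ((S * pw (V (\<phi> k j)) (1 - u)) * (S * pw (V (\<psi> k j)) (1 - u))) * p"
          using pos p V(1) by (intro mult_left_mono mult_right_mono mult_mono V(3)) auto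
        also have "\<dots> = S * S * (Ca * Cb * Cc) * P i"
          unfolding P_def p_def defs using nn by (simp add: pw_mult mult_ac)
        finally show "ennreal (jbr (fst i) powr \<alpha> * pw (B (fst i)) (1 - u)) *
            (ennreal (pair_weight \<phi> \<psi> (fst i) (snd i)) * (a (fst (snd i)) * b (snd (snd i)) * c (fst i - fst (snd i) - snd (snd i))))
          \<le> ennreal (S * S * (Ca * Cb * Cc)) * ennreal (P i)"
          unfolding defs using pos V(1) by (simp add: ennreal_mult[symmetric] P_def ennreal_leI)
      qed
      also have "\<dots> \<le> ennreal (S * S * (Ca * Cb * Cc)) * 1"
        unfolding tsum_cmult by (intro mult_left_mono P1) auto
      finally show "tsum (\<lambda>k. ennreal (jbr k powr \<alpha> * pw (B k) (1 - u)) *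
          tsum (\<lambda>j. ennreal (pair_weight \<phi> \<psi> k j) * (a (fst j) * b (snd j) * c (k - fst j - snd j))))
        \<le> ennreal (S * S * (Ca * Cb * Cc))"
        by simp
    qed
  qed
qed

text \<open>The condition \<open>\<alpha> > max (- 1/p) (- 1/2)\<close> is what makes the resonant sum converge.\<close>

lemma resonant_sum:
  obtains C where "C > 0" "\<And>a b Ca Cb. Ca > 0 \<Longrightarrow> Cb > 0 \<Longrightarrow>
    wnorm u \<alpha> a \<le> ennreal Ca \<Longrightarrow> wnorm u \<alpha> b \<le> ennreal Cb \<Longrightarrow>
    tsum (\<lambda>k. ennreal (1 / jbr k) * (a k * b (- k))) \<le> ennreal (C * (Ca * Cb))"
proof -
  \<comment> \<open>Two inputs and the factor 1 / <k> give <k>^(-x). Here x > 0 means \<alpha> > -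
    1/2, and x > 1 - 2u means \<alpha> > - u.\<close>
  define x where "x = 1 + 2 * \<alpha>"
  have x: "x > 0" "x > 1 - 2 * u"
    using alpha gamma by (auto simp: x_def)
  define e where "e = max 0 (1 - 2 * u)"
  have e: "0 \<le> e" "e < x"
    using x by (auto simp: e_def)
  obtain V S where V: "S > 0" "unit_mass V" "\<And>k. jbr k powr - x \<le> S * pw (V k) e"
    by (rule jbr_weight[OF e]) iprover
  have sum1: "tsum (\<lambda>k. ennreal (pw (V k) e * (pw (A k) u * pw (A' (- k)) u))) \<le> 1"
    if A: "unit_mass A" and A': "unit_mass A'" for A A'
  proof -
    have m: "tsum (\<lambda>k. ennreal (A' (- k))) \<le> 1"
      using tsum_diff_left[of "\<lambda>k. ennreal (A' k)" 0] unit_mass_tsum[OF A'] by simp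
    note nn = unit_mass_nonneg[OF V(2)] unit_mass_nonneg[OF A] unit_mass_nonneg[OF A']
    \<comment> \<open>For u > 1/2 the two exponents u would exceed 1 in total; lowering both to 1/2
      only enlarges the factors, since a unit mass is at most 1.\<close>
    define v where "v = (if u \<ge> 1 / 2 then 1 / 2 else u)"
    have v: "0 \<le> v" "v \<le> u" "e + v + v = 1"
      using u by (auto simp: v_def e_def)
    have le: "pw (D k) u \<le> pw (D k) v" if D: "unit_mass D" for D k
    proof -
      have "pw (D k) u = pw (D k) v * pw (D k) (u - v)"
        using v by (simp add: pw_add[symmetric])
      also have "\<dots> \<le> pw (D k) v * 1"
        using v unit_mass_nonneg[OF D] unit_mass_le_one[OF D] by (intro mult_left_mono pw_le_one) auto
      finally show ?thesis
        by simp
    qed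
    show ?thesis
    proof (rule tsum_average3[of e v v V A "\<lambda>k. A' (- k)"])
      show "pw (V k) e * (pw (A k) u * pw (A' (- k)) u) \<le> e * V k + v * A k + v * A' (- k)" for k
      proof -
        have "pw (V k) e * (pw (A k) u * pw (A' (- k)) u) \<le> pw (V k) e * (pw (A k) v * pw (A' (- k)) v)"
          by (intro mult_left_mono mult_mono le A A') auto
        also have "\<dots> \<le> e * V k + v * A k + v * A' (- k)"
          unfolding mult.assoc[symmetric] using nn v e by (intro young3) auto
        finally show ?thesis .
      qed
    qed (use nn v e m unit_mass_tsum[OF V(2)] unit_mass_tsum[OF A] in auto)
  qed
  show ?thesis
  proof (rule that[OF V(1)])
    fix a b :: "int \<Rightarrow> ennreal" and Ca Cb :: real
    assume pos: "Ca > 0" "Cb > 0" and a: "wnorm u \<alpha> a \<le> ennreal Ca" and b: "wnorm u \<alpha> b \<le> ennreal Cb"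
    obtain A where A: "unit_mass A" "\<And>k. a k \<le> ennreal (Ca * (jbr k powr - \<alpha> * pw (A k) u))"
      using wnorm_ball[OF u pos(1) a] by blast
    obtain A' where A': "unit_mass A'" "\<And>k. b k \<le> ennreal (Cb * (jbr k powr - \<alpha> * pw (A' k) u))"
      using wnorm_ball[OF u pos(2) b] by blast
    have "tsum (\<lambda>k. ennreal (1 / jbr k) * (a k * b (- k)))
      \<le> tsum (\<lambda>k. ennreal (S * (Ca * Cb)) * ennreal (pw (V k) e * (pw (A k) u * pw (A' (- k)) u)))"
    proof (rule tsum_mono)
      fix k
      have "ennreal (1 / jbr k) * (a k * b (- k)) \<le> ennreal (1 / jbr k) *
          (ennreal (Ca * (jbr k powr - \<alpha> * pw (A k) u)) * ennreal (Cb * (jbr (- k) powr - \<alpha> * pw (A' (- k)) u)))"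
        by (intro mult_left_mono mult_mono A A') auto
      also have "\<dots> = ennreal (1 / jbr k * ((Ca * (jbr k powr - \<alpha> * pw (A k) u)) * (Cb * (jbr k powr - \<alpha> * pw (A' (- k)) u))))"
        using pos by (simp add: ennreal_mult[symmetric])
      also have "1 / jbr k * ((Ca * (jbr k powr - \<alpha> * pw (A k) u)) * (Cb * (jbr k powr - \<alpha> * pw (A' (- k)) u)))
        = (Ca * Cb) * (jbr k powr - 1 * (jbr k powr - \<alpha> * jbr k powr - \<alpha>)) * (pw (A k) u * pw (A' (- k)) u)"
        by (simp add: powr_minus_divide)
      also have "jbr k powr - 1 * (jbr k powr - \<alpha> * jbr k powr - \<alpha>) = jbr k powr - x"
        unfolding powr_add[symmetric] by (simp add: x_def)
      also have "(Ca * Cb) * jbr k powr - x * (pw (A k) u * pw (A' (- k)) u)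
        \<le> (Ca * Cb) * (S * pw (V k) e) * (pw (A k) u * pw (A' (- k)) u)"
        using pos by (intro mult_left_mono mult_right_mono V) auto
      also have "\<dots> = S * (Ca * Cb) * (pw (V k) e * (pw (A k) u * pw (A' (- k)) u))"
        by (simp add: mult_ac)
      finally show "ennreal (1 / jbr k) * (a k * b (- k))
        \<le> ennreal (S * (Ca * Cb)) * ennreal (pw (V k) e * (pw (A k) u * pw (A' (- k)) u))"
        using pos V(1) by (simp add: ennreal_mult[symmetric] ennreal_leI)
    qed
    also have "\<dots> \<le> ennreal (S * (Ca * Cb)) * 1"
      unfolding tsum_cmult by (intro mult_left_mono sum1 A A') auto
    finally show "tsum (\<lambda>k. ennreal (1 / jbr k) * (a k * b (- k))) \<le> ennreal (S * (Ca * Cb))"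
      by simp
  qed
qed

end

section \<open>Oscillatory kernels\<close>

definition ph :: "real \<Rightarrow> real \<Rightarrow> complex" where
  "ph \<Phi> \<sigma> = exp (- (\<i> * of_real (\<Phi> * \<sigma>)))"

lemma norm_ph [simp]: "norm (ph \<Phi> \<sigma>) = 1"
  by (simp add: ph_def)

lemma ph_0 [simp]: "ph 0 \<sigma> = 1"
  by (simp add: ph_def)

lemma ph_mult: "ph \<Phi> \<sigma> * ph \<Psi> \<sigma> = ph (\<Phi> + \<Psi>) \<sigma>"
  by (simp add: ph_def exp_add[symmetric] algebra_simps)

lemma ph_int: "exp (- 3 * \<i> * of_int n * of_real \<sigma>) = ph (3 * of_int n) \<sigma>"
  by (simp add: ph_def mult_ac)

definition osc :: "real \<Rightarrow> real \<Rightarrow> real \<Rightarrow> complex" where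
  "osc \<Phi> s t = (if \<Phi> = 0 then of_real (t - s) else (ph \<Phi> s - ph \<Phi> t) / (\<i> * of_real \<Phi>))"

lemma osc_has_integral: "s \<le> t \<Longrightarrow> ((\<lambda>\<sigma>. ph \<Phi> \<sigma>) has_integral osc \<Phi> s t) {s..t}"
proof (cases "\<Phi> = 0")
  case True
  assume "s \<le> t"
  then show ?thesis
    using True has_integral_const_real[of "1::complex" s t]
    by (simp add: osc_def scaleR_conv_of_real)
next
  case False
  assume "s \<le> t"
  then have "((\<lambda>\<sigma>. ph \<Phi> \<sigma>) has_integral (- ph \<Phi> t / (\<i> * of_real \<Phi>) - - ph \<Phi> s / (\<i> * of_real \<Phi>))) {s..t}"
  proof (rule fundamental_theorem_of_calculus)
    fix x assume "x \<in> {s..t}"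
    show "((\<lambda>x. - ph \<Phi> x / (\<i> * of_real \<Phi>)) has_vector_derivative ph \<Phi> x) (at x within {s..t})"
      unfolding ph_def using False
      by (auto intro!: derivative_eq_intros has_vector_derivative_real_field simp: field_simps)
  qed
  then show ?thesis
    using False by (simp add: osc_def diff_divide_distrib)
qed

lemma osc_chain: "osc \<Phi> s t = osc \<Phi> s m + osc \<Phi> m t"
  by (simp add: osc_def diff_divide_distrib)

lemma norm_osc_le_length: "s \<le> t \<Longrightarrow> norm (osc \<Phi> s t) \<le> t - s"
  using has_integral_bound_real[OF _ _ osc_has_integral, of 1 "{}" s t \<Phi>] by simp

lemma norm_osc_le_phase: "\<Phi> \<noteq> 0 \<Longrightarrow> norm (osc \<Phi> s t) \<le> 2 / \<bar>\<Phi>\<bar>"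
  using norm_triangle_ineq4[of "ph \<Phi> s" "ph \<Phi> t"]
  by (simp add: osc_def norm_divide norm_mult divide_right_mono)

lemma min_le_powr:
  fixes x y :: real
  assumes "0 \<le> x" "0 \<le> y" "0 \<le> \<theta>" "\<theta> \<le> 1"
  shows "min x y \<le> x powr \<theta> * y powr (1 - \<theta>)"
proof -
  have "min x y = min x y powr \<theta> * min x y powr (1 - \<theta>)"
    using assms by (cases "min x y = 0") (auto simp: powr_add[symmetric])
  also have "\<dots> \<le> x powr \<theta> * y powr (1 - \<theta>)"
    using assms by (intro mult_mono powr_mono2) auto
  finally show ?thesis .
qed

text \<open>Interpolation between the length of the interval and the reciprocal of the
  phase.\<close>

lemma norm_osc_le:
  assumes "\<Phi> \<noteq> 0" "s \<le> t" "0 \<le> \<theta>" "\<theta> \<le> 1"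
  shows "norm (osc \<Phi> s t) \<le> 2 * (t - s) powr \<theta> * \<bar>\<Phi>\<bar> powr (\<theta> - 1)"
proof -
  have "norm (osc \<Phi> s t) \<le> min (t - s) (2 / \<bar>\<Phi>\<bar>)"
    using norm_osc_le_length[of s t \<Phi>] norm_osc_le_phase[of \<Phi> s t] assms by simp
  also have "\<dots> \<le> 2 * min (t - s) (1 / \<bar>\<Phi>\<bar>)"
    using assms by (auto simp: min_def)
  also have "\<dots> \<le> 2 * ((t - s) powr \<theta> * (1 / \<bar>\<Phi>\<bar>) powr (1 - \<theta>))"
    using assms by (intro mult_left_mono min_le_powr) auto
  also have "(1 / \<bar>\<Phi>\<bar>) powr (1 - \<theta>) = \<bar>\<Phi>\<bar> powr (\<theta> - 1)"
    using powr_minus_divide[of "\<bar>\<Phi>\<bar>" "1 - \<theta>"] by (simp add: powr_divide)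
  finally show ?thesis
    by (simp add: mult_ac)
qed

text \<open>The iterated integral of \<open>ph \<Phi> \<sigma> * ph \<Psi> \<sigma>\<^sub>1\<close> over \<open>s \<le> \<sigma>\<^sub>1 \<le> \<sigma> \<le> t\<close>, for \<open>\<Psi> \<noteq> 0\<close>.\<close>

definition osc2 :: "real \<Rightarrow> real \<Rightarrow> real \<Rightarrow> real \<Rightarrow> complex" where
  "osc2 \<Phi> \<Psi> s t = (ph \<Psi> s * osc \<Phi> s t - osc (\<Phi> + \<Psi>) s t) / (\<i> * of_real \<Psi>)"

lemma osc2_has_integral:
  assumes "s \<le> t" "\<Psi> \<noteq> 0"
  shows "((\<lambda>\<sigma>. ph \<Phi> \<sigma> * osc \<Psi> s \<sigma>) has_integral osc2 \<Phi> \<Psi> s t) {s..t}"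
proof -
  have "((\<lambda>\<sigma>. (ph \<Psi> s * ph \<Phi> \<sigma> - ph (\<Phi> + \<Psi>) \<sigma>) / (\<i> * of_real \<Psi>)) has_integral osc2 \<Phi> \<Psi> s t) {s..t}"
    unfolding osc2_def using assms
    by (intro has_integral_divide has_integral_diff has_integral_mult_right osc_has_integral)
  moreover have "(ph \<Psi> s * ph \<Phi> \<sigma> - ph (\<Phi> + \<Psi>) \<sigma>) / (\<i> * of_real \<Psi>) = ph \<Phi> \<sigma> * osc \<Psi> s \<sigma>" for \<sigma>
    using assms by (simp add: osc_def ph_mult[symmetric] algebra_simps)
  ultimately show ?thesis
    by simp
qed

lemma osc2_chain:
  assumes "\<Psi> \<noteq> 0"
  shows "osc2 \<Phi> \<Psi> s t = osc2 \<Phi> \<Psi> s m + osc2 \<Phi> \<Psi> m t + osc \<Phi> m t * osc \<Psi> s m"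
proof -
  have o: "osc \<Psi> s m = (ph \<Psi> s - ph \<Psi> m) / (\<i> * of_real \<Psi>)"
    using assms by (simp add: osc_def)
  show ?thesis
    unfolding osc2_def osc_chain[of _ s t m] o
    by (simp add: diff_divide_distrib add_divide_distrib algebra_simps)
qed

text \<open>Integrating in the other order exposes the decay in \<open>\<Phi>\<close>.\<close>

lemma osc2_swap:
  assumes "\<Psi> \<noteq> 0" "\<Phi> \<noteq> 0" "\<Phi> + \<Psi> \<noteq> 0"
  shows "osc2 \<Phi> \<Psi> s t = (osc (\<Phi> + \<Psi>) s t - ph \<Phi> t * osc \<Psi> s t) / (\<i> * of_real \<Phi>)"
proof -
  define G where "G = osc (\<Phi> + \<Psi>) s t"
  define x y where "x = \<i> * of_real \<Phi>" and "y = \<i> * of_real \<Psi>"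
  have xy: "x \<noteq> 0" "y \<noteq> 0" "x + y \<noteq> 0" "\<i> * of_real (\<Phi> + \<Psi>) = x + y"
    using assms by (auto simp: x_def y_def distrib_left[symmetric] of_real_add[symmetric] simp del: of_real_add)
  have G: "G * (x + y) = ph \<Phi> s * ph \<Psi> s - ph \<Phi> t * ph \<Psi> t"
    using assms xy by (simp add: G_def osc_def ph_mult)
  have o: "osc \<Phi> s t = (ph \<Phi> s - ph \<Phi> t) / x" "osc \<Psi> s t = (ph \<Psi> s - ph \<Psi> t) / y"
    using assms by (simp_all add: osc_def x_def y_def)
  have "osc2 \<Phi> \<Psi> s t - (G - ph \<Phi> t * osc \<Psi> s t) / x
      = (ph \<Psi> s * (ph \<Phi> s - ph \<Phi> t) + ph \<Phi> t * (ph \<Psi> s - ph \<Psi> t) - G * (x + y)) / (x * y)"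
    unfolding osc2_def o G_def[symmetric] y_def[symmetric] using xy by (simp add: field_simps)
  also have "\<dots> = 0"
    unfolding G by (simp add: algebra_simps)
  finally show ?thesis
    by (simp add: G_def x_def)
qed

lemma norm_osc2_le1:
  assumes "\<Psi> \<noteq> 0"
  shows "norm (osc2 \<Phi> \<Psi> s t) \<le> (norm (osc \<Phi> s t) + norm (osc (\<Phi> + \<Psi>) s t)) / \<bar>\<Psi>\<bar>"
  unfolding osc2_def norm_divide
  using norm_triangle_ineq4[of "ph \<Psi> s * osc \<Phi> s t" "osc (\<Phi> + \<Psi>) s t"]
  by (auto simp: norm_mult intro!: divide_right_mono)

text \<open>It suffices to bound the integral by the product of the minima of t - s with 1/|\<Phi>|
  and with 1/|\<Psi>|; the four corners are the facts 1 to 4. In the corner with both reciprocals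
  \<open>far\<close> bounds the phase of the sum from below; the one with 1/|\<Phi>| alone needs the
  other order of integration.\<close>

lemma norm_osc2_nonresonant:
  assumes st: "s \<le> t" and nz: "\<Psi> \<noteq> 0" "\<Phi> \<noteq> 0" and far: "\<bar>\<Phi>\<bar> \<le> 2 * \<bar>\<Phi> + \<Psi>\<bar>" and th: "0 \<le> \<theta>" "\<theta> \<le> 1"
  shows "norm (osc2 \<Phi> \<Psi> s t) \<le> 6 * (t - s) powr (2 * \<theta>) * (\<bar>\<Phi>\<bar> * \<bar>\<Psi>\<bar>) powr (\<theta> - 1)"
proof -
  define \<tau> a b where "\<tau> = t - s" and "a = \<bar>\<Phi>\<bar>" and "b = \<bar>\<Psi>\<bar>"
  have pos: "0 \<le> \<tau>" "0 < a" "0 < b"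
    using assms by (auto simp: \<tau>_def a_def b_def)
  have nz3: "\<Phi> + \<Psi> \<noteq> 0"
    using far nz by auto
  have o: "norm (osc \<Phi> s t) \<le> \<tau>" "norm (osc \<Psi> s t) \<le> \<tau>" "norm (osc (\<Phi> + \<Psi>) s t) \<le> \<tau>"
    using norm_osc_le_length[OF st] by (auto simp: \<tau>_def)
  have 1: "norm (osc2 \<Phi> \<Psi> s t) \<le> 6 * (1 / a * (1 / b))"
  proof -
    have "2 / \<bar>\<Phi> + \<Psi>\<bar> \<le> 4 / a"
      using far pos nz3 by (simp add: field_simps a_def)
    then have "norm (osc \<Phi> s t) + norm (osc (\<Phi> + \<Psi>) s t) \<le> 2 / a + 4 / a"
      using norm_osc_le_phase[OF nz(2), of s t] norm_osc_le_phase[OF nz3, of s t] by (auto simp: a_def)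
    from divide_right_mono[OF this, of b] have "norm (osc2 \<Phi> \<Psi> s t) \<le> (2 / a + 4 / a) / b"
      using norm_osc2_le1[OF nz(1), of \<Phi> s t] pos unfolding b_def by linarith
    then show ?thesis
      using pos by (simp add: field_simps)
  qed
  have 2: "norm (osc2 \<Phi> \<Psi> s t) \<le> 6 * (\<tau> * (1 / b))"
  proof -
    have "norm (osc2 \<Phi> \<Psi> s t) \<le> (\<tau> + \<tau>) / b"
      using order_trans[OF norm_osc2_le1[OF nz(1)] divide_right_mono[OF add_mono[OF o(1,3)]]] pos by (simp add: b_def)
    also have "\<dots> \<le> 6 * (\<tau> * (1 / b))"
      using pos by (simp add: field_simps)
    finally show ?thesis .
  qed
  have 3: "norm (osc2 \<Phi> \<Psi> s t) \<le> 6 * (1 / a * \<tau>)"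
  proof -
    have "norm (osc (\<Phi> + \<Psi>) s t - ph \<Phi> t * osc \<Psi> s t) \<le> \<tau> + \<tau>"
      using norm_triangle_ineq4[of "osc (\<Phi> + \<Psi>) s t" "ph \<Phi> t * osc \<Psi> s t"] o by (auto simp: norm_mult)
    then have "norm (osc2 \<Phi> \<Psi> s t) \<le> (\<tau> + \<tau>) / a"
      unfolding osc2_swap[OF nz nz3] norm_divide using pos by (auto simp: a_def norm_mult intro!: divide_right_mono)
    also have "\<dots> \<le> 6 * (1 / a * \<tau>)"
      using pos by (simp add: field_simps)
    finally show ?thesis .
  qed
  have 4: "norm (osc2 \<Phi> \<Psi> s t) \<le> 6 * (\<tau> * \<tau>)"
  proof -
    have "norm (osc2 \<Phi> \<Psi> s t) \<le> \<tau> * (t - s)"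
    proof (rule order_trans[OF has_integral_bound_real[OF pos(1) finite.emptyI osc2_has_integral[OF st nz(1)]]])
      show "norm (ph \<Phi> \<sigma> * osc \<Psi> s \<sigma>) \<le> \<tau>" if "\<sigma> \<in> {s..t} - {}" for \<sigma>
        using norm_osc_le_length[of s \<sigma> \<Psi>] that by (auto simp: norm_mult \<tau>_def)
    qed (use st in auto)
    then show ?thesis
      using pos by (auto simp: \<tau>_def intro: order_trans)
  qed
  have "norm (osc2 \<Phi> \<Psi> s t) \<le> 6 * (min \<tau> (1 / a) * min \<tau> (1 / b))"
    using 1 2 3 4 by (auto simp: min_def)
  also have "\<dots> \<le> 6 * ((\<tau> powr \<theta> * (1 / a) powr (1 - \<theta>)) * (\<tau> powr \<theta> * (1 / b) powr (1 - \<theta>)))"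
    using pos th by (intro mult_left_mono mult_mono min_le_powr) auto
  also have "\<dots> = 6 * (\<tau> powr \<theta> * \<tau> powr \<theta>) * ((1 / a) powr (1 - \<theta>) * (1 / b) powr (1 - \<theta>))"
    by (simp add: mult_ac)
  also have "\<tau> powr \<theta> * \<tau> powr \<theta> = \<tau> powr (2 * \<theta>)"
    by (simp add: powr_add[symmetric])
  also have "(1 / a) powr (1 - \<theta>) * (1 / b) powr (1 - \<theta>) = (a * b) powr (\<theta> - 1)"
    using pos powr_minus_divide[of "a * b" "1 - \<theta>"] by (simp add: powr_divide powr_mult)
  finally show ?thesis
    by (simp add: \<tau>_def a_def b_def)
qed

text \<open>The inner integral yields only the division by \<Psi>. Both remaining phases are at
  least |\<Phi> + \<Psi>|, and one oscillatory integral has to supply the power of t - s.\<close>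

lemma norm_osc2_near_resonant:
  assumes st: "s \<le> t" and nz: "\<Psi> \<noteq> 0" "\<Phi> \<noteq> 0" and near: "\<Phi> + \<Psi> \<noteq> 0" "2 * \<bar>\<Phi> + \<Psi>\<bar> < \<bar>\<Phi>\<bar>" and th: "0 \<le> \<theta>" "\<theta> \<le> 1"
  shows "norm (osc2 \<Phi> \<Psi> s t) \<le> 4 * (t - s) powr \<theta> * \<bar>\<Phi> + \<Psi>\<bar> powr (\<theta> - 1) / \<bar>\<Psi>\<bar>"
proof -
  have le: "\<bar>\<Phi> + \<Psi>\<bar> \<le> \<bar>\<Phi>\<bar>"
    by (rule order_trans[OF _ less_imp_le[OF near(2)]]) simp
  have "norm (osc \<Phi> s t) \<le> 2 * (t - s) powr \<theta> * \<bar>\<Phi>\<bar> powr (\<theta> - 1)"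
    using assms by (intro norm_osc_le) auto
  also have "\<dots> \<le> 2 * (t - s) powr \<theta> * \<bar>\<Phi> + \<Psi>\<bar> powr (\<theta> - 1)"
    using near(1) le th by (intro mult_left_mono powr_mono2') auto
  finally have "norm (osc \<Phi> s t) + norm (osc (\<Phi> + \<Psi>) s t) \<le> 4 * (t - s) powr \<theta> * \<bar>\<Phi> + \<Psi>\<bar> powr (\<theta> - 1)"
    using norm_osc_le[OF near(1) st th] by linarith
  from divide_right_mono[OF this, of "\<bar>\<Psi>\<bar>"] show ?thesis
    using norm_osc2_le1[OF nz(1), of \<Phi> s t] by linarith
qed

lemma norm_osc2_resonant:
  assumes "s \<le> t" "\<Psi> \<noteq> 0"
  shows "norm (osc2 \<Phi> \<Psi> s t) \<le> 2 * (t - s) / \<bar>\<Psi>\<bar>"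
  using order_trans[OF norm_osc2_le1[OF assms(2)] divide_right_mono[OF add_mono[OF norm_osc_le_length norm_osc_le_length]]] assms
  by simp

section \<open>Fourier kernels of X and X^2\<close>

definition Xker :: "real \<Rightarrow> real \<Rightarrow> int \<Rightarrow> int \<Rightarrow> complex" where
  "Xker t s k k1 = \<i> * of_int k / 2 * osc (3 * of_int (k * k1 * (k - k1))) s t"

text \<open>The quotient in \<open>Xop\<close> is the time integral of the kernel of the derivative
  of X. At k = 0 the exponentials cancel and both sides vanish.\<close>

lemma Xop_eq: "Xop t s \<phi> \<psi> k = (\<Sum>\<^sub>\<infinity>k1\<in>{k1. k1 \<noteq> 0 \<and> k1 \<noteq> k}. Xker t s k k1 * \<phi> k1 * \<psi> (k - k1))"
  unfolding Xop_def
proof (rule infsum_cong)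
  fix k1 assume "k1 \<in> {k1. k1 \<noteq> 0 \<and> k1 \<noteq> k}"
  then have k1: "of_int k1 \<noteq> (0::complex)" "of_int k - of_int k1 \<noteq> (0::complex)"
    by auto
  show "(exp (- 3 * \<i> * of_int (k * k1 * (k - k1)) * of_real s) - exp (- 3 * \<i> * of_int (k * k1 * (k - k1)) * of_real t))
      / of_int (6 * k1 * (k - k1)) * \<phi> k1 * \<psi> (k - k1) = Xker t s k k1 * \<phi> k1 * \<psi> (k - k1)"
  proof (cases "k = 0")
    case True
    then show ?thesis
      by (simp add: Xker_def)
  next
    case False
    then have "3 * real_of_int (k * k1 * (k - k1)) \<noteq> 0"
      using k1 by auto
    then have "Xker t s k k1 = (ph (3 * of_int (k * k1 * (k - k1))) s - ph (3 * of_int (k * k1 * (k - k1))) t) / of_int (6 * k1 * (k - k1))"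
      unfolding Xker_def osc_def using k1 False by (simp add: field_simps)
    then show ?thesis
      by (simp only: ph_int)
  qed
qed

definition X2ker :: "real \<Rightarrow> real \<Rightarrow> int \<Rightarrow> int \<Rightarrow> int \<Rightarrow> complex" where
  "X2ker t s k k1 k3 = 2 * (\<i> * of_int k / 2) * (\<i> * of_int (k - k1) / 2)
     * osc2 (3 * of_int (k * k1 * (k - k1))) (3 * of_int ((k - k1) * k3 * (k - k1 - k3))) s t"

definition X2idx :: "int \<Rightarrow> (int \<times> int) set" where
  "X2idx k = {(k1, k3). k1 \<noteq> 0 \<and> k1 \<noteq> k \<and> k3 \<noteq> 0 \<and> k3 \<noteq> k - k1}"

lemma X2op_eq:
  assumes st: "s \<le> t"
  shows "X2op t s \<phi> \<psi> \<xi> k =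
    infsum (\<lambda>j. X2ker t s k (fst j) (snd j) * \<phi> (fst j) * \<psi> (snd j) * \<xi> (k - fst j - snd j)) (X2idx k)"
  unfolding X2op_def X2idx_def
proof (rule infsum_cong, clarify)
  fix k1 k3 :: int assume k: "k1 \<noteq> 0" "k1 \<noteq> k" "k3 \<noteq> 0" "k3 \<noteq> k - k1"
  define \<Phi> \<Psi> where "\<Phi> = 3 * real_of_int (k * k1 * (k - k1))" and "\<Psi> = 3 * real_of_int ((k - k1) * k3 * (k - k1 - k3))"
  have nz: "\<Psi> \<noteq> 0"
    using k by (simp add: \<Psi>_def)
  define c :: complex where "c = (\<i> * of_int k / 2) * (\<i> * of_int (k - k1) / 2)"
  have inner: "sint s \<sigma> (\<lambda>\<sigma>1. (\<i> * of_int k / 2) * exp (- 3 * \<i> * of_int (k * k1 * (k - k1)) * of_real \<sigma>)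
           * (\<i> * of_int (k - k1) / 2) * exp (- 3 * \<i> * of_int ((k - k1) * k3 * (k - k1 - k3)) * of_real \<sigma>1))
      = c * (ph \<Phi> \<sigma> * osc \<Psi> s \<sigma>)" if "\<sigma> \<in> {s..t}" for \<sigma>
  proof -
    have "((\<lambda>\<sigma>1. (c * ph \<Phi> \<sigma>) * ph \<Psi> \<sigma>1) has_integral (c * ph \<Phi> \<sigma>) * osc \<Psi> s \<sigma>) {s..\<sigma>}"
      using that by (intro has_integral_mult_right osc_has_integral) auto
    then show ?thesis
      using that unfolding ph_int \<Phi>_def[symmetric] \<Psi>_def[symmetric] c_def sint_def
      by (auto simp: mult_ac dest!: integral_unique)
  qed
  have "((\<lambda>\<sigma>. c * (ph \<Phi> \<sigma> * osc \<Psi> s \<sigma>)) has_integral c * osc2 \<Phi> \<Psi> s t) {s..t}"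
    by (intro has_integral_mult_right osc2_has_integral st nz)
  then have outer: "integral {s..t} (\<lambda>\<sigma>. c * (ph \<Phi> \<sigma> * osc \<Psi> s \<sigma>)) = c * osc2 \<Phi> \<Psi> s t"
    by (rule integral_unique)
  have "sint s t (\<lambda>\<sigma>. sint s \<sigma> (\<lambda>\<sigma>1. (\<i> * of_int k / 2) * exp (- 3 * \<i> * of_int (k * k1 * (k - k1)) * of_real \<sigma>)
           * (\<i> * of_int (k - k1) / 2) * exp (- 3 * \<i> * of_int ((k - k1) * k3 * (k - k1 - k3)) * of_real \<sigma>1)))
      = c * osc2 \<Phi> \<Psi> s t"
    unfolding outer[symmetric] sint_def[of s t] if_P[OF st] by (intro integral_cong inner)
  then show "(let k2 = k - k1; k4 = k2 - k3 in
      2 * sint s t (\<lambda>\<sigma>. sint s \<sigma> (\<lambda>\<sigma>1.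
             (\<i> * of_int k / 2) * exp (- 3 * \<i> * of_int (k * k1 * k2) * of_real \<sigma>)
           * (\<i> * of_int k2 / 2) * exp (- 3 * \<i> * of_int (k2 * k3 * k4) * of_real \<sigma>1)))
        * \<phi> k1 * \<psi> k3 * \<xi> k4) =
      X2ker t s k (fst (k1, k3)) (snd (k1, k3)) * \<phi> (fst (k1, k3)) * \<psi> (snd (k1, k3)) * \<xi> (k - fst (k1, k3) - snd (k1, k3))"
    by (simp only: Let_def X2ker_def fst_conv snd_conv \<Phi>_def \<Psi>_def c_def mult.assoc)
qed

text \<open>Chen's relation for a single coefficient: cutting the triangle s \<le> \<sigma>1 \<le>
  \<sigma> \<le> t at \<open>m\<close> leaves two triangles and a rectangle, the latter with the
  factor 2 of X^2. The assumptions make the inner phase nonzero.\<close>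

lemma X2ker_chain:
  assumes "k1 \<noteq> k" "k3 \<noteq> 0" "k3 \<noteq> k - k1"
  shows "X2ker t s k k1 k3 = X2ker t m k k1 k3 + X2ker m s k k1 k3 + 2 * (Xker t m k k1 * Xker m s (k - k1) k3)"
proof -
  have "3 * real_of_int ((k - k1) * k3 * (k - k1 - k3)) \<noteq> 0"
    using assms by auto
  from osc2_chain[OF this, of "3 * of_int (k * k1 * (k - k1))" s t m] show ?thesis
    unfolding X2ker_def Xker_def by (simp only:) (simp only: distrib_left mult_ac add_ac)
qed

lemma Xker_chain: "Xker t s k k1 = Xker t m k k1 + Xker m s k k1"
  unfolding Xker_def osc_chain[of _ s t m] by (simp add: algebra_simps)

lemma Xker_commute: "Xker t s k (k - k1) = Xker t s k k1"
  by (simp add: Xker_def mult_ac)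

lemma abs_powr_le_jbr: "k \<noteq> 0 \<Longrightarrow> 0 \<le> e \<Longrightarrow> e \<le> 1 \<Longrightarrow> \<bar>real_of_int k\<bar> powr - e \<le> 2 * jbr k powr - e"
proof -
  assume k: "k \<noteq> 0" and e: "0 \<le> e" "e \<le> 1"
  have "\<bar>real_of_int k\<bar> powr - e \<le> (jbr k / 2) powr - e"
    using jbr_le_abs[OF k] e by (intro powr_mono2') auto
  also have "\<dots> = 2 powr e * jbr k powr - e"
    by (simp add: powr_divide powr_minus_divide)
  also have "\<dots> \<le> 2 powr 1 * jbr k powr - e"
    using e by (intro mult_right_mono powr_mono) auto
  finally show ?thesis
    by simp
qed

lemma abs_le_bikernel:
  assumes "k \<noteq> 0" "k1 \<noteq> 0" "k1 \<noteq> k" "0 \<le> \<gamma>" "\<gamma> \<le> 1"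
  shows "\<bar>real_of_int k\<bar> * (\<bar>real_of_int k\<bar> * \<bar>real_of_int k1\<bar> * \<bar>real_of_int (k - k1)\<bar>) powr (\<gamma> - 1)
    \<le> 4 * bikernel \<gamma> k k1"
proof -
  have "\<bar>real_of_int k\<bar> * (\<bar>real_of_int k\<bar> * \<bar>real_of_int k1\<bar> * \<bar>real_of_int (k - k1)\<bar>) powr (\<gamma> - 1)
    = (\<bar>real_of_int k\<bar> * \<bar>real_of_int k\<bar> powr (\<gamma> - 1)) * (\<bar>real_of_int k1\<bar> powr - (1 - \<gamma>) * \<bar>real_of_int (k - k1)\<bar> powr - (1 - \<gamma>))"
    by (simp add: powr_mult mult_ac)
  also have "\<bar>real_of_int k\<bar> * \<bar>real_of_int k\<bar> powr (\<gamma> - 1) = \<bar>real_of_int k\<bar> powr \<gamma>"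
    using assms by (simp add: powr_mult_base)
  also have "\<bar>real_of_int k\<bar> powr \<gamma> * (\<bar>real_of_int k1\<bar> powr - (1 - \<gamma>) * \<bar>real_of_int (k - k1)\<bar> powr - (1 - \<gamma>))
    \<le> jbr k powr \<gamma> * ((2 * jbr k1 powr - (1 - \<gamma>)) * (2 * jbr (k - k1) powr - (1 - \<gamma>)))"
    using assms by (intro mult_mono powr_mono2 abs_le_jbr abs_powr_le_jbr) auto
  finally show ?thesis
    by (simp add: bikernel_def)
qed

lemma Xker_bound:
  assumes k1: "k1 \<noteq> 0" "k1 \<noteq> k" and st: "s \<le> t" and g: "0 \<le> \<gamma>" "\<gamma> \<le> 1"
  shows "norm (Xker t s k k1) \<le> 4 * (t - s) powr \<gamma> * bikernel \<gamma> k k1"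
proof (cases "k = 0")
  case True
  then show ?thesis
    by (simp add: Xker_def)
next
  case False
  define y where "y = \<bar>real_of_int k\<bar> * \<bar>real_of_int k1\<bar> * \<bar>real_of_int (k - k1)\<bar>"
  have ph: "\<bar>3 * real_of_int (k * k1 * (k - k1))\<bar> = 3 * y"
    by (simp add: y_def abs_mult)
  have y: "y > 0"
    using False k1 by (simp add: y_def)
  have "norm (Xker t s k k1) = \<bar>real_of_int k\<bar> / 2 * norm (osc (3 * of_int (k * k1 * (k - k1))) s t)"
    by (simp add: Xker_def norm_mult norm_divide)
  also have "\<dots> \<le> \<bar>real_of_int k\<bar> / 2 * (2 * (t - s) powr \<gamma> * \<bar>3 * real_of_int (k * k1 * (k - k1))\<bar> powr (\<gamma> - 1))"
    using False k1 st g by (intro mult_left_mono norm_osc_le) auto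
  also have "\<dots> = (t - s) powr \<gamma> * (\<bar>real_of_int k\<bar> * (3 * y) powr (\<gamma> - 1))"
    unfolding ph by simp
  also have "\<dots> \<le> (t - s) powr \<gamma> * (\<bar>real_of_int k\<bar> * y powr (\<gamma> - 1))"
    using y g by (intro mult_left_mono powr_mono2') auto
  also have "\<dots> \<le> (t - s) powr \<gamma> * (4 * bikernel \<gamma> k k1)"
    unfolding y_def using False k1 g by (intro mult_left_mono abs_le_bikernel) auto
  finally show ?thesis
    by simp
qed

lemma abs_near:
  fixes x y :: real
  assumes "2 * \<bar>x + y\<bar> < \<bar>x\<bar>"
  shows "\<bar>x\<bar> \<le> 2 * \<bar>y\<bar>" "2 * \<bar>y\<bar> \<le> 3 * \<bar>x\<bar>"
  using assms by (auto simp: abs_if split: if_splits)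

section \<open>Pointwise bounds for the kernel of X^2\<close>

context exponents
begin

text \<open>The exponents balance exactly: (1 + 2\<alpha>) + 3 (1 - 2\<gamma>) = 2 z. As
  \<open>a\<close> is dominated by \<kappa>1 and b, its exponent can be raised to z at their
  expense, and the smallest of the other three takes the second z.\<close>

lemma near_resonant_weight_aux:
  fixes \<kappa>1 \<kappa>2 a b :: real
  assumes "1 \<le> \<kappa>1" "1 \<le> \<kappa>2" "1 \<le> a" "a \<le> b" "a \<le> 3 * \<kappa>1"
  shows "\<kappa>1 powr - (1 + 2 * \<alpha>) * (\<kappa>2 * a * b) powr - (1 - 2 * \<gamma>)
    \<le> 3 powr z * (a powr - z * \<kappa>1 powr - z + a powr - z * \<kappa>2 powr - z + a powr - z * b powr - z)"
proof -
  define l where "l = 1 - 2 * \<gamma>"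
  have l: "0 \<le> l" "0 \<le> z - l" "z > 0" "1 + 2 * \<alpha> + l = (z - l) + (z - l)" "0 \<le> 1 + 2 * \<alpha>"
    using alpha gamma by (auto simp: l_def z_def)
  have a3: "(a / 3) powr - e = 3 powr e * a powr - e" for e
    using assms by (simp add: powr_divide powr_minus_divide)
  \<comment> \<open>\<kappa>1 and b together hold the exponent 2 (z - l). Once both are replaced by
    \<open>m\<close>, one half passes to a / 3 \<le> m and the other to \<open>r\<close>.\<close>
  define m where "m = min \<kappa>1 b"
  define r where "r = min m \<kappa>2"
  have m: "1 \<le> m" "m \<le> \<kappa>1" "m \<le> b" "a / 3 \<le> m"
    using assms by (auto simp: m_def)
  have r: "1 \<le> r" "r \<le> m" "r \<le> \<kappa>2"
    using m assms by (auto simp: r_def)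
  have "\<kappa>1 powr - (1 + 2 * \<alpha>) * (\<kappa>2 * a * b) powr - l
    = (\<kappa>1 powr - (1 + 2 * \<alpha>) * b powr - l) * \<kappa>2 powr - l * a powr - l"
    using assms by (simp add: powr_mult mult_ac)
  also have "\<dots> \<le> (m powr - (1 + 2 * \<alpha>) * m powr - l) * r powr - l * a powr - l"
    using m r l assms by (intro mult_mono mult_nonneg_nonneg powr_mono2') auto
  also have "m powr - (1 + 2 * \<alpha>) * m powr - l = m powr - (z - l) * m powr - (z - l)"
    unfolding powr_add[symmetric] using l(4) by (intro arg_cong2[where f = "(powr)"]) auto
  also have "\<dots> * r powr - l * a powr - l \<le> ((a / 3) powr - (z - l) * r powr - (z - l)) * r powr - l * a powr - l"
    using m r l assms by (intro mult_right_mono mult_mono powr_mono2') auto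
  also have "\<dots> = 3 powr (z - l) * (a powr - (z - l) * a powr - l) * (r powr - (z - l) * r powr - l)"
    using a3[of "z - l"] by simp
  also have "\<dots> = 3 powr (z - l) * (a powr - z * r powr - z)"
    unfolding powr_add[symmetric] by simp
  also have "\<dots> \<le> 3 powr z * (a powr - z * r powr - z)"
    using l by (intro mult_right_mono powr_mono) auto
  also have "r powr - z \<le> \<kappa>1 powr - z + \<kappa>2 powr - z + b powr - z"
    by (auto simp: r_def m_def min_def)
  then have "3 powr z * (a powr - z * r powr - z) \<le> 3 powr z * (a powr - z * (\<kappa>1 powr - z + \<kappa>2 powr - z + b powr - z))"
    by (intro mult_left_mono) auto
  finally show ?thesis
    by (simp add: l_def distrib_left)
qed

lemma near_resonant_weight:
  fixes \<kappa>1 \<kappa>2 a b :: real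
  assumes "1 \<le> \<kappa>1" "1 \<le> \<kappa>2" "1 \<le> a" "1 \<le> b" "min a b \<le> 3 * \<kappa>1"
  shows "\<kappa>1 powr - (1 + 2 * \<alpha>) * (\<kappa>2 * a * b) powr - (1 - 2 * \<gamma>)
    \<le> 3 powr z * (a powr - z * \<kappa>1 powr - z + a powr - z * \<kappa>2 powr - z + a powr - z * b powr - z
        + b powr - z * \<kappa>1 powr - z + b powr - z * \<kappa>2 powr - z)"
proof (cases "a \<le> b")
  case True
  have "\<kappa>1 powr - (1 + 2 * \<alpha>) * (\<kappa>2 * a * b) powr - (1 - 2 * \<gamma>)
    \<le> 3 powr z * (a powr - z * \<kappa>1 powr - z + a powr - z * \<kappa>2 powr - z + a powr - z * b powr - z)"
    using True assms by (intro near_resonant_weight_aux) auto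
  also have "\<dots> \<le> 3 powr z * (a powr - z * \<kappa>1 powr - z + a powr - z * \<kappa>2 powr - z + a powr - z * b powr - z
        + b powr - z * \<kappa>1 powr - z + b powr - z * \<kappa>2 powr - z)"
    by (intro mult_left_mono) auto
  finally show ?thesis .
next
  case False
  have "\<kappa>1 powr - (1 + 2 * \<alpha>) * (\<kappa>2 * b * a) powr - (1 - 2 * \<gamma>)
    \<le> 3 powr z * (b powr - z * \<kappa>1 powr - z + b powr - z * \<kappa>2 powr - z + b powr - z * a powr - z)"
    using False assms by (intro near_resonant_weight_aux) auto
  also have "\<dots> \<le> 3 powr z * (a powr - z * \<kappa>1 powr - z + a powr - z * \<kappa>2 powr - z + a powr - z * b powr - z
        + b powr - z * \<kappa>1 powr - z + b powr - z * \<kappa>2 powr - z)"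
    by (intro mult_left_mono) (auto simp: mult_ac)
  finally show ?thesis
    by (simp add: mult_ac)
qed

text \<open>The pairs of \<open>near_resonant_weight\<close> with a = U = k - k3, b = W = k1 + k3,
  \<kappa>1 = k1 and \<kappa>2 = k - k1. Given k, each pair determines (k1, k3); the pair of k1 and
  k - k1 would not, and does not occur.\<close>

definition near_weight :: "int \<Rightarrow> int \<times> int \<Rightarrow> real" where
  "near_weight k j =
     pair_weight (\<lambda>k j. k - snd j) (\<lambda>k j. fst j) k j + pair_weight (\<lambda>k j. k - snd j) (\<lambda>k j. k - fst j) k j
     + pair_weight (\<lambda>k j. k - snd j) (\<lambda>k j. fst j + snd j) k j
     + pair_weight (\<lambda>k j. fst j + snd j) (\<lambda>k j. fst j) k j + pair_weight (\<lambda>k j. fst j + snd j) (\<lambda>k j. k - fst j) k j"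

lemma near_weight_nonneg [simp]: "0 \<le> near_weight k j"
  by (simp add: near_weight_def)

text \<open>Since \<open>|k\<^sub>3 k\<^sub>4|\<close> and \<open>|k k\<^sub>1|\<close> are comparable, the weights at \<open>k\<close>, \<open>k\<^sub>3\<close>, \<open>k\<^sub>4\<close> combine to one at \<open>k\<^sub>1\<close>;
  moreover the smaller of \<open>U\<close>, \<open>W\<close> cannot exceed a multiple of \<open>k\<^sub>1\<close>.\<close>

lemma near_weight_ge:
  fixes k k1 k3 :: int
  defines "k2 \<equiv> k - k1" and "k4 \<equiv> k - k1 - k3" and "U \<equiv> k - k3" and "W \<equiv> k1 + k3"
  assumes nz: "k \<noteq> 0" "k1 \<noteq> 0" "k2 \<noteq> 0" "k3 \<noteq> 0" "k4 \<noteq> 0" "U \<noteq> 0" "W \<noteq> 0"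
    and near: "2 * (\<bar>real_of_int U\<bar> * \<bar>real_of_int W\<bar>) < \<bar>real_of_int k\<bar> * \<bar>real_of_int k1\<bar>"
    and lo: "\<bar>real_of_int k\<bar> * \<bar>real_of_int k1\<bar> \<le> 2 * (\<bar>real_of_int k3\<bar> * \<bar>real_of_int k4\<bar>)"
    and hi: "2 * (\<bar>real_of_int k3\<bar> * \<bar>real_of_int k4\<bar>) \<le> 3 * (\<bar>real_of_int k\<bar> * \<bar>real_of_int k1\<bar>)"
  shows "\<bar>real_of_int k\<bar> / (\<bar>real_of_int k3\<bar> * \<bar>real_of_int k4\<bar>) *
      (\<bar>real_of_int k2\<bar> * \<bar>real_of_int U\<bar> * \<bar>real_of_int W\<bar>) powr - (1 - 2 * \<gamma>)
    \<le> 32 * 8 powr \<bar>\<alpha>\<bar> * 3 powr z * near_weight k (k1, k3)"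
proof -
  have jb: "\<bar>real_of_int l\<bar> \<le> jbr l" "jbr l \<le> 2 * \<bar>real_of_int l\<bar>" "0 < \<bar>real_of_int l\<bar>" if "l \<noteq> 0" for l
    using abs_le_jbr[of l] jbr_le_abs[of l] that by auto
  note j0 = jb[OF nz(1)] and j1 = jb[OF nz(2)] and j2 = jb[OF nz(3)] and j3 = jb[OF nz(4)]
    and j4 = jb[OF nz(5)] and jU = jb[OF nz(6)] and jW = jb[OF nz(7)]
  have l: "0 \<le> 1 - 2 * \<gamma>" "1 - 2 * \<gamma> \<le> 1"
    using gamma by auto
  \<comment> \<open>As k = U + W - k1, if |U| and |W| both exceeded 3/2 |k1|, then |k k1| would be
    at most 3 |k1| max(|U|, |W|), hence at most 2 |U W|, against \<open>near\<close>.\<close>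
  have small: "min (jbr U) (jbr W) \<le> 3 * jbr k1"
  proof (rule ccontr)
    define x where "x = \<bar>real_of_int k1\<bar>"
    define a b where "a = min \<bar>real_of_int U\<bar> \<bar>real_of_int W\<bar>" and "b = max \<bar>real_of_int U\<bar> \<bar>real_of_int W\<bar>"
    assume "\<not> min (jbr U) (jbr W) \<le> 3 * jbr k1"
    then have "jbr U > 3 * jbr k1" "jbr W > 3 * jbr k1"
      by auto
    then have "3 * x < 2 * \<bar>real_of_int U\<bar>" "3 * x < 2 * \<bar>real_of_int W\<bar>"
      using jU jW j1 unfolding x_def by linarith+
    then have a: "2 * a > 3 * x" "a \<le> b"
      by (auto simp: a_def b_def min_def max_def)
    have x: "x > 0"
      using j1 by (simp add: x_def)
    have "real_of_int k = real_of_int U + real_of_int W - real_of_int k1"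
      by (simp add: U_def W_def)
    then have "\<bar>real_of_int k\<bar> \<le> a + b + x"
      by (auto simp: a_def b_def x_def min_def max_def)
    then have "\<bar>real_of_int k\<bar> * x \<le> (a + b + x) * x"
      using x by (intro mult_right_mono) auto
    moreover have "\<bar>real_of_int U\<bar> * \<bar>real_of_int W\<bar> = a * b"
      by (auto simp: a_def b_def min_def max_def)
    ultimately have "2 * (a * b) < (a + b + x) * x"
      using near by (simp add: x_def)
    moreover have "(a + b + x) * x \<le> (3 * b) * x"
      using a x by (intro mult_right_mono) auto
    moreover have "(3 * x) * b \<le> (2 * a) * b"
      using a x by (intro mult_right_mono) auto
    ultimately show False
      by (simp add: mult_ac)
  qed
  have "\<bar>real_of_int k\<bar> / (\<bar>real_of_int k3\<bar> * \<bar>real_of_int k4\<bar>) \<le> 2 / \<bar>real_of_int k1\<bar>"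
    using lo j1 j3 j4 by (simp add: field_simps)
  also have "\<dots> \<le> 4 * jbr k1 powr - 1"
    using j1 by (simp add: powr_minus_divide field_simps)
  finally have 1: "\<bar>real_of_int k\<bar> / (\<bar>real_of_int k3\<bar> * \<bar>real_of_int k4\<bar>) \<le> 4 * jbr k1 powr - 1" .
  have "(\<bar>real_of_int k2\<bar> * \<bar>real_of_int U\<bar> * \<bar>real_of_int W\<bar>) powr - (1 - 2 * \<gamma>)
    = \<bar>real_of_int k2\<bar> powr - (1 - 2 * \<gamma>) * \<bar>real_of_int U\<bar> powr - (1 - 2 * \<gamma>) * \<bar>real_of_int W\<bar> powr - (1 - 2 * \<gamma>)"
    by (simp add: powr_mult)
  also have "\<dots> \<le> (2 * jbr k2 powr - (1 - 2 * \<gamma>)) * (2 * jbr U powr - (1 - 2 * \<gamma>)) * (2 * jbr W powr - (1 - 2 * \<gamma>))"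
    using l nz by (intro mult_mono abs_powr_le_jbr) auto
  also have "\<dots> = 8 * (jbr k2 * jbr U * jbr W) powr - (1 - 2 * \<gamma>)"
    by (simp add: powr_mult)
  finally have 2: "(\<bar>real_of_int k2\<bar> * \<bar>real_of_int U\<bar> * \<bar>real_of_int W\<bar>) powr - (1 - 2 * \<gamma>)
    \<le> 8 * (jbr k2 * jbr U * jbr W) powr - (1 - 2 * \<gamma>)" .
  define \<Sigma> where "\<Sigma> = jbr U powr - z * jbr k1 powr - z + jbr U powr - z * jbr k2 powr - z + jbr U powr - z * jbr W powr - z
        + jbr W powr - z * jbr k1 powr - z + jbr W powr - z * jbr k2 powr - z"
  have \<Sigma>: "0 \<le> \<Sigma>"
    by (simp add: \<Sigma>_def)
  have 3: "jbr k1 powr - (1 + 2 * \<alpha>) * (jbr k2 * jbr U * jbr W) powr - (1 - 2 * \<gamma>) \<le> 3 powr z * \<Sigma>"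
    unfolding \<Sigma>_def by (intro near_resonant_weight jbr_ge_1 small)
  \<comment> \<open>The comparison is two-sided because \<alpha> may have either sign. Brackets cost
    a factor 4, and \<open>hi\<close> and \<open>lo\<close> cost 3/2 and 2, whence 6 and 8.\<close>
  have cmp: "(jbr k * jbr k1) powr \<alpha> \<le> 8 powr \<bar>\<alpha>\<bar> * (jbr k3 * jbr k4) powr \<alpha>"
  proof (rule powr_comparable)
    have "jbr k3 * jbr k4 \<le> (2 * \<bar>real_of_int k3\<bar>) * (2 * \<bar>real_of_int k4\<bar>)"
      using j3 j4 by (intro mult_mono) auto
    also have "\<dots> \<le> 6 * (\<bar>real_of_int k\<bar> * \<bar>real_of_int k1\<bar>)"
      using hi by simp
    also have "\<dots> \<le> 6 * (jbr k * jbr k1)"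
      using j0 j1 by (intro mult_left_mono mult_mono) auto
    also have "\<dots> \<le> 8 * (jbr k * jbr k1)"
      by (intro mult_right_mono) auto
    finally show "jbr k3 * jbr k4 \<le> 8 * (jbr k * jbr k1)" .
    have "jbr k * jbr k1 \<le> (2 * \<bar>real_of_int k\<bar>) * (2 * \<bar>real_of_int k1\<bar>)"
      using j0 j1 by (intro mult_mono) auto
    also have "\<dots> \<le> 8 * (\<bar>real_of_int k3\<bar> * \<bar>real_of_int k4\<bar>)"
      using lo by simp
    also have "\<dots> \<le> 8 * (jbr k3 * jbr k4)"
      using j3 j4 by (intro mult_left_mono mult_mono) auto
    finally show "jbr k * jbr k1 \<le> 8 * (jbr k3 * jbr k4)" .
  qed auto
  have 4: "jbr k1 powr (2 * \<alpha>) \<le> 8 powr \<bar>\<alpha>\<bar> * (jbr k powr - \<alpha> * (jbr k1 powr \<alpha> * jbr k3 powr \<alpha> * jbr k4 powr \<alpha>))"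
  proof -
    have "jbr k1 powr (2 * \<alpha>) = (jbr k powr - \<alpha> * jbr k powr \<alpha>) * jbr k1 powr \<alpha> * jbr k1 powr \<alpha>"
      unfolding powr_add[symmetric] by (simp add: powr_add[symmetric])
    also have "\<dots> = jbr k powr - \<alpha> * jbr k1 powr \<alpha> * (jbr k * jbr k1) powr \<alpha>"
      by (simp add: powr_mult mult_ac)
    also have "\<dots> \<le> jbr k powr - \<alpha> * jbr k1 powr \<alpha> * (8 powr \<bar>\<alpha>\<bar> * (jbr k3 * jbr k4) powr \<alpha>)"
      by (intro mult_left_mono cmp) auto
    finally show ?thesis
      by (simp add: powr_mult mult_ac)
  qed
  have "\<bar>real_of_int k\<bar> / (\<bar>real_of_int k3\<bar> * \<bar>real_of_int k4\<bar>) *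
      (\<bar>real_of_int k2\<bar> * \<bar>real_of_int U\<bar> * \<bar>real_of_int W\<bar>) powr - (1 - 2 * \<gamma>)
    \<le> (4 * jbr k1 powr - 1) * (8 * (jbr k2 * jbr U * jbr W) powr - (1 - 2 * \<gamma>))"
    by (intro mult_mono 1 2) auto
  \<comment> \<open>The factor <k1>^(2\<alpha>) is split off to create the powers of order \<alpha>
    in \<open>pair_weight\<close>; the rest is what \<open>near_resonant_weight\<close>
    bounds.\<close>
  also have "jbr k1 powr - 1 = jbr k1 powr (2 * \<alpha>) * jbr k1 powr - (1 + 2 * \<alpha>)"
    unfolding powr_add[symmetric] by simp
  also have "(4 * (jbr k1 powr (2 * \<alpha>) * jbr k1 powr - (1 + 2 * \<alpha>))) * (8 * (jbr k2 * jbr U * jbr W) powr - (1 - 2 * \<gamma>))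
    = 32 * jbr k1 powr (2 * \<alpha>) * (jbr k1 powr - (1 + 2 * \<alpha>) * (jbr k2 * jbr U * jbr W) powr - (1 - 2 * \<gamma>))"
    by (simp add: mult_ac)
  also have "\<dots> \<le> 32 * (8 powr \<bar>\<alpha>\<bar> * (jbr k powr - \<alpha> * (jbr k1 powr \<alpha> * jbr k3 powr \<alpha> * jbr k4 powr \<alpha>))) * (3 powr z * \<Sigma>)"
    using \<Sigma> by (intro mult_mono 3 4) auto
  also have "\<dots> = 32 * 8 powr \<bar>\<alpha>\<bar> * 3 powr z * near_weight k (k1, k3)"
    by (simp add: near_weight_def pair_weight_def \<Sigma>_def U_def W_def k2_def k4_def algebra_simps)
  finally show ?thesis .
qed

text \<open>The regimes are added instead of selected, so that each can be summed over all indices.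
  The last two terms are the zeros of k - k3 and k1 + k3, where the phases cancel.\<close>

definition X2weight :: "int \<Rightarrow> int \<times> int \<Rightarrow> real" where
  "X2weight k j = bikernel \<gamma> k (fst j) * bikernel \<gamma> (k - fst j) (snd j) + near_weight k j
     + ((if snd j = k then 1 / jbr (fst j) else 0) + (if snd j = - fst j then 1 / jbr (fst j) else 0))"

lemma X2weight_nonneg [simp]: "0 \<le> X2weight k j"
  by (simp add: X2weight_def)

lemma X2ker_bound:
  obtains C where "C > 0" "\<And>s t k j. j \<in> X2idx k \<Longrightarrow> s \<le> t \<Longrightarrow> t - s \<le> T \<Longrightarrow>
    norm (X2ker t s k (fst j) (snd j)) \<le> C * (t - s) powr (2 * \<gamma>) * X2weight k j"
proof -
  \<comment> \<open>One summand per regime: 48 = 3 * 4 * 4 from two uses of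
    \<open>abs_le_bikernel\<close>, the constant of \<open>near_weight_ge\<close>, and the price of
    turning t - s into (t - s)^(2\<gamma>) on intervals of length at most \<open>T\<close>.\<close>
  define C where "C = 48 + 32 * 8 powr \<bar>\<alpha>\<bar> * 3 powr z + 2 * \<bar>T\<bar> powr (1 - 2 * \<gamma>)"
  have C: "48 \<le> C" "32 * 8 powr \<bar>\<alpha>\<bar> * 3 powr z \<le> C" "2 * \<bar>T\<bar> powr (1 - 2 * \<gamma>) \<le> C" "C > 0"
    by (auto simp: C_def add_pos_nonneg)
  show ?thesis
  proof (rule that[OF C(4)])
    fix s t :: real and k :: int and j :: "int \<times> int"
    assume j: "j \<in> X2idx k" and st: "s \<le> t" "t - s \<le> T"
    define k1 k3 k2 k4 where "k1 = fst j" and "k3 = snd j" and "k2 = k - k1" and "k4 = k - k1 - k3"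
    define U W where "U = k - k3" and "W = k1 + k3"
    have jeq: "j = (k1, k3)"
      by (simp add: k1_def k3_def)
    have nz: "k1 \<noteq> 0" "k2 \<noteq> 0" "k3 \<noteq> 0" "k4 \<noteq> 0" "k1 \<noteq> k" "k3 \<noteq> k2"
      using j by (auto simp: X2idx_def jeq k2_def k4_def)
    define \<Phi> \<Psi> where "\<Phi> = 3 * real_of_int (k * k1 * k2)" and "\<Psi> = 3 * real_of_int (k2 * k3 * k4)"
    have nm: "norm (X2ker t s k k1 k3) = \<bar>real_of_int k\<bar> * \<bar>real_of_int k2\<bar> / 2 * norm (osc2 \<Phi> \<Psi> s t)"
    proof -
      have eq: "X2ker t s k k1 k3 = 2 * (\<i> * of_int k / 2) * (\<i> * of_int k2 / 2) * osc2 \<Phi> \<Psi> s t"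
        by (simp only: X2ker_def \<Phi>_def \<Psi>_def k2_def k4_def)
      show ?thesis
        unfolding eq by (simp add: norm_mult norm_divide)
    qed
    have Psi: "\<Psi> \<noteq> 0" "\<bar>\<Psi>\<bar> = 3 * (\<bar>real_of_int k2\<bar> * (\<bar>real_of_int k3\<bar> * \<bar>real_of_int k4\<bar>))"
      using nz by (auto simp: \<Psi>_def abs_mult)
    have sum: "\<Phi> + \<Psi> = 3 * real_of_int (k2 * U * W)"
    proof -
      have "k * k1 * k2 + k2 * k3 * k4 = k2 * U * W"
        by (simp add: k2_def k4_def U_def W_def algebra_simps)
      then have "real_of_int (k * k1 * k2) + real_of_int (k2 * k3 * k4) = real_of_int (k2 * U * W)"
        unfolding of_int_add[symmetric] by (rule arg_cong)
      then show ?thesis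
        unfolding \<Phi>_def \<Psi>_def by linarith
    qed
    define w where "w = X2weight k j"
    have w: "bikernel \<gamma> k k1 * bikernel \<gamma> k2 k3 \<le> w" "near_weight k (k1, k3) \<le> w"
      "U = 0 \<or> W = 0 \<Longrightarrow> 1 / jbr k1 \<le> w"
      by (auto simp: w_def X2weight_def jeq k2_def U_def W_def add_eq_0_iff)
    have w0: "0 \<le> w"
      by (simp add: w_def)
    have p: "0 \<le> (t - s) powr (2 * \<gamma>)"
      by simp
    have fin: "D * (t - s) powr (2 * \<gamma>) * v \<le> C * (t - s) powr (2 * \<gamma>) * w" if "0 \<le> v" "v \<le> w" "D \<le> C" for D v
      using that C by (intro mult_mono mult_right_mono) auto
    have "norm (X2ker t s k k1 k3) \<le> C * (t - s) powr (2 * \<gamma>) * w"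
    proof (cases "k = 0")
      case True
      then have "norm (X2ker t s k k1 k3) = 0"
        unfolding nm by simp
      then show ?thesis
        using C w0 by simp
    next
      case k: False
      have Phi: "\<Phi> \<noteq> 0" "\<bar>\<Phi>\<bar> = 3 * (\<bar>real_of_int k2\<bar> * (\<bar>real_of_int k\<bar> * \<bar>real_of_int k1\<bar>))"
        using nz k by (auto simp: \<Phi>_def abs_mult)
      have pos: "0 < \<bar>real_of_int k\<bar>" "0 < \<bar>real_of_int k1\<bar>" "0 < \<bar>real_of_int k2\<bar>"
        "0 < \<bar>real_of_int k3\<bar>" "0 < \<bar>real_of_int k4\<bar>"
        using nz k by auto
      consider "\<bar>\<Phi>\<bar> \<le> 2 * \<bar>\<Phi> + \<Psi>\<bar>" | "\<Phi> + \<Psi> = 0" | "\<Phi> + \<Psi> \<noteq> 0" "2 * \<bar>\<Phi> + \<Psi>\<bar> < \<bar>\<Phi>\<bar>"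
        by linarith
      then show ?thesis
      proof cases
        case 1
        define x y where "x = \<bar>real_of_int k\<bar> * \<bar>real_of_int k1\<bar> * \<bar>real_of_int (k - k1)\<bar>"
          and "y = \<bar>real_of_int k2\<bar> * \<bar>real_of_int k3\<bar> * \<bar>real_of_int (k2 - k3)\<bar>"
        have k4: "k2 - k3 = k4"
          by (simp add: k2_def k4_def)
        have xy: "0 < x" "0 < y" "\<bar>\<Phi>\<bar> = 3 * x" "\<bar>\<Psi>\<bar> = 3 * y"
          using pos nz unfolding x_def y_def k4 Phi Psi k2_def[symmetric] by auto
        have "(\<bar>\<Phi>\<bar> * \<bar>\<Psi>\<bar>) powr (\<gamma> - 1) \<le> (x * y) powr (\<gamma> - 1)"
          unfolding xy using xy(1,2) gamma by (intro powr_mono2') auto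
        also have "\<dots> = x powr (\<gamma> - 1) * y powr (\<gamma> - 1)"
          using xy by (simp add: powr_mult)
        finally have le: "(\<bar>\<Phi>\<bar> * \<bar>\<Psi>\<bar>) powr (\<gamma> - 1) \<le> x powr (\<gamma> - 1) * y powr (\<gamma> - 1)" .
        have "norm (X2ker t s k k1 k3)
          \<le> \<bar>real_of_int k\<bar> * \<bar>real_of_int k2\<bar> / 2 * (6 * (t - s) powr (2 * \<gamma>) * (\<bar>\<Phi>\<bar> * \<bar>\<Psi>\<bar>) powr (\<gamma> - 1))"
          unfolding nm using 1 Phi Psi st gamma by (intro mult_left_mono norm_osc2_nonresonant) auto
        also have "\<dots> \<le> \<bar>real_of_int k\<bar> * \<bar>real_of_int k2\<bar> / 2 * (6 * (t - s) powr (2 * \<gamma>) * (x powr (\<gamma> - 1) * y powr (\<gamma> - 1)))"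
          by (intro mult_left_mono le) auto
        also have "\<dots> = 3 * (t - s) powr (2 * \<gamma>) * ((\<bar>real_of_int k\<bar> * x powr (\<gamma> - 1)) * (\<bar>real_of_int k2\<bar> * y powr (\<gamma> - 1)))"
          by simp
        also have "\<dots> \<le> 3 * (t - s) powr (2 * \<gamma>) * ((4 * bikernel \<gamma> k k1) * (4 * bikernel \<gamma> k2 k3))"
          unfolding x_def y_def using k nz gamma
          by (intro mult_left_mono mult_mono abs_le_bikernel) auto
        also have "\<dots> = 48 * (t - s) powr (2 * \<gamma>) * (bikernel \<gamma> k k1 * bikernel \<gamma> k2 k3)"
          by simp
        also have "\<dots> \<le> C * (t - s) powr (2 * \<gamma>) * w"
          by (intro fin w C) auto
        finally show ?thesis .
      next
        case 2
        then have "k2 * U * W = 0"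
          unfolding sum by (metis mult_eq_0_iff of_int_eq_0_iff zero_neq_numeral)
        then have UW: "U = 0 \<or> W = 0"
          using nz by auto
        \<comment> \<open>Hence |k3 k4| = |k k1|: the factors |k| and |k2| of the kernel cancel
          against \<Psi>, and only 1/|k1| remains.\<close>
        then have "k3 = k \<and> k4 = - k1 \<or> k3 = - k1 \<and> k4 = k"
          by (auto simp: U_def W_def k4_def)
        then have kk: "\<bar>real_of_int k3\<bar> * \<bar>real_of_int k4\<bar> = \<bar>real_of_int k\<bar> * \<bar>real_of_int k1\<bar>"
          by auto
        have tau: "t - s \<le> (t - s) powr (2 * \<gamma>) * \<bar>T\<bar> powr (1 - 2 * \<gamma>)"
        proof -
          have "t - s = (t - s) powr (2 * \<gamma>) * (t - s) powr (1 - 2 * \<gamma>)"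
            using st by (cases "s = t") (auto simp: powr_add[symmetric])
          also have "\<dots> \<le> (t - s) powr (2 * \<gamma>) * \<bar>T\<bar> powr (1 - 2 * \<gamma>)"
            using st gamma by (intro mult_left_mono powr_mono2) auto
          finally show ?thesis .
        qed
        have j1: "1 / \<bar>real_of_int k1\<bar> \<le> 2 * (1 / jbr k1)"
          using jbr_le_abs[OF nz(1)] pos by (simp add: field_simps)
        have "norm (X2ker t s k k1 k3) \<le> \<bar>real_of_int k\<bar> * \<bar>real_of_int k2\<bar> / 2 * (2 * (t - s) / \<bar>\<Psi>\<bar>)"
          unfolding nm using st Psi by (intro mult_left_mono norm_osc2_resonant) auto
        also have "\<dots> = (t - s) / 3 * (1 / \<bar>real_of_int k1\<bar>)"
          unfolding Psi(2) kk using pos by (simp add: field_simps)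
        also have "\<dots> \<le> (t - s) * (2 * (1 / jbr k1))"
          using st by (intro mult_mono j1) auto
        also have "\<dots> \<le> ((t - s) powr (2 * \<gamma>) * \<bar>T\<bar> powr (1 - 2 * \<gamma>)) * (2 * (1 / jbr k1))"
          by (intro mult_right_mono tau) auto
        also have "\<dots> = (2 * \<bar>T\<bar> powr (1 - 2 * \<gamma>)) * (t - s) powr (2 * \<gamma>) * (1 / jbr k1)"
          by simp
        also have "\<dots> \<le> C * (t - s) powr (2 * \<gamma>) * w"
          by (intro fin w C UW) auto
        finally show ?thesis .
      next
        case 3
        have UW: "U \<noteq> 0" "W \<noteq> 0"
          using 3(1) unfolding sum by auto
        have sum': "\<bar>\<Phi> + \<Psi>\<bar> = 3 * (\<bar>real_of_int k2\<bar> * (\<bar>real_of_int U\<bar> * \<bar>real_of_int W\<bar>))"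
          unfolding sum by (simp add: abs_mult)
        define q where "q = \<bar>real_of_int k2\<bar> * \<bar>real_of_int U\<bar> * \<bar>real_of_int W\<bar>"
        have q: "0 < q" "\<bar>\<Phi> + \<Psi>\<bar> = 3 * q"
          using pos UW by (auto simp: q_def sum')
        have lohi: "\<bar>\<Phi>\<bar> \<le> 2 * \<bar>\<Psi>\<bar>" "2 * \<bar>\<Psi>\<bar> \<le> 3 * \<bar>\<Phi>\<bar>"
          using abs_near[OF 3(2)] by auto
        have key: "\<bar>real_of_int k\<bar> / (\<bar>real_of_int k3\<bar> * \<bar>real_of_int k4\<bar>) * q powr - (1 - 2 * \<gamma>)
          \<le> 32 * 8 powr \<bar>\<alpha>\<bar> * 3 powr z * near_weight k (k1, k3)"
          unfolding q_def U_def W_def k2_def k4_def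
        proof (rule near_weight_ge)
          show "2 * (\<bar>real_of_int (k - k3)\<bar> * \<bar>real_of_int (k1 + k3)\<bar>) < \<bar>real_of_int k\<bar> * \<bar>real_of_int k1\<bar>"
            using 3(2) pos unfolding sum' Phi(2) U_def[symmetric] W_def[symmetric]
            by (simp add: mult_ac)
          show "\<bar>real_of_int k\<bar> * \<bar>real_of_int k1\<bar> \<le> 2 * (\<bar>real_of_int k3\<bar> * \<bar>real_of_int (k - k1 - k3)\<bar>)"
            using lohi(1) pos unfolding Psi(2) Phi(2) k4_def[symmetric] by (simp add: mult_ac)
          show "2 * (\<bar>real_of_int k3\<bar> * \<bar>real_of_int (k - k1 - k3)\<bar>) \<le> 3 * (\<bar>real_of_int k\<bar> * \<bar>real_of_int k1\<bar>)"
            using lohi(2) pos unfolding Psi(2) Phi(2) k4_def[symmetric] by (simp add: mult_ac)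
        qed (use k nz UW in \<open>auto simp: U_def W_def k2_def k4_def\<close>)
        \<comment> \<open>The interpolation exponent is 2\<gamma> here, admissible as \<gamma> \<le>
          1/2.\<close>
        have "norm (X2ker t s k k1 k3)
          \<le> \<bar>real_of_int k\<bar> * \<bar>real_of_int k2\<bar> / 2 * (4 * (t - s) powr (2 * \<gamma>) * \<bar>\<Phi> + \<Psi>\<bar> powr (2 * \<gamma> - 1) / \<bar>\<Psi>\<bar>)"
          unfolding nm using 3 Phi Psi st gamma by (intro mult_left_mono norm_osc2_near_resonant) auto
        also have "\<dots> \<le> \<bar>real_of_int k\<bar> * \<bar>real_of_int k2\<bar> / 2 * (4 * (t - s) powr (2 * \<gamma>) * q powr (2 * \<gamma> - 1) / \<bar>\<Psi>\<bar>)"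
          unfolding q(2) using q(1) gamma by (intro mult_left_mono divide_right_mono powr_mono2') auto
        also have "\<dots> = (2 / 3) * (t - s) powr (2 * \<gamma>) * (\<bar>real_of_int k\<bar> / (\<bar>real_of_int k3\<bar> * \<bar>real_of_int k4\<bar>) * q powr - (1 - 2 * \<gamma>))"
          unfolding Psi(2) using pos by (simp add: field_simps)
        also have "\<dots> \<le> 1 * (t - s) powr (2 * \<gamma>) * (32 * 8 powr \<bar>\<alpha>\<bar> * 3 powr z * near_weight k (k1, k3))"
          by (rule mult_mono[OF _ key]) (use p in auto)
        also have "\<dots> = (32 * 8 powr \<bar>\<alpha>\<bar> * 3 powr z) * (t - s) powr (2 * \<gamma>) * near_weight k (k1, k3)"
          by simp
        also have "\<dots> \<le> C * (t - s) powr (2 * \<gamma>) * w"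
          by (intro fin w C) auto
        finally show ?thesis .
      qed
    qed
    then show "norm (X2ker t s k (fst j) (snd j)) \<le> C * (t - s) powr (2 * \<gamma>) * X2weight k j"
      by (simp add: k1_def k3_def w_def)
  qed
qed

end

section \<open>The operators on the weighted spaces\<close>

lemma wnorm_finite: "wnorm u \<alpha> a < top \<Longrightarrow> a k < top"
  using le_dnorm[of "\<lambda>k. ennreal (jbr k powr \<alpha>) * a k" k u]
  unfolding wnorm_def by (auto simp: ennreal_mult_less_top dest!: order_le_less_trans)

lemma tsum_delta: "tsum (\<lambda>l. ennreal (if l = m then x else 0) * F l) = ennreal x * F m"
proof -
  have "ennreal (if l = m then x else 0) * F l = (ennreal x * F m) * indicator {m} l" for l
    by (auto simp: indicator_def)
  then show ?thesis
    by simp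
qed

text \<open>Lets the positive radii of the bilinear estimate shrink to the norms, which may
  vanish.\<close>

lemma le_two_factors:
  fixes x c a b :: real
  assumes "\<And>e. e > 0 \<Longrightarrow> x \<le> c * ((a + e) * (b + e))"
  shows "x \<le> c * (a * b)"
proof (rule tendsto_lowerbound)
  show "((\<lambda>e. c * ((a + e) * (b + e))) \<longlongrightarrow> c * (a * b)) (at_right 0)"
    by (auto intro!: tendsto_eq_intros)
  show "\<forall>\<^sub>F e in at_right 0. x \<le> c * ((a + e) * (b + e))"
    using assms by (auto simp: eventually_at_filter intro!: always_eventually)
qed auto

lemma le_three_factors:
  fixes x c a b d :: real
  assumes "\<And>e. e > 0 \<Longrightarrow> x \<le> c * ((a + e) * (b + e) * (d + e))"
  shows "x \<le> c * (a * b * d)"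
proof (rule tendsto_lowerbound)
  show "((\<lambda>e. c * ((a + e) * (b + e) * (d + e))) \<longlongrightarrow> c * (a * b * d)) (at_right 0)"
    by (auto intro!: tendsto_eq_intros)
  show "\<forall>\<^sub>F e in at_right 0. x \<le> c * ((a + e) * (b + e) * (d + e))"
    using assms by (auto simp: eventually_at_filter intro!: always_eventually)
qed auto

lemma infsum_add_abs:
  fixes f g :: "'a \<Rightarrow> complex"
  assumes "(\<lambda>x. norm (f x)) summable_on S" "(\<lambda>x. norm (g x)) summable_on S"
  shows "infsum (\<lambda>x. f x + g x) S = infsum f S + infsum g S"
  by (rule infsum_add[OF abs_summable_summable[OF assms(1)] abs_summable_summable[OF assms(2)]])

lemma infsum_add3:
  fixes a b c :: "'a \<Rightarrow> complex"
  assumes "a summable_on S" "b summable_on S" "c summable_on S"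
  shows "infsum (\<lambda>x. a x + (b x + (c x + c x))) S = infsum a S + (infsum b S + (infsum c S + infsum c S))"
proof -
  have "infsum (\<lambda>x. a x + (b x + (c x + c x))) S = infsum a S + infsum (\<lambda>x. b x + (c x + c x)) S"
    by (intro infsum_add summable_on_add assms)
  also have "infsum (\<lambda>x. b x + (c x + c x)) S = infsum b S + infsum (\<lambda>x. c x + c x) S"
    by (intro infsum_add summable_on_add assms)
  also have "infsum (\<lambda>x. c x + c x) S = infsum c S + infsum c S"
    by (intro infsum_add assms)
  finally show ?thesis .
qed

context exponents
begin

definition ana :: "fser \<Rightarrow> int \<Rightarrow> ennreal" where
  "ana f k = ennreal (cmod (f k))"

definition wn :: "fser \<Rightarrow> ennreal" where
  "wn f = wnorm u \<alpha> (ana f)"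

definition nrm :: "fser \<Rightarrow> real" where
  "nrm f = enn2real (wn f)"

text \<open>Contains \<open>FL \<alpha> p\<close> for u = 1/p and is preserved by sums, negation and
  both operators, so that solution, iterates and errors live in one group.\<close>

definition fin :: "fser set" where
  "fin = {f. wn f < top}"

lemma wn_le_nrm: "f \<in> fin \<Longrightarrow> e \<ge> 0 \<Longrightarrow> wn f \<le> ennreal (nrm f + e)"
  by (simp add: fin_def nrm_def ennreal_plus[symmetric] del: ennreal_plus)
    (metis add_increasing2 ennreal_enn2real ennreal_leI order_refl)

lemma wn_leD: "wn f \<le> ennreal c \<Longrightarrow> 0 \<le> c \<Longrightarrow> f \<in> fin \<and> nrm f \<le> c"
  unfolding fin_def nrm_def
  by (auto intro: enn2real_leI order_le_less_trans[OF _ ennreal_less_top])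

lemma wn_add: "wn (f + g) \<le> wn f + wn g"
proof -
  have "ana (f + g) k \<le> ana f k + ana g k" for k
    unfolding ana_def by (simp add: ennreal_plus[symmetric] norm_triangle_ineq ennreal_leI del: ennreal_plus)
  then have "wn (f + g) \<le> wnorm u \<alpha> (\<lambda>k. ana f k + ana g k)"
    unfolding wn_def by (rule wnorm_mono)
  also have "\<dots> \<le> wn f + wn g"
    unfolding wn_def by (rule wnorm_add)
  finally show ?thesis .
qed

lemma wn_uminus: "wn (- f) = wn f"
  unfolding wn_def ana_def by simp

lemma wn_zero: "wn 0 = 0"
proof -
  have "wn 0 = wnorm u \<alpha> (\<lambda>k. 0 * (0::ennreal))"
    unfolding wn_def by (rule arg_cong[where f = "wnorm u \<alpha>"]) (auto simp: ana_def)
  then show ?thesis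
    unfolding wnorm_cmult by simp
qed

lemma fin_add: "f \<in> fin \<Longrightarrow> g \<in> fin \<Longrightarrow> f + g \<in> fin \<and> nrm (f + g) \<le> nrm f + nrm g"
proof -
  assume fg: "f \<in> fin" "g \<in> fin"
  have "wn (f + g) \<le> ennreal (nrm f + 0) + ennreal (nrm g + 0)"
    by (rule order_trans[OF wn_add add_mono[OF wn_le_nrm[OF fg(1)] wn_le_nrm[OF fg(2)]]]) auto
  then show ?thesis
    by (intro wn_leD) (auto simp: nrm_def ennreal_plus)
qed

definition bimaj :: "fser \<Rightarrow> fser \<Rightarrow> int \<Rightarrow> ennreal" where
  "bimaj f g k = tsum (\<lambda>k1. ennreal (bikernel \<gamma> k k1) * (ana f k1 * ana g (k - k1)))"

lemma bimaj_bound: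
  obtains C where "C > 0" "\<And>f g Ca Cb. Ca > 0 \<Longrightarrow> Cb > 0 \<Longrightarrow>
    wn f \<le> ennreal Ca \<Longrightarrow> wn g \<le> ennreal Cb \<Longrightarrow> wnorm u \<alpha> (bimaj f g) \<le> ennreal (C * (Ca * Cb))"
proof -
  obtain C where C: "C > 0" "\<And>a b Ca Cb. Ca > 0 \<Longrightarrow> Cb > 0 \<Longrightarrow>
    wnorm u \<alpha> a \<le> ennreal Ca \<Longrightarrow> wnorm u \<alpha> b \<le> ennreal Cb \<Longrightarrow>
    wnorm u \<alpha> (\<lambda>k. tsum (\<lambda>k1. ennreal (bikernel \<gamma> k k1) * (a k1 * b (k - k1)))) \<le> ennreal (C * (Ca * Cb))"
    using bilinear_bound by blast
  show ?thesis
  proof (rule that[OF C(1)])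
    fix f g :: fser and Ca Cb :: real
    assume "Ca > 0" "Cb > 0" "wn f \<le> ennreal Ca" "wn g \<le> ennreal Cb"
    then show "wnorm u \<alpha> (bimaj f g) \<le> ennreal (C * (Ca * Cb))"
      unfolding wn_def bimaj_def[abs_def] by (rule C(2))
  qed
qed

text \<open>A finite weighted norm forces finiteness at every frequency; this gives absolute
  convergence of the sums defining X.\<close>

lemma bimaj_finite: "f \<in> fin \<Longrightarrow> g \<in> fin \<Longrightarrow> bimaj f g k < top"
proof -
  assume fg: "f \<in> fin" "g \<in> fin"
  obtain C where C: "C > 0" "\<And>f g Ca Cb. Ca > 0 \<Longrightarrow> Cb > 0 \<Longrightarrow>
    wn f \<le> ennreal Ca \<Longrightarrow> wn g \<le> ennreal Cb \<Longrightarrow> wnorm u \<alpha> (bimaj f g) \<le> ennreal (C * (Ca * Cb))"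
    using bimaj_bound by blast
  have "wnorm u \<alpha> (bimaj f g) \<le> ennreal (C * ((nrm f + 1) * (nrm g + 1)))"
    by (intro C wn_le_nrm fg) (auto simp: nrm_def add_nonneg_pos)
  then show ?thesis
    by (intro wnorm_finite) (rule order_le_less_trans[OF _ ennreal_less_top])
qed

lemma Xker_term_bound:
  assumes "s \<le> t" "k1 \<in> {k1. k1 \<noteq> 0 \<and> k1 \<noteq> k}"
  shows "norm (Xker t s k k1 * f k1 * g (k - k1))
    \<le> 4 * (t - s) powr \<gamma> * (bikernel \<gamma> k k1 * (cmod (f k1) * cmod (g (k - k1))))"
proof -
  have "norm (Xker t s k k1 * f k1 * g (k - k1)) = norm (Xker t s k k1) * (cmod (f k1) * cmod (g (k - k1)))"
    by (simp add: norm_mult)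
  also have "\<dots> \<le> 4 * (t - s) powr \<gamma> * bikernel \<gamma> k k1 * (cmod (f k1) * cmod (g (k - k1)))"
    using assms gamma by (intro mult_right_mono Xker_bound) auto
  finally show ?thesis
    by (simp add: mult_ac)
qed

lemma tsum_Xker_majorant: "0 \<le> c \<Longrightarrow>
  tsum (\<lambda>k1. ennreal (c * (bikernel \<gamma> k k1 * (cmod (f k1) * cmod (g (k - k1)))))) = ennreal c * bimaj f g k"
  by (simp add: bimaj_def ana_def ennreal_mult tsum_cmult)

lemma X_summable:
  assumes "s \<le> t" "f \<in> fin" "g \<in> fin"
  shows "(\<lambda>k1. norm (Xker t s k k1 * f k1 * g (k - k1))) summable_on {k1. k1 \<noteq> 0 \<and> k1 \<noteq> k}"
proof (rule summable_of_tsum[OF Xker_term_bound[OF assms(1)]])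
  show "tsum (\<lambda>k1. ennreal (4 * (t - s) powr \<gamma> * (bikernel \<gamma> k k1 * (cmod (f k1) * cmod (g (k - k1)))))) < top"
    using bimaj_finite[OF assms(2,3)] by (subst tsum_Xker_majorant) (auto simp: ennreal_mult_less_top)
qed auto

lemma X_bound:
  obtains C where "C > 0" "\<And>s t f g. s \<le> t \<Longrightarrow> f \<in> fin \<Longrightarrow> g \<in> fin \<Longrightarrow>
    Xop t s f g \<in> fin \<and> nrm (Xop t s f g) \<le> C * (t - s) powr \<gamma> * (nrm f * nrm g)"
proof -
  obtain C where C: "C > 0" "\<And>f g Ca Cb. Ca > 0 \<Longrightarrow> Cb > 0 \<Longrightarrow>
    wn f \<le> ennreal Ca \<Longrightarrow> wn g \<le> ennreal Cb \<Longrightarrow> wnorm u \<alpha> (bimaj f g) \<le> ennreal (C * (Ca * Cb))"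
    using bimaj_bound by blast
  show ?thesis
  proof (rule that[of "4 * C"])
    fix s t :: real and f g :: fser
    assume st: "s \<le> t" and fg: "f \<in> fin" "g \<in> fin"
    have "ana (Xop t s f g) k \<le> ennreal (4 * (t - s) powr \<gamma>) * bimaj f g k" for k
      unfolding ana_def Xop_eq
      by (subst tsum_Xker_majorant[symmetric]) (auto intro!: norm_infsum_le_tsum Xker_term_bound[OF st])
    then have le: "wn (Xop t s f g) \<le> ennreal (4 * (t - s) powr \<gamma>) * wnorm u \<alpha> (bimaj f g)"
      unfolding wn_def wnorm_cmult[symmetric] by (rule wnorm_mono)
    have eps: "wn (Xop t s f g) \<le> ennreal (4 * C * (t - s) powr \<gamma> * ((nrm f + e) * (nrm g + e)))" if e: "e > 0" for e
    proof -
      have pos: "nrm f + e > 0" "nrm g + e > 0"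
        using e by (auto simp: nrm_def add_nonneg_pos)
      have "wnorm u \<alpha> (bimaj f g) \<le> ennreal (C * ((nrm f + e) * (nrm g + e)))"
        using e by (intro C pos wn_le_nrm fg) auto
      then have "wn (Xop t s f g) \<le> ennreal (4 * (t - s) powr \<gamma>) * ennreal (C * ((nrm f + e) * (nrm g + e)))"
        by (intro order_trans[OF le] mult_left_mono) auto
      then show ?thesis
        using C(1) pos by (simp add: ennreal_mult[symmetric] mult_ac)
    qed
    have nn: "0 \<le> 4 * C * (t - s) powr \<gamma> * ((nrm f + e) * (nrm g + e))" if "e > 0" for e
      using C(1) that by (auto simp: nrm_def)
    show "Xop t s f g \<in> fin \<and> nrm (Xop t s f g) \<le> 4 * C * (t - s) powr \<gamma> * (nrm f * nrm g)"
    proof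
      show "Xop t s f g \<in> fin"
        by (rule conjunct1[OF wn_leD[OF eps[OF zero_less_one] nn[OF zero_less_one]]])
      show "nrm (Xop t s f g) \<le> 4 * C * (t - s) powr \<gamma> * (nrm f * nrm g)"
        by (rule le_two_factors) (rule conjunct2[OF wn_leD[OF eps nn]])
    qed
  qed (use C in auto)
qed

lemma X_add:
  assumes "s \<le> t" "f \<in> fin" "f' \<in> fin" "g \<in> fin"
  shows "Xop t s (f + f') g = Xop t s f g + Xop t s f' g"
proof (rule ext)
  fix k
  show "Xop t s (f + f') g k = (Xop t s f g + Xop t s f' g) k"
    unfolding plus_fun_apply Xop_eq
    by (subst infsum_add_abs[symmetric, OF X_summable X_summable]; (intro assms)?; simp add: algebra_simps)
qed

lemma X_commute: "Xop t s f g = Xop t s g f"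
proof (rule ext)
  fix k :: int
  have "bij_betw (\<lambda>k1. k - k1) {k1. k1 \<noteq> 0 \<and> k1 \<noteq> k} {k1. k1 \<noteq> 0 \<and> k1 \<noteq> k}"
    by (rule bij_betwI[where g = "\<lambda>k1. k - k1"]) auto
  from infsum_reindex_bij_betw[OF this, of "\<lambda>k1. Xker t s k k1 * f k1 * g (k - k1)"]
  show "Xop t s f g k = Xop t s g f k"
    unfolding Xop_eq by (simp add: Xker_commute mult_ac)
qed

lemma X_chain:
  assumes "s \<le> m" "m \<le> t" "f \<in> fin" "g \<in> fin"
  shows "Xop t s f g = Xop t m f g + Xop m s f g"
proof (rule ext)
  fix k
  show "Xop t s f g k = (Xop t m f g + Xop m s f g) k"
    unfolding plus_fun_apply Xop_eq Xker_chain[of t s k _ m]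
    by (subst infsum_add_abs[symmetric, OF X_summable X_summable]; (intro assms)?; simp add: algebra_simps)
qed

section \<open>The trilinear operator X^2 and Chen's relation\<close>

definition trimaj :: "fser \<Rightarrow> fser \<Rightarrow> fser \<Rightarrow> int \<Rightarrow> ennreal" where
  "trimaj f g h k = tsum (\<lambda>j. ennreal (X2weight k j) * (ana f (fst j) * ana g (snd j) * ana h (k - fst j - snd j)))"

lemma trimaj_bound:
  obtains C where "C > 0" "\<And>f g h Ca Cb Cc. Ca > 0 \<Longrightarrow> Cb > 0 \<Longrightarrow> Cc > 0 \<Longrightarrow>
    wn f \<le> ennreal Ca \<Longrightarrow> wn g \<le> ennreal Cb \<Longrightarrow> wn h \<le> ennreal Cc \<Longrightarrow>
    wnorm u \<alpha> (trimaj f g h) \<le> ennreal (C * (Ca * Cb * Cc))"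
proof -
  obtain C0 where C0: "C0 > 0" "\<And>a b Ca Cb. Ca > 0 \<Longrightarrow> Cb > 0 \<Longrightarrow>
    wnorm u \<alpha> a \<le> ennreal Ca \<Longrightarrow> wnorm u \<alpha> b \<le> ennreal Cb \<Longrightarrow>
    wnorm u \<alpha> (\<lambda>k. tsum (\<lambda>k1. ennreal (bikernel \<gamma> k k1) * (a k1 * b (k - k1)))) \<le> ennreal (C0 * (Ca * Cb))"
    using bilinear_bound by blast
  obtain Cr where Cr: "Cr > 0" "\<And>a b Ca Cb. Ca > 0 \<Longrightarrow> Cb > 0 \<Longrightarrow>
    wnorm u \<alpha> a \<le> ennreal Ca \<Longrightarrow> wnorm u \<alpha> b \<le> ennreal Cb \<Longrightarrow>
    tsum (\<lambda>k. ennreal (1 / jbr k) * (a k * b (- k))) \<le> ennreal (Cr * (Ca * Cb))"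
    using resonant_sum by blast
  define tri where "tri = (\<lambda>(\<omega>::int \<Rightarrow> int \<times> int \<Rightarrow> real) a b c k.
    tsum (\<lambda>j. ennreal (\<omega> k j) * (a (fst j) * b (snd j) * c (k - fst j - snd j))))"
  have tri_add: "tri (\<lambda>k j. \<omega> k j + \<omega>' k j) a b c k = tri \<omega> a b c k + tri \<omega>' a b c k"
    if "\<And>k j. 0 \<le> \<omega> k j" "\<And>k j. 0 \<le> \<omega>' k j" for \<omega> \<omega>' a b c k
    unfolding tri_def tsum_add[symmetric] using that by (simp add: distrib_right)
  \<comment> \<open>Weights that induce a bounded trilinear operator. The class is closed under
    addition, so the summands of \<open>X2weight\<close> can be treated one at a time.\<close>
  define good where "good = (\<lambda>\<omega>. (\<forall>k j. 0 \<le> \<omega> k j) \<and> (\<exists>C>0. \<forall>a b c Ca Cb Cc. Ca > 0 \<and> Cb > 0 \<and> Cc > 0 \<and>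
    wnorm u \<alpha> a \<le> ennreal Ca \<and> wnorm u \<alpha> b \<le> ennreal Cb \<and> wnorm u \<alpha> c \<le> ennreal Cc \<longrightarrow>
    wnorm u \<alpha> (tri \<omega> a b c) \<le> ennreal (C * (Ca * Cb * Cc))))"
  have good_add: "good (\<lambda>k j. \<omega> k j + \<omega>' k j)" if g: "good \<omega>" "good \<omega>'" for \<omega> \<omega>'
  proof -
    obtain C where C: "C > 0" "\<And>a b c Ca Cb Cc. Ca > 0 \<and> Cb > 0 \<and> Cc > 0 \<and>
      wnorm u \<alpha> a \<le> ennreal Ca \<and> wnorm u \<alpha> b \<le> ennreal Cb \<and> wnorm u \<alpha> c \<le> ennreal Cc \<Longrightarrow>
      wnorm u \<alpha> (tri \<omega> a b c) \<le> ennreal (C * (Ca * Cb * Cc))"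
      using conjunct2[OF g(1)[unfolded good_def]] by blast
    obtain C' where C': "C' > 0" "\<And>a b c Ca Cb Cc. Ca > 0 \<and> Cb > 0 \<and> Cc > 0 \<and>
      wnorm u \<alpha> a \<le> ennreal Ca \<and> wnorm u \<alpha> b \<le> ennreal Cb \<and> wnorm u \<alpha> c \<le> ennreal Cc \<Longrightarrow>
      wnorm u \<alpha> (tri \<omega>' a b c) \<le> ennreal (C' * (Ca * Cb * Cc))"
      using conjunct2[OF g(2)[unfolded good_def]] by blast
    have nn: "\<And>k j. 0 \<le> \<omega> k j" "\<And>k j. 0 \<le> \<omega>' k j"
      using conjunct1[OF g(1)[unfolded good_def]] conjunct1[OF g(2)[unfolded good_def]] by auto
    show ?thesis
      unfolding good_def
    proof (intro conjI exI[of _ "C + C'"] allI impI)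
      fix a b c Ca Cb Cc
      assume as: "Ca > 0 \<and> Cb > 0 \<and> Cc > 0 \<and>
        wnorm u \<alpha> a \<le> ennreal Ca \<and> wnorm u \<alpha> b \<le> ennreal Cb \<and> wnorm u \<alpha> c \<le> ennreal Cc"
      have "wnorm u \<alpha> (tri (\<lambda>k j. \<omega> k j + \<omega>' k j) a b c) = wnorm u \<alpha> (\<lambda>k. tri \<omega> a b c k + tri \<omega>' a b c k)"
        using nn by (intro arg_cong[where f = "wnorm u \<alpha>"] ext tri_add)
      also have "\<dots> \<le> ennreal (C * (Ca * Cb * Cc)) + ennreal (C' * (Ca * Cb * Cc))"
        by (rule order_trans[OF wnorm_add add_mono[OF C(2)[OF as] C'(2)[OF as]]])
      also have "\<dots> = ennreal ((C + C') * (Ca * Cb * Cc))"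
        using C C' as by (simp add: distrib_right ennreal_plus)
      finally show "wnorm u \<alpha> (tri (\<lambda>k j. \<omega> k j + \<omega>' k j) a b c) \<le> ennreal ((C + C') * (Ca * Cb * Cc))" .
    qed (use nn C C' in auto)
  qed
  have good_pair: "good (pair_weight \<phi> \<psi>)" if inj: "inj (\<lambda>i. (\<phi> (fst i) (snd i), \<psi> (fst i) (snd i), fst i))" for \<phi> \<psi>
  proof -
    obtain C where C: "C > 0" "\<And>a b c Ca Cb Cc. Ca > 0 \<Longrightarrow> Cb > 0 \<Longrightarrow> Cc > 0 \<Longrightarrow>
      wnorm u \<alpha> a \<le> ennreal Ca \<Longrightarrow> wnorm u \<alpha> b \<le> ennreal Cb \<Longrightarrow> wnorm u \<alpha> c \<le> ennreal Cc \<Longrightarrow>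
      wnorm u \<alpha> (\<lambda>k. tsum (\<lambda>j. ennreal (pair_weight \<phi> \<psi> k j) * (a (fst j) * b (snd j) * c (k - fst j - snd j))))
        \<le> ennreal (C * (Ca * Cb * Cc))"
      using trilinear_bound[OF inj] by blast
    show ?thesis
      unfolding good_def
    proof (intro conjI exI[of _ C] allI impI)
      fix a b c Ca Cb Cc
      assume as: "Ca > 0 \<and> Cb > 0 \<and> Cc > 0 \<and>
        wnorm u \<alpha> a \<le> ennreal Ca \<and> wnorm u \<alpha> b \<le> ennreal Cb \<and> wnorm u \<alpha> c \<le> ennreal Cc"
      then show "wnorm u \<alpha> (tri (pair_weight \<phi> \<psi>) a b c) \<le> ennreal (C * (Ca * Cb * Cc))"
        unfolding tri_def by (elim conjE) (rule C(2))
    qed (use C(1) in auto)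
  qed
  have good_near: "good near_weight"
    unfolding near_weight_def[abs_def]
    by (intro good_add good_pair) (auto simp: inj_def)
  \<comment> \<open>The inner sum over k3 is itself a sequence of finite norm, so the bilinear bound
    applies twice.\<close>
  have good_comp: "good (\<lambda>k j. bikernel \<gamma> k (fst j) * bikernel \<gamma> (k - fst j) (snd j))"
    unfolding good_def
  proof (intro conjI exI[of _ "C0 * C0"] allI impI)
    fix a b c Ca Cb Cc
    assume as: "Ca > 0 \<and> Cb > 0 \<and> Cc > 0 \<and>
      wnorm u \<alpha> a \<le> ennreal Ca \<and> wnorm u \<alpha> b \<le> ennreal Cb \<and> wnorm u \<alpha> c \<le> ennreal Cc"
    define S where "S = (\<lambda>l. tsum (\<lambda>k3. ennreal (bikernel \<gamma> l k3) * (b k3 * c (l - k3))))"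
    have S: "wnorm u \<alpha> S \<le> ennreal (C0 * (Cb * Cc))"
      unfolding S_def using as by (intro C0) auto
    have "tri (\<lambda>k j. bikernel \<gamma> k (fst j) * bikernel \<gamma> (k - fst j) (snd j)) a b c k
      = tsum (\<lambda>k1. ennreal (bikernel \<gamma> k k1) * (a k1 * S (k - k1)))" for k
    proof -
      have "tri (\<lambda>k j. bikernel \<gamma> k (fst j) * bikernel \<gamma> (k - fst j) (snd j)) a b c k
        = tsum (\<lambda>k1. tsum (\<lambda>k3. ennreal (bikernel \<gamma> k k1 * bikernel \<gamma> (k - k1) k3) * (a k1 * b k3 * c (k - k1 - k3))))"
        unfolding tri_def tsum_prod ..
      also have "\<dots> = tsum (\<lambda>k1. tsum (\<lambda>k3. (ennreal (bikernel \<gamma> k k1) * a k1) * (ennreal (bikernel \<gamma> (k - k1) k3) * (b k3 * c (k - k1 - k3)))))"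
        by (simp add: ennreal_mult mult_ac)
      finally show ?thesis
        unfolding tsum_cmult S_def by (simp add: mult_ac)
    qed
    then have "wnorm u \<alpha> (tri (\<lambda>k j. bikernel \<gamma> k (fst j) * bikernel \<gamma> (k - fst j) (snd j)) a b c)
      = wnorm u \<alpha> (\<lambda>k. tsum (\<lambda>k1. ennreal (bikernel \<gamma> k k1) * (a k1 * S (k - k1))))"
      by (intro arg_cong[where f = "wnorm u \<alpha>"] ext)
    also have "\<dots> \<le> ennreal (C0 * (Ca * (C0 * (Cb * Cc))))"
      using as S C0(1) by (intro C0) auto
    also have "\<dots> = ennreal (C0 * C0 * (Ca * Cb * Cc))"
      by (simp add: mult_ac)
    finally show "wnorm u \<alpha> (tri (\<lambda>k j. bikernel \<gamma> k (fst j) * bikernel \<gamma> (k - fst j) (snd j)) a b c)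
      \<le> ennreal (C0 * C0 * (Ca * Cb * Cc))" .
  qed (use C0 in auto)
  \<comment> \<open>k3 = k leaves the frequency -k1 for the third argument: the sum over k1 is a
    number, by which \<open>b\<close> is multiplied.\<close>
  have good_res1: "good (\<lambda>k j. if snd j = k then 1 / jbr (fst j) else 0)"
    unfolding good_def
  proof (intro conjI exI[of _ Cr] allI impI)
    fix a b c Ca Cb Cc
    assume as: "Ca > 0 \<and> Cb > 0 \<and> Cc > 0 \<and>
      wnorm u \<alpha> a \<le> ennreal Ca \<and> wnorm u \<alpha> b \<le> ennreal Cb \<and> wnorm u \<alpha> c \<le> ennreal Cc"
    define S where "S = tsum (\<lambda>k. ennreal (1 / jbr k) * (a k * c (- k)))"
    have S: "S \<le> ennreal (Cr * (Ca * Cc))"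
      unfolding S_def using as by (intro Cr) auto
    have "tri (\<lambda>k j. if snd j = k then 1 / jbr (fst j) else 0) a b c k = S * b k" for k
    proof -
      have "tri (\<lambda>k j. if snd j = k then 1 / jbr (fst j) else 0) a b c k
        = tsum (\<lambda>k1. tsum (\<lambda>k3. ennreal (if k3 = k then 1 / jbr k1 else 0) * (a k1 * b k3 * c (k - k1 - k3))))"
        unfolding tri_def tsum_prod ..
      also have "\<dots> = tsum (\<lambda>k1. (ennreal (1 / jbr k1) * (a k1 * c (- k1))) * b k)"
        unfolding tsum_delta by (simp add: mult_ac)
      finally show ?thesis
        unfolding tsum_multc S_def .
    qed
    then have "wnorm u \<alpha> (tri (\<lambda>k j. if snd j = k then 1 / jbr (fst j) else 0) a b c) = S * wnorm u \<alpha> b"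
      unfolding wnorm_cmult[symmetric] by (intro arg_cong[where f = "wnorm u \<alpha>"] ext)
    also have "\<dots> \<le> ennreal (Cr * (Ca * Cc)) * ennreal Cb"
      using as by (intro mult_mono S) auto
    also have "\<dots> = ennreal (Cr * (Ca * Cb * Cc))"
      using as Cr(1) by (simp add: ennreal_mult[symmetric] mult_ac)
    finally show "wnorm u \<alpha> (tri (\<lambda>k j. if snd j = k then 1 / jbr (fst j) else 0) a b c) \<le> ennreal (Cr * (Ca * Cb * Cc))" .
  qed (use Cr in auto)
  \<comment> \<open>k3 = -k1 leaves the frequency k for the third argument, so now \<open>c\<close>
    is multiplied by a number.\<close>
  have good_res2: "good (\<lambda>k j. if snd j = - fst j then 1 / jbr (fst j) else 0)"
    unfolding good_def
  proof (intro conjI exI[of _ Cr] allI impI)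
    fix a b c Ca Cb Cc
    assume as: "Ca > 0 \<and> Cb > 0 \<and> Cc > 0 \<and>
      wnorm u \<alpha> a \<le> ennreal Ca \<and> wnorm u \<alpha> b \<le> ennreal Cb \<and> wnorm u \<alpha> c \<le> ennreal Cc"
    define S where "S = tsum (\<lambda>k. ennreal (1 / jbr k) * (a k * b (- k)))"
    have S: "S \<le> ennreal (Cr * (Ca * Cb))"
      unfolding S_def using as by (intro Cr) auto
    have "tri (\<lambda>k j. if snd j = - fst j then 1 / jbr (fst j) else 0) a b c k = S * c k" for k
    proof -
      have "tri (\<lambda>k j. if snd j = - fst j then 1 / jbr (fst j) else 0) a b c k
        = tsum (\<lambda>k1. tsum (\<lambda>k3. ennreal (if k3 = - k1 then 1 / jbr k1 else 0) * (a k1 * b k3 * c (k - k1 - k3))))"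
        unfolding tri_def tsum_prod ..
      also have "\<dots> = tsum (\<lambda>k1. (ennreal (1 / jbr k1) * (a k1 * b (- k1))) * c k)"
        unfolding tsum_delta by (simp add: mult_ac)
      finally show ?thesis
        unfolding tsum_multc S_def .
    qed
    then have "wnorm u \<alpha> (tri (\<lambda>k j. if snd j = - fst j then 1 / jbr (fst j) else 0) a b c) = S * wnorm u \<alpha> c"
      unfolding wnorm_cmult[symmetric] by (intro arg_cong[where f = "wnorm u \<alpha>"] ext)
    also have "\<dots> \<le> ennreal (Cr * (Ca * Cb)) * ennreal Cc"
      using as by (intro mult_mono S) auto
    also have "\<dots> = ennreal (Cr * (Ca * Cb * Cc))"
      using as Cr(1) by (simp add: ennreal_mult[symmetric] mult_ac)
    finally show "wnorm u \<alpha> (tri (\<lambda>k j. if snd j = - fst j then 1 / jbr (fst j) else 0) a b c) \<le> ennreal (Cr * (Ca * Cb * Cc))" .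
  qed (use Cr in auto)
  have "good X2weight"
    unfolding X2weight_def[abs_def]
    by (intro good_add good_comp good_near good_res1 good_res2)
  obtain C where C: "C > 0" "\<And>a b c Ca Cb Cc. Ca > 0 \<and> Cb > 0 \<and> Cc > 0 \<and>
      wnorm u \<alpha> a \<le> ennreal Ca \<and> wnorm u \<alpha> b \<le> ennreal Cb \<and> wnorm u \<alpha> c \<le> ennreal Cc \<Longrightarrow>
      wnorm u \<alpha> (tri X2weight a b c) \<le> ennreal (C * (Ca * Cb * Cc))"
    using conjunct2[OF \<open>good X2weight\<close>[unfolded good_def]] by blast
  have eq: "trimaj f g h = tri X2weight (ana f) (ana g) (ana h)" for f g h
    by (auto simp: trimaj_def tri_def)
  show ?thesis
    by (rule that[OF C(1)]) (auto simp: eq wn_def intro!: C(2))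
qed

lemma trimaj_finite: "f \<in> fin \<Longrightarrow> g \<in> fin \<Longrightarrow> h \<in> fin \<Longrightarrow> trimaj f g h k < top"
proof -
  assume fg: "f \<in> fin" "g \<in> fin" "h \<in> fin"
  obtain C where C: "C > 0" "\<And>f g h Ca Cb Cc. Ca > 0 \<Longrightarrow> Cb > 0 \<Longrightarrow> Cc > 0 \<Longrightarrow>
    wn f \<le> ennreal Ca \<Longrightarrow> wn g \<le> ennreal Cb \<Longrightarrow> wn h \<le> ennreal Cc \<Longrightarrow>
    wnorm u \<alpha> (trimaj f g h) \<le> ennreal (C * (Ca * Cb * Cc))"
    using trimaj_bound by blast
  have "wnorm u \<alpha> (trimaj f g h) \<le> ennreal (C * ((nrm f + 1) * (nrm g + 1) * (nrm h + 1)))"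
    by (intro C wn_le_nrm fg) (auto simp: nrm_def add_nonneg_pos)
  then show ?thesis
    by (intro wnorm_finite) (rule order_le_less_trans[OF _ ennreal_less_top])
qed

lemma tsum_X2_majorant: "0 \<le> c \<Longrightarrow>
  tsum (\<lambda>j. ennreal (c * (X2weight k j * (cmod (f (fst j)) * cmod (g (snd j)) * cmod (h (k - fst j - snd j))))))
    = ennreal c * trimaj f g h k"
  by (simp add: trimaj_def ana_def ennreal_mult tsum_cmult)

text \<open>The kernel is a parameter because Chen's relation involves, on the same index set, both
  the kernel of X^2 and a product of two kernels of X.\<close>

definition X2term :: "(int \<Rightarrow> int \<times> int \<Rightarrow> complex) \<Rightarrow> fser \<Rightarrow> fser \<Rightarrow> fser \<Rightarrow> int \<Rightarrow> int \<times> int \<Rightarrow> complex" where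
  "X2term \<kappa> f g h k j = \<kappa> k j * f (fst j) * g (snd j) * h (k - fst j - snd j)"

lemma X2term_bound:
  assumes "norm (\<kappa> k j) \<le> c * X2weight k j"
  shows "norm (X2term \<kappa> f g h k j) \<le> c * (X2weight k j * (cmod (f (fst j)) * cmod (g (snd j)) * cmod (h (k - fst j - snd j))))"
proof -
  have "norm (X2term \<kappa> f g h k j) = norm (\<kappa> k j) * (cmod (f (fst j)) * cmod (g (snd j)) * cmod (h (k - fst j - snd j)))"
    by (simp add: X2term_def norm_mult)
  also have "\<dots> \<le> c * X2weight k j * (cmod (f (fst j)) * cmod (g (snd j)) * cmod (h (k - fst j - snd j)))"
    by (intro mult_right_mono assms) auto
  finally show ?thesis
    by (simp add: mult_ac)
qed

lemma X2term_summable: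
  assumes "\<And>j. j \<in> X2idx k \<Longrightarrow> norm (\<kappa> k j) \<le> c * X2weight k j" "0 \<le> c" "f \<in> fin" "g \<in> fin" "h \<in> fin"
  shows "(\<lambda>j. norm (X2term \<kappa> f g h k j)) summable_on X2idx k"
proof (rule summable_of_tsum[OF X2term_bound[where \<kappa> = \<kappa> and k = k, OF assms(1)]])
  show "tsum (\<lambda>j. ennreal (c * (X2weight k j * (cmod (f (fst j)) * cmod (g (snd j)) * cmod (h (k - fst j - snd j)))))) < top"
    using trimaj_finite[OF assms(3-5)] by (subst tsum_X2_majorant[OF assms(2)]) (auto simp: ennreal_mult_less_top)
qed (use assms in auto)

lemma X2op_eq_term:
  "s \<le> t \<Longrightarrow> X2op t s f g h k = infsum (X2term (\<lambda>k j. X2ker t s k (fst j) (snd j)) f g h k) (X2idx k)"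
  by (subst X2op_eq) (auto simp: X2term_def intro!: infsum_cong)

lemma X2_summable:
  assumes "s \<le> t" "f \<in> fin" "g \<in> fin" "h \<in> fin"
  shows "(\<lambda>j. norm (X2term (\<lambda>k j. X2ker t s k (fst j) (snd j)) f g h k j)) summable_on X2idx k"
proof -
  obtain C where C: "C > 0" "\<And>s' t' k j. j \<in> X2idx k \<Longrightarrow> s' \<le> t' \<Longrightarrow> t' - s' \<le> t - s \<Longrightarrow>
    norm (X2ker t' s' k (fst j) (snd j)) \<le> C * (t' - s') powr (2 * \<gamma>) * X2weight k j"
    using X2ker_bound[of "t - s"] by blast
  show ?thesis
    using C(1) assms by (intro X2term_summable[where c = "C * (t - s) powr (2 * \<gamma>)"] C(2)) auto
qed

lemma X2_bound:
  obtains C where "C > 0" "\<And>s t f g h. s \<le> t \<Longrightarrow> t - s \<le> T \<Longrightarrow> f \<in> fin \<Longrightarrow> g \<in> fin \<Longrightarrow> h \<in> fin \<Longrightarrow>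
    X2op t s f g h \<in> fin \<and> nrm (X2op t s f g h) \<le> C * (t - s) powr (2 * \<gamma>) * (nrm f * nrm g * nrm h)"
proof -
  obtain C where C: "C > 0" "\<And>f g h Ca Cb Cc. Ca > 0 \<Longrightarrow> Cb > 0 \<Longrightarrow> Cc > 0 \<Longrightarrow>
    wn f \<le> ennreal Ca \<Longrightarrow> wn g \<le> ennreal Cb \<Longrightarrow> wn h \<le> ennreal Cc \<Longrightarrow>
    wnorm u \<alpha> (trimaj f g h) \<le> ennreal (C * (Ca * Cb * Cc))"
    using trimaj_bound by blast
  obtain D where D: "D > 0" "\<And>s t k j. j \<in> X2idx k \<Longrightarrow> s \<le> t \<Longrightarrow> t - s \<le> T \<Longrightarrow>
    norm (X2ker t s k (fst j) (snd j)) \<le> D * (t - s) powr (2 * \<gamma>) * X2weight k j"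
    using X2ker_bound[of T] by blast
  show ?thesis
  proof (rule that[of "D * C"])
    fix s t :: real and f g h :: fser
    assume st: "s \<le> t" "t - s \<le> T" and fg: "f \<in> fin" "g \<in> fin" "h \<in> fin"
    have "ana (X2op t s f g h) k \<le> ennreal (D * (t - s) powr (2 * \<gamma>)) * trimaj f g h k" for k
      unfolding ana_def X2op_eq_term[OF st(1)] using D(1)
      by (subst tsum_X2_majorant[symmetric]) (auto intro!: norm_infsum_le_tsum X2term_bound D(2) st)
    then have le: "wn (X2op t s f g h) \<le> ennreal (D * (t - s) powr (2 * \<gamma>)) * wnorm u \<alpha> (trimaj f g h)"
      unfolding wn_def wnorm_cmult[symmetric] by (rule wnorm_mono)
    have eps: "wn (X2op t s f g h) \<le> ennreal (D * C * (t - s) powr (2 * \<gamma>) * ((nrm f + e) * (nrm g + e) * (nrm h + e)))"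
      if e: "e > 0" for e
    proof -
      have pos: "nrm f + e > 0" "nrm g + e > 0" "nrm h + e > 0"
        using e by (auto simp: nrm_def add_nonneg_pos)
      have "wnorm u \<alpha> (trimaj f g h) \<le> ennreal (C * ((nrm f + e) * (nrm g + e) * (nrm h + e)))"
        using e by (intro C pos wn_le_nrm fg) auto
      then have "wn (X2op t s f g h) \<le> ennreal (D * (t - s) powr (2 * \<gamma>)) * ennreal (C * ((nrm f + e) * (nrm g + e) * (nrm h + e)))"
        by (intro order_trans[OF le] mult_left_mono) auto
      then show ?thesis
        using C(1) D(1) pos by (simp add: ennreal_mult[symmetric] mult_ac)
    qed
    have nn: "0 \<le> D * C * (t - s) powr (2 * \<gamma>) * ((nrm f + e) * (nrm g + e) * (nrm h + e))" if "e > 0" for e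
      using C(1) D(1) that by (auto simp: nrm_def)
    show "X2op t s f g h \<in> fin \<and> nrm (X2op t s f g h) \<le> D * C * (t - s) powr (2 * \<gamma>) * (nrm f * nrm g * nrm h)"
    proof
      show "X2op t s f g h \<in> fin"
        by (rule conjunct1[OF wn_leD[OF eps[OF zero_less_one] nn[OF zero_less_one]]])
      show "nrm (X2op t s f g h) \<le> D * C * (t - s) powr (2 * \<gamma>) * (nrm f * nrm g * nrm h)"
        by (rule le_three_factors) (rule conjunct2[OF wn_leD[OF eps nn]])
    qed
  qed (use C D in auto)
qed

lemma X2_add:
  assumes "s \<le> t" "f \<in> fin" "f' \<in> fin" "g \<in> fin" "h \<in> fin"
  shows "X2op t s (f + f') g h = X2op t s f g h + X2op t s f' g h"
    and "X2op t s g (f + f') h = X2op t s g f h + X2op t s g f' h"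
    and "X2op t s g h (f + f') = X2op t s g h f + X2op t s g h f'"
proof -
  note sm = X2_summable[OF assms(1)]
  have "X2op t s (f + f') g h k = X2op t s f g h k + X2op t s f' g h k"
    and "X2op t s g (f + f') h k = X2op t s g f h k + X2op t s g f' h k"
    and "X2op t s g h (f + f') k = X2op t s g h f k + X2op t s g h f' k" for k
    unfolding X2op_eq_term[OF assms(1)]
    by (subst infsum_add_abs[symmetric, OF sm sm];
        (intro assms)?; intro infsum_cong; simp add: X2term_def algebra_simps)+
  then show "X2op t s (f + f') g h = X2op t s f g h + X2op t s f' g h"
    and "X2op t s g (f + f') h = X2op t s g f h + X2op t s g f' h"
    and "X2op t s g h (f + f') = X2op t s g h f + X2op t s g h f'"
    by (simp_all add: fun_eq_iff)
qed

text \<open>\<open>X2ker_chain\<close> may be summed term by term because all kernels in it are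
  dominated by multiples of \<open>X2weight\<close>, the product kernel by its first
  summand.\<close>

lemma X2_chain:
  assumes "s \<le> m" "m \<le> t" "f \<in> fin" "g \<in> fin" "h \<in> fin"
  shows "X2op t s f g h = X2op t m f g h + X2op m s f g h + (Xop t m f (Xop m s g h) + Xop t m f (Xop m s g h))"
proof (rule ext)
  fix k
  define \<kappa> where "\<kappa> = (\<lambda>k j. Xker t m k (fst j) * Xker m s (k - fst j) (snd j))"
  have idx: "X2idx k = Sigma {k1. k1 \<noteq> 0 \<and> k1 \<noteq> k} (\<lambda>k1. {k3. k3 \<noteq> 0 \<and> k3 \<noteq> k - k1})"
    by (auto simp: X2idx_def)
  have "(\<lambda>j. norm (X2term \<kappa> f g h k j)) summable_on X2idx k"
  proof (rule X2term_summable[where c = "16 * (t - m) powr \<gamma> * (m - s) powr \<gamma>"])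
    fix j assume j: "j \<in> X2idx k"
    have "norm (\<kappa> k j) \<le> (4 * (t - m) powr \<gamma> * bikernel \<gamma> k (fst j)) * (4 * (m - s) powr \<gamma> * bikernel \<gamma> (k - fst j) (snd j))"
      unfolding \<kappa>_def norm_mult using j assms gamma
      by (intro mult_mono Xker_bound) (auto simp: X2idx_def)
    also have "\<dots> = 16 * (t - m) powr \<gamma> * (m - s) powr \<gamma> * (bikernel \<gamma> k (fst j) * bikernel \<gamma> (k - fst j) (snd j))"
      by (simp add: mult_ac)
    also have "\<dots> \<le> 16 * (t - m) powr \<gamma> * (m - s) powr \<gamma> * X2weight k j"
      by (intro mult_left_mono) (auto simp: X2weight_def)
    finally show "norm (\<kappa> k j) \<le> 16 * (t - m) powr \<gamma> * (m - s) powr \<gamma> * X2weight k j" .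
  qed (use assms in auto)
  note sm = this
  \<comment> \<open>Absolute convergence over pairs permits summing over k3 first, which produces
    the inner operator.\<close>
  have X: "Xop t m f (Xop m s g h) k = infsum (X2term \<kappa> f g h k) (X2idx k)"
  proof -
    have "infsum (X2term \<kappa> f g h k) (X2idx k)
      = (\<Sum>\<^sub>\<infinity>k1\<in>{k1. k1 \<noteq> 0 \<and> k1 \<noteq> k}. \<Sum>\<^sub>\<infinity>k3\<in>{k3. k3 \<noteq> 0 \<and> k3 \<noteq> k - k1}. X2term \<kappa> f g h k (k1, k3))"
      unfolding idx
      by (rule infsum_Sigma_banach[symmetric])
        (use abs_summable_summable[OF sm] in \<open>simp add: idx\<close>)
    also have "\<dots> = (\<Sum>\<^sub>\<infinity>k1\<in>{k1. k1 \<noteq> 0 \<and> k1 \<noteq> k}. Xker t m k k1 * f k1 * Xop m s g h (k - k1))"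
      unfolding Xop_eq[of m s g h] infsum_cmult_right'[symmetric]
      by (auto intro!: infsum_cong simp: X2term_def \<kappa>_def mult_ac)
    finally show ?thesis
      by (simp add: Xop_eq)
  qed
  have "X2op t s f g h k = infsum (\<lambda>j. X2term (\<lambda>k j. X2ker t m k (fst j) (snd j)) f g h k j
      + (X2term (\<lambda>k j. X2ker m s k (fst j) (snd j)) f g h k j
        + (X2term \<kappa> f g h k j + X2term \<kappa> f g h k j))) (X2idx k)"
    using assms
    by (subst X2op_eq_term) (auto intro!: infsum_cong simp: X2ker_chain[of _ _ _ t s m] X2term_def X2idx_def \<kappa>_def algebra_simps)
  also have "\<dots> = X2op t m f g h k + (X2op m s f g h k + (Xop t m f (Xop m s g h) k + Xop t m f (Xop m s g h) k))"
    unfolding X X2op_eq_term[OF assms(1)] X2op_eq_term[OF assms(2)]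
    by (intro infsum_add3 abs_summable_summable[OF sm] abs_summable_summable[OF X2_summable] assms)
  finally show "X2op t s f g h k = (X2op t m f g h + X2op m s f g h + (Xop t m f (Xop m s g h) + Xop t m f (Xop m s g h))) k"
    by (simp add: add_ac)
qed

lemma rough_equation_X:
  assumes "T > 0"
  obtains K where "rough_equation fin nrm Xop X2op T K \<gamma>"
proof -
  obtain C where C: "C > 0" "\<And>s t f g. s \<le> t \<Longrightarrow> f \<in> fin \<Longrightarrow> g \<in> fin \<Longrightarrow>
    Xop t s f g \<in> fin \<and> nrm (Xop t s f g) \<le> C * (t - s) powr \<gamma> * (nrm f * nrm g)"
    using X_bound by blast
  obtain D where D: "D > 0" "\<And>s t f g h. s \<le> t \<Longrightarrow> t - s \<le> T \<Longrightarrow> f \<in> fin \<Longrightarrow> g \<in> fin \<Longrightarrow> h \<in> fin \<Longrightarrow>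
    X2op t s f g h \<in> fin \<and> nrm (X2op t s f g h) \<le> D * (t - s) powr (2 * \<gamma>) * (nrm f * nrm g * nrm h)"
    using X2_bound[of T] by blast
  have nn: "0 \<le> nrm f" for f
    by (simp add: nrm_def)
  have "rough_equation fin nrm Xop X2op T (max C D) \<gamma>"
  proof
    show "nrm (Xop t s x y) \<le> max C D * (t - s) powr \<gamma> * (nrm x * nrm y)"
      if "0 \<le> s" "s \<le> t" "t \<le> T" "x \<in> fin" "y \<in> fin" for s t x y
    proof -
      have "C * (t - s) powr \<gamma> * (nrm x * nrm y) \<le> max C D * (t - s) powr \<gamma> * (nrm x * nrm y)"
        using nn by (intro mult_right_mono) auto
      with C(2)[OF that(2,4,5)] show ?thesis
        by linarith
    qed
    show "nrm (X2op t s x y z) \<le> max C D * (t - s) powr (2 * \<gamma>) * (nrm x * nrm y * nrm z)"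
      and "X2op t s x y z \<in> fin"
      if "0 \<le> s" "s \<le> t" "t \<le> T" "x \<in> fin" "y \<in> fin" "z \<in> fin" for s t x y z
    proof -
      have "t - s \<le> T"
        using that by simp
      note D' = D(2)[OF that(2) this that(4-6)]
      have "D * (t - s) powr (2 * \<gamma>) * (nrm x * nrm y * nrm z) \<le> max C D * (t - s) powr (2 * \<gamma>) * (nrm x * nrm y * nrm z)"
        using nn by (intro mult_right_mono) auto
      with D' show "nrm (X2op t s x y z) \<le> max C D * (t - s) powr (2 * \<gamma>) * (nrm x * nrm y * nrm z)"
        by linarith
      show "X2op t s x y z \<in> fin"
        using D' by simp
    qed
    show "Xop t s x y \<in> fin" if "0 \<le> s" "s \<le> t" "t \<le> T" "x \<in> fin" "y \<in> fin" for s t x y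
      using C(2)[OF that(2,4,5)] by simp
    show "(0::fser) \<in> fin" "nrm 0 = 0"
      by (simp_all add: fin_def nrm_def wn_zero)
    show "- x \<in> fin" if "x \<in> fin" for x
      using that by (simp add: fin_def wn_uminus)
    show "nrm (- x) = nrm x" for x
      by (simp add: nrm_def wn_uminus)
    show "x + y \<in> fin" "nrm (x + y) \<le> nrm x + nrm y" if "x \<in> fin" "y \<in> fin" for x y
      using fin_add[OF that] by auto
    show "0 \<le> nrm x" for x
      by (rule nn)
    show "1 / 3 < \<gamma>" "\<gamma> \<le> 1 / 2" "0 \<le> max C D" "0 < T"
      using gamma C(1) assms by auto
    show "Xop t s x y = Xop t s y x" for t s x y
      by (rule X_commute)
  qed (erule (1) X_add X2_add X_chain X2_chain | assumption)+
  then show ?thesis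
    by (rule that)
qed

end

section \<open>Convergence of the Euler scheme\<close>

text \<open>For p \<ge> 2 the branch \<gamma> < 1/4 is excluded by \<gamma> > 1/3. For p \<le> 2 the
  branch \<alpha> \<ge> -1 + \<gamma> with \<gamma> < 1/(2p) can occur, and gives \<alpha> + 1/p >
  -1 + \<gamma> + 2\<gamma>, the same inequality as the other branch.\<close>

lemma exponents_of_inDprime:
  assumes p: "1 \<le> p" and g: "\<gamma> > 1/3" and D: "inDprime p \<gamma> \<alpha>"
  shows "exponents (invp p) \<alpha> \<gamma>"
proof
  have "p = \<infinity> \<or> (\<exists>r\<ge>1. p = ereal r)"
    using p by (cases p) (auto simp: one_ereal_def)
  then show u: "0 \<le> invp p" "invp p \<le> 1"
    by (auto simp: invp_def)
  show "- 1 / 2 < \<alpha>" "3 * \<gamma> - 1 < \<alpha> + invp p" "1 / 3 < \<gamma>" "\<gamma> \<le> 1 / 2"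
    using D g u unfolding inDprime_def inD_def by auto
qed

theorem theorem4:
  fixes p :: ereal and \<alpha> \<gamma> T :: real and v0 :: fser and v :: "real \<Rightarrow> fser"
  assumes "1 \<le> p"
    and "\<alpha> > max (- invp p) (- 1/2)"
    and "\<gamma> > 1/3"
    and "inDprime p \<gamma> \<alpha>"
    and "v0 \<in> FL \<alpha> p"
    and "T > 0"
    and "v 0 = v0"
    and "\<forall>t\<in>{0..T}. v t \<in> FL \<alpha> p"
    and "\<exists>C. \<forall>s\<in>{0..T}. \<forall>t\<in>{0..T}. FLnorm \<alpha> p (\<lambda>k. v t k - v s k) \<le> ennreal (C * \<bar>t - s\<bar> powr \<gamma>)"
    and "((\<lambda>h. (SUP st \<in> {(s, t). s \<in> {0..T} \<and> t \<in> {0..T} \<and> \<bar>t - s\<bar> \<le> h}.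
              FLnorm \<alpha> p (\<lambda>k. v (snd st) k - v (fst st) k
                 - Xop (snd st) (fst st) (v (fst st)) (v (fst st)) k
                 - X2op (snd st) (fst st) (v (fst st)) (v (fst st)) (v (fst st)) k)) / ennreal h)
           \<longlongrightarrow> 0) (at_right 0)"
  shows "\<exists>C N. \<forall>n\<ge>N. \<forall>i j. i < j \<and> real j \<le> real n * T \<longrightarrow>
           FLnorm \<alpha> p (\<lambda>k. (yseq n v0 i k - v (real i / real n) k)
                              - (yseq n v0 j k - v (real j / real n) k))
             \<le> ennreal (C * real n powr (1 - 3 * \<gamma>) * real (j - i) powr \<gamma>)"
proof -
  interpret exponents "invp p" \<alpha> \<gamma>
    using assms by (intro exponents_of_inDprime)
  have FL_wn: "FLnorm \<alpha> p f = wn f" for f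
    using FLnorm_eq_wnorm[OF assms(1)] by (simp add: wn_def ana_def[abs_def])
  obtain K where "rough_equation fin nrm Xop X2op T K \<gamma>"
    using rough_equation_X[OF assms(6)] by blast
  then interpret rough_equation fin nrm Xop X2op T K \<gamma> .
  have v: "v t \<in> fin" if "0 \<le> t" "t \<le> T" for t
    using assms(8) that by (auto simp: FL_def FL_wn fin_def)
  obtain H where H: "\<And>s t. s \<in> {0..T} \<Longrightarrow> t \<in> {0..T} \<Longrightarrow>
      FLnorm \<alpha> p (\<lambda>k. v t k - v s k) \<le> ennreal (H * \<bar>t - s\<bar> powr \<gamma>)"
    using assms(9) by blast
  have holder: "nrm (v t - v s) \<le> \<bar>H\<bar> * (t - s) powr \<gamma>" if "0 \<le> s" "s \<le> t" "t \<le> T" for s t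
  proof -
    have "wn (v t - v s) \<le> ennreal (H * \<bar>t - s\<bar> powr \<gamma>)"
      using H[of s t] that by (simp add: FL_wn fun_diff_def)
    also have "\<dots> \<le> ennreal (\<bar>H\<bar> * (t - s) powr \<gamma>)"
      using that by (intro ennreal_leI mult_mono) auto
    finally show ?thesis
      by (intro wn_leD[THEN conjunct2]) auto
  qed
  define R where "R = (\<lambda>st. FLnorm \<alpha> p (\<lambda>k. v (snd st) k - v (fst st) k
                 - Xop (snd st) (fst st) (v (fst st)) (v (fst st)) k
                 - X2op (snd st) (fst st) (v (fst st)) (v (fst st)) (v (fst st)) k))"
  have R_eq: "R (s, t) = wn (v t - step t s (v s))" for s t
  proof -
    have "(\<lambda>k. v t k - v s k - Xop t s (v s) (v s) k - X2op t s (v s) (v s) (v s) k) = v t - step t s (v s)"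
      by (rule ext) (simp add: step_def algebra_simps)
    then show ?thesis
      by (simp add: R_def FL_wn)
  qed
  have lim: "((\<lambda>h. (SUP st \<in> {(s, t). s \<in> {0..T} \<and> t \<in> {0..T} \<and> \<bar>t - s\<bar> \<le> h}. R st) / ennreal h) \<longlongrightarrow> 0) (at_right 0)"
    using assms(10) unfolding R_def .
  have small: "\<exists>h>0. \<forall>s t. 0 \<le> s \<and> s \<le> t \<and> t \<le> T \<and> t - s \<le> h \<longrightarrow>
        nrm (v t - step t s (v s)) \<le> \<epsilon> * (t - s)" if eps: "0 < \<epsilon>" for \<epsilon>
  proof -
    have "\<forall>\<^sub>F h in at_right 0. (SUP st \<in> {(s, t). s \<in> {0..T} \<and> t \<in> {0..T} \<and> \<bar>t - s\<bar> \<le> h}. R st) / ennreal h < ennreal \<epsilon>"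
      using eps by (intro order_tendstoD(2)[OF lim]) auto
    then obtain b where b: "b > 0" "\<And>h. 0 < h \<Longrightarrow> h < b \<Longrightarrow>
        (SUP st \<in> {(s, t). s \<in> {0..T} \<and> t \<in> {0..T} \<and> \<bar>t - s\<bar> \<le> h}. R st) / ennreal h < ennreal \<epsilon>"
      unfolding eventually_at_right_field by blast
    \<comment> \<open>The supremum bounds the remainder over all gaps up to \<open>h\<close> by
      \<epsilon> h; taking h = t - s afterwards yields \<epsilon> (t - s).\<close>
    have le: "nrm (v t - step t s (v s)) \<le> \<epsilon> * h"
      if h: "0 < h" "h < b" and st: "0 \<le> s" "s \<le> t" "t \<le> T" "t - s \<le> h" for s t h
    proof -
      define M where "M = (SUP st \<in> {(s, t). s \<in> {0..T} \<and> t \<in> {0..T} \<and> \<bar>t - s\<bar> \<le> h}. R st)"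
      have "M = M / ennreal h * ennreal h"
        using h(1) by (simp add: ennreal_divide_times)
      also have "\<dots> \<le> ennreal \<epsilon> * ennreal h"
        using b(2)[OF h] unfolding M_def by (intro mult_right_mono) auto
      finally have "M \<le> ennreal (\<epsilon> * h)"
        using eps h by (simp add: ennreal_mult)
      moreover have "R (s, t) \<le> M"
        unfolding M_def using st by (intro SUP_upper) auto
      ultimately have "wn (v t - step t s (v s)) \<le> ennreal (\<epsilon> * h)"
        unfolding R_eq by simp
      then show ?thesis
        using eps h by (intro wn_leD[THEN conjunct2]) auto
    qed
    \<comment> \<open>h = 0 is not covered by the limit, so coinciding times are handled by letting
      h become arbitrarily small.\<close>
    have zero: "nrm (v s - step s s (v s)) \<le> 0" if "0 \<le> s" "s \<le> T" for s
    proof (rule field_le_epsilon)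
      fix e :: real assume e: "e > 0"
      define h where "h = min (b / 2) (e / \<epsilon>)"
      have h: "0 < h" "h < b" "\<epsilon> * h \<le> e"
        using b(1) e eps by (auto simp: h_def min_def field_simps)
      then show "nrm (v s - step s s (v s)) \<le> 0 + e"
        using le[of h s s] that by simp
    qed
    show ?thesis
    proof (intro exI[of _ "b / 2"] conjI allI impI)
      fix s t assume st: "0 \<le> s \<and> s \<le> t \<and> t \<le> T \<and> t - s \<le> b / 2"
      show "nrm (v t - step t s (v s)) \<le> \<epsilon> * (t - s)"
      proof (cases "s = t")
        case True
        then show ?thesis
          using zero[of s] st by simp
      next
        case False
        then show ?thesis
          using le[of "t - s" s t] st b(1) by auto
      qed
    qed (use b(1) in auto)
  qed
  obtain C n0 where C: "C \<ge> 0" and conv: "\<And>n y j. n \<ge> n0 \<Longrightarrow> y 0 = v 0 \<Longrightarrow>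
      (\<And>i. y (Suc i) = step (real (Suc i) / real n) (real i / real n) (y i)) \<Longrightarrow>
      real j / real n \<le> T \<Longrightarrow>
      y j \<in> fin \<and> nrm (y j - v (real j / real n)) \<le> C * real n powr (1 - 3 * \<gamma>)"
    using euler_convergence[OF v holder small] by blast
  have yseq_step: "yseq n v0 (Suc i) = step (real (Suc i) / real n) (real i / real n) (yseq n v0 i)" for n i
    by (rule ext) (simp add: Let_def step_def)
  show ?thesis
  \<comment> \<open>The factor 2 is the triangle inequality for the two errors;
    \<open>max n0 1\<close> keeps \<open>n\<close> positive.\<close>
  proof (intro exI[of _ "2 * C"] exI[of _ "max n0 1"] allI impI)
    fix n i j :: nat
    assume n: "max n0 1 \<le> n" and ij: "i < j \<and> real j \<le> real n * T"
    define \<Delta> where "\<Delta> = (\<lambda>i. yseq n v0 i - v (real i / real n))"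
    have npos: "real n > 0"
      using n by simp
    have le_T: "real l / real n \<le> T" if "l \<le> j" for l
    proof -
      have "real l \<le> real n * T"
        using that ij by linarith
      then show ?thesis
        using npos by (simp add: field_simps)
    qed
    have \<Delta>: "\<Delta> l \<in> fin \<and> nrm (\<Delta> l) \<le> C * real n powr (1 - 3 * \<gamma>)" if "l \<le> j" for l
      unfolding \<Delta>_def
      using conv[of n "yseq n v0" l] yseq_step n le_T[OF that] assms(7) v[OF _ le_T[OF that]]
      by (auto intro: B_diff)
    have fin: "\<Delta> i - \<Delta> j \<in> fin" and "nrm (\<Delta> i - \<Delta> j) \<le> nrm (\<Delta> i) + nrm (\<Delta> j)"
      using \<Delta>[of i] \<Delta>[of j] ij by (auto intro!: B_diff N_diff)
    then have "nrm (\<Delta> i - \<Delta> j) \<le> 2 * C * real n powr (1 - 3 * \<gamma>)"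
      using \<Delta>[of i] \<Delta>[of j] ij by auto
    also have "\<dots> \<le> 2 * C * real n powr (1 - 3 * \<gamma>) * real (j - i) powr \<gamma>"
    proof -
      have "1 \<le> real (j - i) powr \<gamma>"
        using ij gamma by (intro ge_one_powr_ge_zero) auto
      then have "2 * C * real n powr (1 - 3 * \<gamma>) * 1 \<le> 2 * C * real n powr (1 - 3 * \<gamma>) * real (j - i) powr \<gamma>"
        using C by (intro mult_left_mono) auto
      then show ?thesis
        by simp
    qed
    finally have "ennreal (nrm (\<Delta> i - \<Delta> j)) \<le> ennreal (2 * C * real n powr (1 - 3 * \<gamma>) * real (j - i) powr \<gamma>)"
      by (rule ennreal_leI)
    moreover have "FLnorm \<alpha> p (\<lambda>k. (yseq n v0 i k - v (real i / real n) k) - (yseq n v0 j k - v (real j / real n) k))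
        = wn (\<Delta> i - \<Delta> j)"
      unfolding FL_wn by (rule arg_cong[where f = wn]) (auto simp: \<Delta>_def)
    moreover have "wn (\<Delta> i - \<Delta> j) = ennreal (nrm (\<Delta> i - \<Delta> j))"
      using fin by (simp add: fin_def nrm_def)
    ultimately show "FLnorm \<alpha> p (\<lambda>k. (yseq n v0 i k - v (real i / real n) k) - (yseq n v0 j k - v (real j / real n) k))
        \<le> ennreal (2 * C * real n powr (1 - 3 * \<gamma>) * real (j - i) powr \<gamma>)"
      by simp
  qed
qed

end
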